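(* Let $A$ be a QLC algebra over a field $k$ of characteristic zero, and let $C=((qA)^{¡},\tilde\phi,\tilde\theta)$ be its Koszul dual curved coalgebra. Suppose the associated quadratic algebra $qA$ is Koszul. Then the morphism of DG algebras $g_\kappa:\boldsymbol\Omega(C)\to A$ is a quasi-isomorphism.
   Context: Conventions. $k$ has characteristic zero; gradings are homological, differentials have degree $-1$, Koszul sign rule. $sV$ is the suspension, $(sV)_i=V_{i-1}$; $s^{-1}$ the desuspension. $T^c(W)$ is the tensor coalgebra with deconcatenation. QLC algebras. A QLC datum is a non-negatively graded $V$ with a degree-homogeneous subspace $R\subset k\oplus V\oplus V^{\otimes2}$. The QLC algebra is $A=A(V,R):=T(V)/(R)$, with zero differential. It is assumed throughout that $R\cap(k\oplus V)=\{0\}$ and $(R)\cap(k\oplus V\oplus V^{\otimes2})=R$. Let $q:T(V)\to V^{\otimes2}$ be the projection, $qR:=q(R)$, and $\phi:qR\to V$, $\theta:qR\to k$ the unique degree $0$ linear maps with $R=\{x-\phi(x)+\theta(x)\mid x\in qR\}$. Put $qA:=T(V)/(qR)$. Koszul dual curved coalgebra. View $s^2qR\subset(sV)^{\otimes2}$ via $s^2(v\otimes w)=(-1)^{|v|}sv\otimes sw$. $(qA)^{¡}\subset T^c(sV)$ is the graded subcoalgebra $k\oplus sV\oplus s^2qR\oplus\cdots\oplus\bigcap_{i+2+j=n}(sV)^{\otimes i}\otimes s^2qR\otimes(sV)^{\otimes j}\oplus\cdots$. $\tilde\phi$ is the restriction to $(qA)^{¡}$ of the coderivation determined by $(qA)^{¡}\twoheadrightarrow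 s^2qR\to sV$, $s^2x\mapsto s\phi(x)$, and $\tilde\theta:(qA)^{¡}\twoheadrightarrow s^2qR\to k$, $s^2x\mapsto\theta(x)$. This is a curved DG coalgebra: $\tilde\phi^2=(\tilde\theta\otimes\mathrm{id}-\mathrm{id}\otimes\tilde\theta)\Delta$ and $\tilde\theta\tilde\phi=0$. Cobar construction. For $C=((qA)^{¡},\tilde\phi,\tilde\theta)$, $\bar C=C/k$ with reduced comultiplication $\bar\Delta(c)=c'\otimes c''$, $\boldsymbol\Omega(C)$ is the DG algebra $T(s^{-1}\bar C)$ with differential $d_0+d_1+d_2$, the derivations being determined by $d_0(s^{-1}c)=\tilde\theta(c)$, $d_1(s^{-1}c)=-s^{-1}\tilde\phi(c)$, $d_2(s^{-1}c)=-(-1)^{|c'|}s^{-1}c'\otimes s^{-1}c''$. $\kappa$ is the degree $-1$ map $(qA)^{¡}\twoheadrightarrow sV\xrightarrow{s^{-1}}V\hookrightarrow A$; $g_\kappa$ is the algebra map with $g_\kappa(s^{-1}c)=\kappa(c)$, which is a morphism of DG algebras. Koszulness. $qA$ is Koszul if the canonical algebra map $(T(s^{-1}\bar C),d_2)\to qA$ induced by $(qA)^{¡}\twoheadrightarrow sV\xrightarrow{s^{-1}}V\hookrightarrow qA$ is a quasi-isomorphism. *)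

theory Defs
  imports Complex_Main "HOL-Library.Poly_Mapping" "HOL-Algebra.QuotRing"
begin

section \<open>Free algebras\<close>

text \<open>
  Lists form the free monoid, so \<open>'a list \<Rightarrow>\<^sub>0 'k\<close> with the convolution product of
  \<^theory>\<open>HOL-Library.Poly_Mapping\<close> is the free associative \<open>'k\<close>-algebra on \<open>'a\<close>, i.e. the
  tensor algebra of the vector space with basis \<open>'a\<close>; the product is concatenation of tensors.
\<close>

instantiation list :: (type) monoid_add
begin
definition zero_list_def: "0 = []"
definition plus_list_def: "xs + ys = xs @ ys"
instance by standard (simp_all add: zero_list_def plus_list_def)
end

lemma single_Nil_one: "Poly_Mapping.single [] 1 = 1"
  by (metis single_one zero_list_def)

definition scal :: "'k::field \<Rightarrow> ('a::monoid_add \<Rightarrow>\<^sub>0 'k) \<Rightarrow> ('a \<Rightarrow>\<^sub>0 'k)" where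
  "scal c f = Poly_Mapping.single 0 c * f"

global_interpretation pm: vector_space scal
  by standard
    (simp_all add: scal_def algebra_simps single_add mult_single flip: mult.assoc)

text \<open>The component of \<open>f\<close> in the span of the basis elements satisfying \<open>P\<close>.\<close>

definition component :: "('a \<Rightarrow> bool) \<Rightarrow> ('a \<Rightarrow>\<^sub>0 'k::comm_monoid_add) \<Rightarrow> ('a \<Rightarrow>\<^sub>0 'k)" where
  "component P f =
    (\<Sum>w \<in> {w \<in> Poly_Mapping.keys f. P w}. Poly_Mapping.single w (Poly_Mapping.lookup f w))"

definition subalgebra_ring :: "'b::ring_1 set \<Rightarrow> 'b ring" where
  "subalgebra_ring S = \<lparr>carrier = S, monoid.mult = (*), one = 1, ring.zero = 0, add = (+)\<rparr>"

section \<open>Homology and quasi-isomorphisms\<close>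

definition chain_complex :: "('a, 'r) ring_scheme \<Rightarrow> ('a \<Rightarrow> 'a) \<Rightarrow> bool" where
  "chain_complex R d \<longleftrightarrow> abelian_group R \<and> d \<in> carrier R \<rightarrow> carrier R \<and>
    (\<forall>x \<in> carrier R. \<forall>y \<in> carrier R. d (x \<oplus>\<^bsub>R\<^esub> y) = d x \<oplus>\<^bsub>R\<^esub> d y) \<and>
    (\<forall>x \<in> carrier R. d (d x) = \<zero>\<^bsub>R\<^esub>)"

definition chain_map ::
  "('a, 'r) ring_scheme \<Rightarrow> ('a \<Rightarrow> 'a) \<Rightarrow> ('b, 's) ring_scheme \<Rightarrow> ('b \<Rightarrow> 'b) \<Rightarrow> ('a \<Rightarrow> 'b) \<Rightarrow> bool"
where
  "chain_map R d S e f \<longleftrightarrow> chain_complex R d \<and> chain_complex S e \<and>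
    f \<in> carrier R \<rightarrow> carrier S \<and>
    (\<forall>x \<in> carrier R. \<forall>y \<in> carrier R. f (x \<oplus>\<^bsub>R\<^esub> y) = f x \<oplus>\<^bsub>S\<^esub> f y) \<and>
    (\<forall>x \<in> carrier R. f (d x) = e (f x))"

text \<open>
  Total homology.  For graded complexes it is the direct sum of the homologies in each degree,
  and a degree-preserving map is bijective on it iff it is bijective in each degree.
\<close>

definition homology :: "('a, 'r) ring_scheme \<Rightarrow> ('a \<Rightarrow> 'a) \<Rightarrow> 'a set set" where
  "homology R d = (\<lambda>z. (d ` carrier R) +>\<^bsub>R\<^esub> z) ` {z \<in> carrier R. d z = \<zero>\<^bsub>R\<^esub>}"

text \<open>The induced map: the cosets in the union below all coincide.\<close>

definition homology_map ::
  "('b, 's) ring_scheme \<Rightarrow> ('b \<Rightarrow> 'b) \<Rightarrow> ('a \<Rightarrow> 'b) \<Rightarrow> 'a set \<Rightarrow> 'b set" where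
  "homology_map S e f X = (\<Union>z \<in> X. (e ` carrier S) +>\<^bsub>S\<^esub> f z)"

definition quasi_iso ::
  "('a, 'r) ring_scheme \<Rightarrow> ('a \<Rightarrow> 'a) \<Rightarrow> ('b, 's) ring_scheme \<Rightarrow> ('b \<Rightarrow> 'b) \<Rightarrow> ('a \<Rightarrow> 'b) \<Rightarrow> bool"
where
  "quasi_iso R d S e f \<longleftrightarrow> chain_map R d S e f \<and>
    bij_betw (homology_map S e f) (homology R d) (homology S e)"

section \<open>QLC algebras\<close>

text \<open>
  A non-negatively graded vector space \<open>V\<close> over the field \<open>'k\<close> is given by a homogeneous basis:
  a set \<open>X\<close> with a degree function \<open>deg :: 'x \<Rightarrow> nat\<close>.  A tensor is a finitely supported
  \<open>'k\<close>-valued function on words over \<open>X\<close>.  \<open>T X\<close> is the space underlying both \<open>T(V)\<close> and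
  \<open>T\<^sup>c(sV)\<close>: the word \<open>x1 \<dots> xn\<close> stands for \<open>x1 \<otimes> \<dots> \<otimes> xn\<close> in the former and for
  \<open>sx1 \<otimes> \<dots> \<otimes> sxn\<close> in the latter.  In particular \<open>s\<close> and \<open>s\<^sup>-\<^sup>1\<close> between \<open>V\<close> and \<open>sV\<close> are
  the identity on underlying spaces; only the degree of a word, \<open>vdeg\<close> or \<open>sdeg\<close>, changes.
\<close>

definition T :: "'x set \<Rightarrow> ('x list \<Rightarrow>\<^sub>0 'k::zero) set" where
  "T X = {f. Poly_Mapping.keys f \<subseteq> lists X}"

definition Tpow :: "'x set \<Rightarrow> nat \<Rightarrow> ('x list \<Rightarrow>\<^sub>0 'k::zero) set" where
  "Tpow X n = {f \<in> T X. \<forall>w \<in> Poly_Mapping.keys f. length w = n}"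

definition Tle :: "'x set \<Rightarrow> nat \<Rightarrow> ('x list \<Rightarrow>\<^sub>0 'k::zero) set" where
  "Tle X n = {f \<in> T X. \<forall>w \<in> Poly_Mapping.keys f. length w \<le> n}"

definition vdeg :: "('x \<Rightarrow> nat) \<Rightarrow> 'x list \<Rightarrow> nat" where
  "vdeg deg w = (\<Sum>x\<leftarrow>w. deg x)"

definition sdeg :: "('x \<Rightarrow> nat) \<Rightarrow> 'x list \<Rightarrow> nat" where
  "sdeg deg w = (\<Sum>x\<leftarrow>w. deg x + 1)"

abbreviation tensor_algebra :: "'x set \<Rightarrow> ('x list \<Rightarrow>\<^sub>0 'k::field) ring" where
  "tensor_algebra X \<equiv> subalgebra_ring (T X)"

abbreviation ideal_gen :: "'x set \<Rightarrow> ('x list \<Rightarrow>\<^sub>0 'k::field) set \<Rightarrow> ('x list \<Rightarrow>\<^sub>0 'k) set" where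
  "ideal_gen X R \<equiv> genideal (tensor_algebra X) R"

definition QLC_datum :: "'x set \<Rightarrow> ('x \<Rightarrow> nat) \<Rightarrow> ('x list \<Rightarrow>\<^sub>0 'k::field) set \<Rightarrow> bool" where
  "QLC_datum X deg R \<longleftrightarrow>
    pm.subspace R \<and> R \<subseteq> Tle X 2 \<and>
    (\<forall>r \<in> R. \<forall>n. component (\<lambda>w. vdeg deg w = n) r \<in> R) \<and>
    R \<inter> Tle X 1 = {0} \<and>
    ideal_gen X R \<inter> Tle X 2 = R"

definition QLC_algebra ::
  "'x set \<Rightarrow> ('x list \<Rightarrow>\<^sub>0 'k::field) set \<Rightarrow> ('x list \<Rightarrow>\<^sub>0 'k) set ring" where
  "QLC_algebra X R = tensor_algebra X Quot ideal_gen X R"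

definition q :: "('x list \<Rightarrow>\<^sub>0 'k::field) \<Rightarrow> ('x list \<Rightarrow>\<^sub>0 'k)" where
  "q = component (\<lambda>w. length w = 2)"

definition phi ::
  "'x set \<Rightarrow> ('x list \<Rightarrow>\<^sub>0 'k::field) set \<Rightarrow> ('x list \<Rightarrow>\<^sub>0 'k) \<Rightarrow> ('x list \<Rightarrow>\<^sub>0 'k)" where
  "phi X R x = (THE y. y \<in> Tpow X 1 \<and> (\<exists>t. x - y + Poly_Mapping.single [] t \<in> R))"

definition theta :: "'x set \<Rightarrow> ('x list \<Rightarrow>\<^sub>0 'k::field) set \<Rightarrow> ('x list \<Rightarrow>\<^sub>0 'k) \<Rightarrow> 'k" where
  "theta X R x = (THE t. \<exists>y \<in> Tpow X 1. x - y + Poly_Mapping.single [] t \<in> R)"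

section \<open>The Koszul dual curved coalgebra\<close>

text \<open>
  The identification \<open>s\<^sup>2(v \<otimes> w) = (-1)\<^bsup>|v|\<^esup> sv \<otimes> sw\<close>.  On underlying spaces it is an involution,
  so it also serves as \<open>s\<^sup>-\<^sup>2 : (sV)\<^bsup>\<otimes>2\<^esup> \<rightarrow> V\<^bsup>\<otimes>2\<^esup>\<close>.  Only words of length two matter.
\<close>

definition susp2 :: "('x \<Rightarrow> nat) \<Rightarrow> ('x list \<Rightarrow>\<^sub>0 'k::field) \<Rightarrow> ('x list \<Rightarrow>\<^sub>0 'k)" where
  "susp2 deg f = (\<Sum>w \<in> Poly_Mapping.keys f.
     Poly_Mapping.single w ((- 1) ^ deg (hd w) * Poly_Mapping.lookup f w))"

text \<open>Tensor product of two subspaces, inside the free algebra.\<close>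

definition tens :: "('a::monoid_add \<Rightarrow>\<^sub>0 'k::field) set \<Rightarrow> ('a \<Rightarrow>\<^sub>0 'k) set \<Rightarrow> ('a \<Rightarrow>\<^sub>0 'k) set"
  (infixr "\<oslash>" 70) where
  "U \<oslash> W = pm.span {u * w | u w. u \<in> U \<and> w \<in> W}"

definition dual_component ::
  "'x set \<Rightarrow> ('x \<Rightarrow> nat) \<Rightarrow> ('x list \<Rightarrow>\<^sub>0 'k::field) set \<Rightarrow> nat \<Rightarrow> ('x list \<Rightarrow>\<^sub>0 'k) set" where
  "dual_component X deg R n =
    {f \<in> Tpow X n. \<forall>i j. i + 2 + j = n \<longrightarrow> f \<in> Tpow X i \<oslash> (susp2 deg ` q ` R) \<oslash> Tpow X j}"

definition dual_coalg ::
  "'x set \<Rightarrow> ('x \<Rightarrow> nat) \<Rightarrow> ('x list \<Rightarrow>\<^sub>0 'k::field) set \<Rightarrow> ('x list \<Rightarrow>\<^sub>0 'k) set" where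
  "dual_coalg X deg R =
    {f \<in> T X. \<forall>n. component (\<lambda>w. length w = n) f \<in> dual_component X deg R n}"

text \<open>
  The degree \<open>-1\<close> coderivation \<open>(id \<otimes> \<gamma> \<otimes> id) \<circ> \<Delta>\<^sup>(\<^sup>3\<^sup>)\<close> with corestriction \<open>\<gamma>\<close>, where
  \<open>\<Delta>\<^sup>(\<^sup>3\<^sup>)\<close> is the iterated deconcatenation: for words \<open>u\<close>, \<open>v\<close>, the element
  \<open>map_key (\<lambda>m. u @ m @ v) f\<close> is the middle tensor factor accompanying \<open>u \<otimes> _ \<otimes> v\<close> in
  \<open>\<Delta>\<^sup>(\<^sup>3\<^sup>) f\<close>.  Formulated this way, \<open>\<gamma>\<close> is evaluated on elements of the subcoalgebra only, which
  is needed since \<open>phi\<close> and \<open>theta\<close> are meaningful on \<open>qR\<close> only.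
\<close>

definition coderivation ::
  "('x \<Rightarrow> nat) \<Rightarrow> (('x list \<Rightarrow>\<^sub>0 'k::field) \<Rightarrow> ('x list \<Rightarrow>\<^sub>0 'k)) \<Rightarrow> ('x list \<Rightarrow>\<^sub>0 'k) \<Rightarrow> ('x list \<Rightarrow>\<^sub>0 'k)"
where
  "coderivation deg \<gamma> f =
    (\<Sum>(u, v) \<in> {(u, v). \<exists>m. u @ m @ v \<in> Poly_Mapping.keys f}.
       Poly_Mapping.single u ((- 1) ^ sdeg deg u)
       * \<gamma> (Poly_Mapping.map_key (\<lambda>m. u @ m @ v) f)
       * Poly_Mapping.single v 1)"

definition phi_tilde ::
  "'x set \<Rightarrow> ('x \<Rightarrow> nat) \<Rightarrow> ('x list \<Rightarrow>\<^sub>0 'k::field) set \<Rightarrow> ('x list \<Rightarrow>\<^sub>0 'k) \<Rightarrow> ('x list \<Rightarrow>\<^sub>0 'k)" where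
  "phi_tilde X deg R = coderivation deg (\<lambda>c. phi X R (susp2 deg (q c)))"

definition theta_tilde ::
  "'x set \<Rightarrow> ('x \<Rightarrow> nat) \<Rightarrow> ('x list \<Rightarrow>\<^sub>0 'k::field) set \<Rightarrow> ('x list \<Rightarrow>\<^sub>0 'k) \<Rightarrow> 'k" where
  "theta_tilde X deg R c = theta X R (susp2 deg (q c))"

section \<open>The cobar construction\<close>

text \<open>The quotient by the coaugmentation \<open>k\<close>, realised as the complement of positive weight.\<close>

definition cbar ::
  "'x set \<Rightarrow> ('x \<Rightarrow> nat) \<Rightarrow> ('x list \<Rightarrow>\<^sub>0 'k::field) set \<Rightarrow> ('x list \<Rightarrow>\<^sub>0 'k) set" where
  "cbar X deg R = {c \<in> dual_coalg X deg R. Poly_Mapping.lookup c [] = 0}"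

text \<open>
  \<open>T(s\<^sup>-\<^sup>1 C\<^sub>+)\<close>, for \<open>C\<^sub>+\<close> the positive weight part, is the subalgebra generated by
  \<open>s\<^sup>-\<^sup>1 C\<^sub>+\<close> in the free algebra \<open>'x list list \<Rightarrow>\<^sub>0 'k\<close> whose letters are words:
  the letter \<open>w\<close> stands for \<open>s\<^sup>-\<^sup>1 w\<close> with \<open>w\<close> a (nonempty) basis word of \<open>T\<^sup>c(sV)\<close>.
\<close>

definition desusp :: "('x list \<Rightarrow>\<^sub>0 'k::field) \<Rightarrow> ('x list list \<Rightarrow>\<^sub>0 'k)" where
  "desusp c = (\<Sum>w \<in> Poly_Mapping.keys c. Poly_Mapping.single [w] (Poly_Mapping.lookup c w))"

definition cobar_carrier ::
  "'x set \<Rightarrow> ('x \<Rightarrow> nat) \<Rightarrow> ('x list \<Rightarrow>\<^sub>0 'k::field) set \<Rightarrow> ('x list list \<Rightarrow>\<^sub>0 'k) set" where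
  "cobar_carrier X deg R = pm.span {prod_list (map desusp cs) | cs. cs \<in> lists (cbar X deg R)}"

definition cobar ::
  "'x set \<Rightarrow> ('x \<Rightarrow> nat) \<Rightarrow> ('x list \<Rightarrow>\<^sub>0 'k::field) set \<Rightarrow> ('x list list \<Rightarrow>\<^sub>0 'k) ring" where
  "cobar X deg R = subalgebra_ring (cobar_carrier X deg R)"

text \<open>The truncated subtraction is harmless, as only nonempty words occur as letters.\<close>

definition cobar_deg :: "('x \<Rightarrow> nat) \<Rightarrow> 'x list list \<Rightarrow> nat" where
  "cobar_deg deg W = (\<Sum>w\<leftarrow>W. sdeg deg w - 1)"

text \<open>
  The degree \<open>-1\<close> derivation with \<open>s\<^sup>-\<^sup>1 c \<mapsto> g c\<close>.  For each pair of words \<open>P\<close>, \<open>Q\<close> the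
  element \<open>map_key (\<lambda>w. P @ [w] @ Q) f\<close> is the tensor factor occurring between \<open>P\<close> and \<open>Q\<close>
  in \<open>f\<close>; again \<open>g\<close> is evaluated on elements of the coalgebra only.  The lemmas below give
  the values on generators and on monomials.
\<close>

definition derivation ::
  "('x \<Rightarrow> nat) \<Rightarrow> (('x list \<Rightarrow>\<^sub>0 'k::field) \<Rightarrow> ('x list list \<Rightarrow>\<^sub>0 'k))
    \<Rightarrow> ('x list list \<Rightarrow>\<^sub>0 'k) \<Rightarrow> ('x list list \<Rightarrow>\<^sub>0 'k)"
where
  "derivation deg g f =
    (\<Sum>(P, Q) \<in> {(P, Q). \<exists>w. P @ [w] @ Q \<in> Poly_Mapping.keys f}.
       Poly_Mapping.single P ((- 1) ^ cobar_deg deg P)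
       * g (Poly_Mapping.map_key (\<lambda>w. P @ [w] @ Q) f)
       * Poly_Mapping.single Q 1)"

lemma lookup_desusp:
  "Poly_Mapping.lookup (desusp c) W = (case W of [w] \<Rightarrow> Poly_Mapping.lookup c w | _ \<Rightarrow> 0)"
proof -
  have "Poly_Mapping.lookup (desusp c) W =
      (\<Sum>w \<in> Poly_Mapping.keys c. if [w] = W then Poly_Mapping.lookup c w else 0)"
    unfolding desusp_def by (simp add: lookup_sum lookup_single when_def)
  also have "\<dots> = (case W of [w] \<Rightarrow> Poly_Mapping.lookup c w | _ \<Rightarrow> 0)"
    by (auto simp: sum.delta' in_keys_iff split: list.split)
  finally show ?thesis .
qed

lemma derivation_desusp:
  assumes "g 0 = 0"
  shows "derivation deg g (desusp c) = g c"
proof (cases "c = 0")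
  case True
  then show ?thesis by (simp add: derivation_def desusp_def assms)
next
  case False
  then obtain w where w: "Poly_Mapping.lookup c w \<noteq> 0"
    by (metis lookup_zero poly_mapping_eqI)
  have keys: "W \<in> Poly_Mapping.keys (desusp c) \<longleftrightarrow>
      (\<exists>w. W = [w] \<and> Poly_Mapping.lookup c w \<noteq> 0)" for W
    by (auto simp: in_keys_iff lookup_desusp split: list.splits)
  have "{(P, Q). \<exists>w. P @ [w] @ Q \<in> Poly_Mapping.keys (desusp c)} = {([], [])}"
    using w by (auto simp: keys append_eq_Cons_conv)
  moreover have "Poly_Mapping.map_key (\<lambda>w. [w]) (desusp c) = c"
    by (rule poly_mapping_eqI) (simp add: map_key.rep_eq inj_def lookup_desusp)
  ultimately show ?thesis by (simp add: derivation_def cobar_deg_def single_Nil_one)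
qed

lemma derivation_monomial:
  assumes "g 0 = 0"
  shows "derivation deg g (Poly_Mapping.single W a) =
    (\<Sum>i<length W. Poly_Mapping.single (take i W) ((- 1) ^ cobar_deg deg (take i W))
       * g (Poly_Mapping.single (W ! i) a) * Poly_Mapping.single (drop (Suc i) W) 1)"
proof (cases "a = 0")
  case True
  then show ?thesis by (simp add: derivation_def assms)
next
  case False
  let ?h = "\<lambda>i. (take i W, drop (Suc i) W)"
  have inj: "inj_on ?h {..<length W}"
    by (rule inj_onI) (metis (no_types, lifting) Pair_inject length_take lessThan_iff min.absorb4)
  have img: "{(P, Q). \<exists>w. P @ [w] @ Q \<in> Poly_Mapping.keys (Poly_Mapping.single W a)}
      = ?h ` {..<length W}"
  proof -
    have "(P, Q) \<in> ?h ` {..<length W}" if "P @ [w] @ Q = W" for P Q w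
      using that by (intro image_eqI[of _ _ "length P"]) auto
    moreover have "take i W @ [W ! i] @ drop (Suc i) W = W" if "i < length W" for i
      using that by (simp add: id_take_nth_drop[symmetric])
    ultimately show ?thesis using False by auto blast
  qed
  have slice: "Poly_Mapping.map_key (\<lambda>w. take i W @ [w] @ drop (Suc i) W) (Poly_Mapping.single W a)
      = Poly_Mapping.single (W ! i) a" if "i < length W" for i
  proof (rule poly_mapping_eqI)
    fix w
    have "W = take i W @ [w] @ drop (Suc i) W \<longleftrightarrow> W ! i = w"
      using that id_take_nth_drop[OF that]
      by (metis append_Cons append_Nil list.inject same_append_eq)
    then show "Poly_Mapping.lookup (Poly_Mapping.map_key (\<lambda>w. take i W @ [w] @ drop (Suc i) W)
        (Poly_Mapping.single W a)) w = Poly_Mapping.lookup (Poly_Mapping.single (W ! i) a) w"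
      by (simp add: map_key.rep_eq inj_def lookup_single when_def)
  qed
  show ?thesis
    unfolding derivation_def img
    by (subst sum.reindex[OF inj]) (auto intro!: sum.cong simp: slice[simplified])
qed

definition d0 ::
  "'x set \<Rightarrow> ('x \<Rightarrow> nat) \<Rightarrow> ('x list \<Rightarrow>\<^sub>0 'k::field) set \<Rightarrow> ('x list list \<Rightarrow>\<^sub>0 'k) \<Rightarrow> ('x list list \<Rightarrow>\<^sub>0 'k)"
where
  "d0 X deg R = derivation deg (\<lambda>c. Poly_Mapping.single [] (theta_tilde X deg R c))"

definition d1 ::
  "'x set \<Rightarrow> ('x \<Rightarrow> nat) \<Rightarrow> ('x list \<Rightarrow>\<^sub>0 'k::field) set \<Rightarrow> ('x list list \<Rightarrow>\<^sub>0 'k) \<Rightarrow> ('x list list \<Rightarrow>\<^sub>0 'k)"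
where
  "d1 X deg R = derivation deg (\<lambda>c. - desusp (phi_tilde X deg R c))"

definition d2 :: "('x \<Rightarrow> nat) \<Rightarrow> ('x list list \<Rightarrow>\<^sub>0 'k::field) \<Rightarrow> ('x list list \<Rightarrow>\<^sub>0 'k)" where
  "d2 deg = derivation deg (\<lambda>c. \<Sum>w \<in> Poly_Mapping.keys c.
     \<Sum>(u, v) \<in> {(u, v). u \<noteq> [] \<and> v \<noteq> [] \<and> u @ v = w}.
       Poly_Mapping.single [u, v] (- ((- 1) ^ sdeg deg u) * Poly_Mapping.lookup c w))"

definition cobar_diff ::
  "'x set \<Rightarrow> ('x \<Rightarrow> nat) \<Rightarrow> ('x list \<Rightarrow>\<^sub>0 'k::field) set \<Rightarrow> ('x list list \<Rightarrow>\<^sub>0 'k) \<Rightarrow> ('x list list \<Rightarrow>\<^sub>0 'k)"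
where
  "cobar_diff X deg R f = d0 X deg R f + d1 X deg R f + d2 deg f"

text \<open>
  \<open>kappa\<close> projects \<open>T\<^sup>c(sV)\<close> onto \<open>sV \<cong> V\<close>, and \<open>g_lift\<close> is the algebra map
  into \<open>T(V)\<close> with \<open>s\<^sup>-\<^sup>1 w \<mapsto> kappa w\<close>; \<open>g_kappa\<close> composes it with the projection to \<open>T(V)/(R)\<close>.
\<close>

definition kappa :: "'x list \<Rightarrow> ('x list \<Rightarrow>\<^sub>0 'k::field)" where
  "kappa w = (if length w = 1 then Poly_Mapping.single w 1 else 0)"

definition g_lift :: "('x list list \<Rightarrow>\<^sub>0 'k::field) \<Rightarrow> ('x list \<Rightarrow>\<^sub>0 'k)" where
  "g_lift f =
    (\<Sum>W \<in> Poly_Mapping.keys f. scal (Poly_Mapping.lookup f W) (prod_list (map kappa W)))"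

definition g_kappa ::
  "'x set \<Rightarrow> ('x list \<Rightarrow>\<^sub>0 'k::field) set \<Rightarrow> ('x list list \<Rightarrow>\<^sub>0 'k) \<Rightarrow> ('x list \<Rightarrow>\<^sub>0 'k) set" where
  "g_kappa X R f = ideal_gen X R +>\<^bsub>tensor_algebra X\<^esub> g_lift f"

text \<open>
  Koszulness of \<open>qA = T(V)/(qR)\<close>.  The graded coalgebra underlying \<open>C\<close>, hence the
  algebra \<open>cobar X deg R\<close>, depends on \<open>qR\<close> only.
\<close>

definition qA_Koszul :: "'x set \<Rightarrow> ('x \<Rightarrow> nat) \<Rightarrow> ('x list \<Rightarrow>\<^sub>0 'k::field) set \<Rightarrow> bool" where
  "qA_Koszul X deg R \<longleftrightarrow>
    quasi_iso (cobar X deg R) (d2 deg)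
      (QLC_algebra X (q ` R)) (\<lambda>_. \<zero>\<^bsub>QLC_algebra X (q ` R)\<^esub>) (g_kappa X (q ` R))"

end

theory Submission
  imports Defs
begin

text \<open>
  The comparison map is a quasi-isomorphism because of one grading.  Give a tensor product of
  \<open>n\<close> desuspended elements of total weight \<open>p\<close> the syzygy degree \<open>p - n\<close>.  All three parts
  of the differential lower it by exactly one: \<open>d\<^sub>2\<close> raises \<open>n\<close>, \<open>d\<^sub>1\<close> lowers \<open>p\<close>, and \<open>d\<^sub>0\<close>
  lowers \<open>p\<close> by two and \<open>n\<close> by one.  In syzygy degree zero the cobar construction is \<open>T(V)\<close>, and
  the boundaries there form the two-sided ideal generated by the elements \<open>x - \<phi>(x) + \<theta>(x)\<close>
  (\<open>emb_relation_boundary\<close> and \<open>g_lift_der_gen\<close>).  So the homology in degree zero is \<open>A\<close>.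

  It remains to see that the homology vanishes in positive syzygy degree.  Koszulness of \<open>qA\<close> says
  this for the differential \<open>d\<^sub>2\<close>.  Since \<open>d\<^sub>2\<close> preserves the weight while \<open>d\<^sub>0\<close> and \<open>d\<^sub>1\<close> lower
  it, the component of highest weight of a cycle is a \<open>d\<^sub>2\<close>-cycle, hence a \<open>d\<^sub>2\<close>-boundary;
  subtracting the full boundary of a primitive lowers the weight, and this terminates
  (\<open>gen_exact\<close>).

  The other half of the work is to show that the differential is defined and squares to zero
  (\<open>gen_gen\<close>).  Its square is a derivation, so only desuspended elements \<open>c\<close> of the dual coalgebra
  matter (\<open>der_gen_gen\<close>).  The identity \<open>d\<^sub>2\<^sup>2 = 0\<close> is part of the Koszulness assumption, and
  \<open>d\<^sub>1 d\<^sub>2 + d\<^sub>2 d\<^sub>1 = 0\<close> expresses that \<open>\<phi>\<close> induces a coderivation (\<open>coder2_gen2\<close>).  The rest is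
  the curved coalgebra structure.  In weight three an element of the coalgebra is a combination of
  relations in two ways; replacing the quadratic relations by the full ones and subtracting gives
  an element of the ideal \<open>(R)\<close> of length at most two, which lies in \<open>R\<close> by assumption, and
  reading off its components yields all the identities (\<open>weight3_identities\<close>).  They spread to
  all weights because the square of the coderivation minus the curvature is a sum over subwords of
  length three (\<open>phl_phl\<close>).

  Two devices make the computations finite.  The maps \<open>\<phi>\<close> and \<open>\<theta>\<close>, which make sense on \<open>qR\<close>
  only, are extended to degree-preserving linear maps on all words of length two
  (\<open>homogeneous_extensions\<close>); sign computations then become identities between linear maps, checked
  word by word.  Membership in the dual coalgebra is expressed by slices, the coefficients of a
  tensor with respect to outer words \<open>u\<close> and \<open>v\<close> (\<open>dual_coalg_iff\<close>).
\<close>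

section \<open>Linear maps between free modules\<close>

abbreviation lookup :: "('a \<Rightarrow>\<^sub>0 'k::zero) \<Rightarrow> 'a \<Rightarrow> 'k" where
  "lookup \<equiv> Poly_Mapping.lookup"

abbreviation keys :: "('a \<Rightarrow>\<^sub>0 'k::zero) \<Rightarrow> 'a set" where
  "keys \<equiv> Poly_Mapping.keys"

abbreviation single :: "'a \<Rightarrow> 'k \<Rightarrow> ('a \<Rightarrow>\<^sub>0 'k::zero)" where
  "single \<equiv> Poly_Mapping.single"

abbreviation mon :: "'a \<Rightarrow> ('a \<Rightarrow>\<^sub>0 'k::zero_neq_one)" where
  "mon w \<equiv> single w 1"

abbreviation plin ::
  "(('a::monoid_add \<Rightarrow>\<^sub>0 'k::field) \<Rightarrow> ('b::monoid_add \<Rightarrow>\<^sub>0 'k)) \<Rightarrow> bool" where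
  "plin F \<equiv> Vector_Spaces.linear scal scal F"

lemma lookup_scal [simp]: "lookup (scal c f) w = c * lookup f w"
  by (simp add: scal_def mult_map_scale_conv_mult[symmetric] Poly_Mapping.map.rep_eq when_def)

lemma scal_single [simp]: "scal c (single w a) = single w (c * a)"
  by (rule poly_mapping_eqI) (simp add: lookup_single when_def)

lemma single_scal_mon: "single w (a::'k::field) = scal a (mon w)"
  by simp

lemma mon_mult [simp]: "mon u * mon v = (mon (u @ v) :: 'a list \<Rightarrow>\<^sub>0 'k::field)"
  by (simp add: mult_single plus_list_def)

lemma mon_Nil [simp]: "mon [] = (1 :: 'a list \<Rightarrow>\<^sub>0 'k::field)"
  by (rule single_Nil_one)

lemma plinI:
  assumes "\<And>x y. F (x + y) = F x + F y" and "\<And>c x. F (scal c x) = scal c (F x)"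
  shows "plin F"
  unfolding Vector_Spaces.linear_iff using assms by (simp add: pm.vector_space_axioms)

lemma plin_add: "plin F \<Longrightarrow> F (x + y) = F x + F y"
  and plin_scal: "plin F \<Longrightarrow> F (scal c x) = scal c (F x)"
  by (simp_all add: Vector_Spaces.linear_iff)

lemma plin_0: "plin F \<Longrightarrow> F 0 = 0"
  using plin_scal[of F 0 0] by simp

lemma plin_neg: "plin F \<Longrightarrow> F (- x) = - F x"
  using plin_scal[of F "- 1" x] by simp

lemma plin_diff: "plin F \<Longrightarrow> F (x - y) = F x - F y"
  using plin_add[of F x "- y"] plin_neg[of F y] by simp

lemma plin_sum: "plin F \<Longrightarrow> F (\<Sum>i\<in>A. f i) = (\<Sum>i\<in>A. F (f i))"
  by (induction A rule: infinite_finite_induct) (simp_all add: plin_0 plin_add)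

lemma poly_mapping_expand:
  "f = (\<Sum>w\<in>keys f. scal (lookup f w) (mon w))"
  for f :: "'a::monoid_add \<Rightarrow>\<^sub>0 'k::field"
  by (rule poly_mapping_eqI)
    (simp add: lookup_sum lookup_single when_def sum.delta' in_keys_iff)

lemma plin_expand:
  assumes "plin F"
  shows "F f = (\<Sum>w\<in>keys f. scal (lookup f w) (F (mon w)))"
  using arg_cong[OF poly_mapping_expand[of f], of F]
  by (simp only: plin_sum[OF assms] plin_scal[OF assms])

lemma plin_eq_on:
  assumes "plin F" "plin G" "\<And>w. w \<in> keys f \<Longrightarrow> F (mon w) = G (mon w)"
  shows "F f = G f"
  unfolding plin_expand[OF assms(1), of f] plin_expand[OF assms(2), of f]
  using assms(3) by (intro sum.cong) simp_all

lemma plin_eq: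
  assumes "plin F" "plin G" "\<And>w. F (mon w) = G (mon w)"
  shows "F f = G f"
  using assms by (rule plin_eq_on)

definition lin :: "('a::monoid_add \<Rightarrow> ('b::monoid_add \<Rightarrow>\<^sub>0 'k::field)) \<Rightarrow> ('a \<Rightarrow>\<^sub>0 'k) \<Rightarrow> ('b \<Rightarrow>\<^sub>0 'k)" where
  "lin h f = (\<Sum>w\<in>keys f. scal (lookup f w) (h w))"

lemma lin_superset:
  assumes "finite A" "keys f \<subseteq> A"
  shows "lin h f = (\<Sum>w\<in>A. scal (lookup f w) (h w))"
  unfolding lin_def using assms
  by (intro sum.mono_neutral_left) (auto simp: in_keys_iff)

lemma lin_add: "lin h (f + g) = lin h f + lin h g"
proof -
  let ?A = "keys f \<union> keys g"
  have "keys (f + g) \<subseteq> ?A" by (rule keys_add)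
  then show ?thesis
    by (simp add: lin_superset[of ?A] lookup_add pm.scale_left_distrib sum.distrib)
qed

lemma lin_single [simp]: "lin h (single w a) = scal a (h w)"
  by (simp add: lin_def)

lemma lin_0 [simp]: "lin h 0 = 0"
  by (simp add: lin_def)

lemma lin_scal: "lin h (scal c f) = scal c (lin h f)"
proof -
  have "keys (scal c f) \<subseteq> keys f" by (auto simp: in_keys_iff)
  then show ?thesis
    by (simp add: lin_superset[of "keys f"] pm.scale_sum_right)
qed

lemma scal_mult_left: "scal c (x * y) = scal c x * y"
  by (simp add: scal_def mult.assoc)

lemma plin_lin: "plin (lin h)"
  by (intro plinI lin_add lin_scal)

lemma scal_commute: "x * single 0 c = scal c x"
  for x :: "'a::monoid_add \<Rightarrow>\<^sub>0 'k::field"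
proof -
  have "plin (\<lambda>x. x * single 0 c)"
    by (rule plinI) (simp_all add: distrib_right scal_mult_left)
  moreover have "plin (scal c :: ('a \<Rightarrow>\<^sub>0 'k) \<Rightarrow> _)"
    by (rule plinI) (simp_all add: pm.scale_right_distrib mult.commute)
  ultimately show ?thesis
    by (rule plin_eq) (simp add: mult_single)
qed

lemma scal_mult_right: "scal c (x * y) = x * scal c y"
  for x :: "'a::monoid_add \<Rightarrow>\<^sub>0 'k::field"
  by (metis scal_commute mult.assoc)

text \<open>Most identities below are linear in one argument.  These rules discharge the linearity, so
  that by \<open>plin_eq\<close> only basis elements have to be compared.\<close>

named_theorems plin_intros

lemma plin_id [plin_intros]: "plin (\<lambda>x. x)"
  by (rule plinI) simp_all

lemma plin_comp_lin [plin_intros]: "plin F \<Longrightarrow> plin (\<lambda>x. lin h (F x))"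
  by (rule plinI) (simp_all add: lin_add lin_scal plin_add plin_scal)

lemma plin_comp_add [plin_intros]: "plin F \<Longrightarrow> plin G \<Longrightarrow> plin (\<lambda>x. F x + G x)"
  by (rule plinI) (simp_all add: plin_add plin_scal pm.scale_right_distrib)

lemma plin_comp_diff [plin_intros]: "plin F \<Longrightarrow> plin G \<Longrightarrow> plin (\<lambda>x. F x - G x)"
  by (rule plinI) (simp_all add: plin_add plin_scal pm.scale_right_diff_distrib)

lemma plin_comp_neg [plin_intros]: "plin F \<Longrightarrow> plin (\<lambda>x. - F x)"
  by (rule plinI) (simp_all add: plin_add plin_scal)

lemma plin_comp_scal [plin_intros]: "plin F \<Longrightarrow> plin (\<lambda>x. scal c (F x))"
  by (rule plinI) (simp_all add: plin_add plin_scal pm.scale_right_distrib mult.commute)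

lemma plin_comp_mult_left [plin_intros]: "plin F \<Longrightarrow> plin (\<lambda>x. a * F x)"
  by (rule plinI) (simp_all add: plin_add plin_scal distrib_left scal_mult_right)

lemma plin_comp_mult_right [plin_intros]: "plin F \<Longrightarrow> plin (\<lambda>x. F x * a)"
  by (rule plinI) (simp_all add: plin_add plin_scal distrib_right scal_mult_left)

lemma plin_comp_sum [plin_intros]:
  "(\<And>i. i \<in> A \<Longrightarrow> plin (F i)) \<Longrightarrow> plin (\<lambda>x. \<Sum>i\<in>A. F i x)"
  by (rule plinI) (simp_all add: plin_add plin_scal sum.distrib pm.scale_sum_right cong: sum.cong)

lemma lin_diff: "lin h (f - g) = lin h f - lin h g"
  by (rule plin_diff[OF plin_lin])

lemma lin_sum: "lin h (\<Sum>i\<in>A. f i) = (\<Sum>i\<in>A. lin h (f i))"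
  by (rule plin_sum[OF plin_lin])

lemma lin_eq_0: "(\<And>w. w \<in> keys f \<Longrightarrow> h w = 0) \<Longrightarrow> lin h f = 0"
  by (simp add: lin_def)

lemma keys_lin: "keys (lin h f) \<subseteq> (\<Union>w\<in>keys f. keys (h w))"
  unfolding lin_def by (rule order_trans[OF keys_sum]) (fastforce simp: in_keys_iff)

lemma lookup_component [simp]:
  "lookup (component P f) w = (if P w then lookup f w else 0)"
  unfolding component_def
  by (simp add: lookup_sum lookup_single when_def sum.delta' in_keys_iff)

lemma plin_component: "plin (component P)"
  by (rule plinI) (auto intro!: poly_mapping_eqI simp: lookup_add)

section \<open>Slices and sums over subwords\<close>

text \<open>The middle tensor factor accompanying \<open>u \<otimes> _ \<otimes> v\<close> in the twofold deconcatenation of \<open>f\<close>.\<close>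

definition slice :: "'a list \<Rightarrow> 'a list \<Rightarrow> ('a list \<Rightarrow>\<^sub>0 'k::zero) \<Rightarrow> ('a list \<Rightarrow>\<^sub>0 'k)" where
  "slice u v f = Poly_Mapping.map_key (\<lambda>m. u @ m @ v) f"

lemma lookup_slice [simp]: "lookup (slice u v f) m = lookup f (u @ m @ v)"
  by (simp add: slice_def map_key.rep_eq inj_def)

lemma plin_slice: "plin (slice u v)"
  by (rule plinI) (auto intro!: poly_mapping_eqI simp: lookup_add)

lemma plin_comp_slice [plin_intros]: "plin F \<Longrightarrow> plin (\<lambda>x. slice u v (F x))"
  by (rule plinI) (simp_all add: plin_add plin_scal plin_add[OF plin_slice] plin_scal[OF plin_slice])

lemma slice_slice [simp]: "slice u v (slice u' v' f) = slice (u' @ u) (v @ v') f"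
  by (rule poly_mapping_eqI) simp

lemma slice_Nil [simp]: "slice [] [] f = f"
  by (rule poly_mapping_eqI) simp

lemma slice_mon: "slice u v (mon (u @ m @ v)) = mon m"
  by (rule poly_mapping_eqI) (simp add: lookup_single when_def)

lemma slice_mon_Cons: "slice (x # u) v (mon (y # w)) = (if x = y then slice u v (mon w) else 0)"
  by (auto intro!: poly_mapping_eqI simp: lookup_single when_def)

text \<open>The pairs of outer words along which \<open>f\<close> can have a nonzero slice.\<close>

definition frames :: "('a list \<Rightarrow>\<^sub>0 'k::zero) \<Rightarrow> ('a list \<times> 'a list) set" where
  "frames f = {(u, v). \<exists>m. u @ m @ v \<in> keys f}"

lemma finite_frames [simp]: "finite (frames f)"
proof -
  have "frames f \<subseteq> (\<Union>w\<in>keys f.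
      (\<lambda>i. take i w) ` {..length w} \<times> (\<lambda>i. drop i w) ` {..length w})"
  proof (clarsimp simp: frames_def)
    fix u m v assume "u @ m @ v \<in> keys f"
    moreover have "u = take (length u) (u @ m @ v)" "length u \<le> length (u @ m @ v)"
      "v = drop (length (u @ m)) (u @ m @ v)" "length (u @ m) \<le> length (u @ m @ v)"
      by simp_all
    ultimately show "\<exists>w\<in>keys f. u \<in> (\<lambda>i. take i w) ` {..length w} \<and>
        v \<in> (\<lambda>i. drop i w) ` {..length w}"
      by blast
  qed
  then show ?thesis by (rule finite_subset) simp
qed

lemma slice_not_frames: "(u, v) \<notin> frames f \<Longrightarrow> slice u v f = 0"
  by (rule poly_mapping_eqI) (auto simp: frames_def in_keys_iff)

text \<open>
  If \<open>\<chi>\<close> is the Koszul sign, this is the coderivation of the deconcatenation coalgebra with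
  corestriction \<open>lin h\<close>; for \<open>\<chi> = 1\<close> it is the corresponding operator of even degree.  On words
  whose letters are words, with \<open>h\<close> supported on words of length one, it is a derivation of the
  tensor algebra.
\<close>

definition window ::
  "('a list \<Rightarrow> 'k::field) \<Rightarrow> ('a list \<Rightarrow> ('a list \<Rightarrow>\<^sub>0 'k)) \<Rightarrow> ('a list \<Rightarrow>\<^sub>0 'k) \<Rightarrow> ('a list \<Rightarrow>\<^sub>0 'k)" where
  "window \<chi> h f = (\<Sum>(u, v)\<in>frames f. single u (\<chi> u) * lin h (slice u v f) * mon v)"

lemma window_superset:
  assumes "finite J" "frames f \<subseteq> J"
  shows "window \<chi> h f = (\<Sum>(u, v)\<in>J. single u (\<chi> u) * lin h (slice u v f) * mon v)"
  unfolding window_def using assms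
  by (intro sum.mono_neutral_left) (auto simp: slice_not_frames)

lemma plin_window: "plin (window \<chi> h)"
  for h :: "'a list \<Rightarrow> ('a list \<Rightarrow>\<^sub>0 'k::field)"
proof (rule plinI)
  fix f g :: "'a list \<Rightarrow>\<^sub>0 'k" and c
  have "frames (f + g) \<subseteq> frames f \<union> frames g"
    using keys_add[of f g] by (auto simp: frames_def)
  then show "window \<chi> h (f + g) = window \<chi> h f + window \<chi> h g"
    by (simp add: window_superset[of "frames f \<union> frames g"] split_def plin_add[OF plin_slice]
        lin_add algebra_simps sum.distrib)
  have "frames (scal c f) \<subseteq> frames f" by (auto simp: frames_def in_keys_iff)
  then show "window \<chi> h (scal c f) = scal c (window \<chi> h f)"
    by (simp add: window_superset[of "frames f"] split_def plin_scal[OF plin_slice]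
        lin_scal pm.scale_sum_right scal_mult_right[symmetric] scal_mult_left[symmetric])
qed

lemma window_Nil:
  assumes "h [] = 0"
  shows "window \<chi> h (mon []) = 0"
  unfolding window_def
proof (rule sum.neutral, clarify)
  fix u v assume "(u, v) \<in> frames (mon [] :: 'a list \<Rightarrow>\<^sub>0 'b)"
  then have "u = []" "v = []" by (auto simp: frames_def zero_list_def)
  then show "single u (\<chi> u) * lin h (slice u v (mon [])) * mon v = 0"
    using assms by (simp del: mon_Nil)
qed

text \<open>When \<open>h\<close> is supported on words of one length \<open>n\<close>, the only subword starting at the first
  letter that contributes is the prefix of length \<open>n\<close>.  This turns the sum over all subwords into a
  recursion along the word, which is how it is used throughout.\<close>

lemma window_Cons:
  assumes h: "\<And>m. length m \<noteq> n \<Longrightarrow> h m = 0"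
    and \<chi>: "\<chi> [] = 1" "\<And>u. \<chi> (x # u) = \<chi> [x] * \<chi> u"
  shows "window \<chi> h (mon (x # w)) =
    (if n \<le> length (x # w) then h (take n (x # w)) * mon (drop n (x # w)) else 0)
    + scal (\<chi> [x]) (mon [x] * window \<chi> h (mon w))"
proof -
  let ?t = "\<lambda>w (u, v). single u (\<chi> u) * lin h (slice u v (mon w)) * mon v"
  define V where "V = {v. \<exists>m. m @ v = x # w}"
  have fr: "(u, v) \<in> frames (mon w :: _ \<Rightarrow>\<^sub>0 'b) \<longleftrightarrow> (\<exists>m. u @ m @ v = w)" for u v w :: "'a list"
    by (simp add: frames_def)
  have split: "frames (mon (x # w) :: _ \<Rightarrow>\<^sub>0 'b) = Pair [] ` V \<union>
      (\<lambda>(u, v). (x # u, v)) ` frames (mon w :: _ \<Rightarrow>\<^sub>0 'b)"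
  proof (intro equalityI subsetI)
    fix p assume p: "p \<in> frames (mon (x # w) :: _ \<Rightarrow>\<^sub>0 'b)"
    obtain u v where uv: "p = (u, v)" by (cases p)
    from p obtain m where *: "u @ m @ v = x # w" unfolding uv fr by (elim exE)
    show "p \<in> Pair [] ` V \<union> (\<lambda>(u, v). (x # u, v)) ` frames (mon w :: _ \<Rightarrow>\<^sub>0 'b)"
    proof (cases u)
      case Nil
      have "v \<in> V" using * Nil unfolding V_def by (intro CollectI exI[of _ m]) simp
      then show ?thesis unfolding uv Nil by (intro UnI1 imageI)
    next
      case (Cons y u')
      then have "(u', v) \<in> frames (mon w :: _ \<Rightarrow>\<^sub>0 'b)" "p = (x # u', v)"
        using uv * exI[of "\<lambda>m. u' @ m @ v = w" m] by (simp_all add: fr)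
      then show ?thesis by (intro UnI2 image_eqI[of _ _ "(u', v)"]) simp_all
    qed
  next
    fix p assume "p \<in> Pair [] ` V \<union> (\<lambda>(u, v). (x # u, v)) ` frames (mon w :: _ \<Rightarrow>\<^sub>0 'b)"
    then show "p \<in> frames (mon (x # w) :: _ \<Rightarrow>\<^sub>0 'b)"
    proof (elim UnE imageE)
      fix v assume "p = ([], v)" "v \<in> V"
      then show ?thesis by (auto simp: fr V_def)
    next
      fix uv assume *: "p = (case uv of (u, v) \<Rightarrow> (x # u, v))" "uv \<in> frames (mon w :: _ \<Rightarrow>\<^sub>0 'b)"
      obtain u v where "uv = (u, v)" by (cases uv)
      with * show ?thesis by (auto simp: fr)
    qed
  qed
  have fin: "finite V"
  proof (rule finite_subset)
    show "V \<subseteq> snd ` frames (mon (x # w) :: _ \<Rightarrow>\<^sub>0 'b)" by (force simp: fr V_def intro: image_eqI[of _ _ "([], _)"])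
  qed (rule finite_imageI[OF finite_frames])
  have "window \<chi> h (mon (x # w)) = (\<Sum>p\<in>Pair [] ` V. ?t (x # w) p) +
      (\<Sum>p\<in>(\<lambda>(u, v). (x # u, v)) ` frames (mon w :: _ \<Rightarrow>\<^sub>0 'b). ?t (x # w) p)"
    unfolding window_def split using fin by (intro sum.union_disjoint) auto
  also have "(\<Sum>p\<in>Pair [] ` V. ?t (x # w) p) = (\<Sum>v\<in>V. lin h (slice [] v (mon (x # w))) * mon v)"
    by (subst sum.reindex) (auto simp: inj_on_def \<chi>)
  also have "\<dots> = (\<Sum>v\<in>V. if v = drop n (x # w) \<and> n \<le> length (x # w)
      then h (take n (x # w)) * mon (drop n (x # w)) else 0)"
  proof (intro sum.cong refl)
    fix v assume "v \<in> V"
    then obtain m where m: "m @ v = x # w" by (auto simp: V_def)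
    have sl: "slice [] v (mon (x # w) :: _ \<Rightarrow>\<^sub>0 'b) = mon m"
      using slice_mon[of "[]" v m] m by simp
    have "length m = n" if *: "v = drop n (x # w) \<and> n \<le> length (x # w)"
    proof -
      from m have "length m + length v = length (x # w)" by (metis length_append)
      moreover have "length v = length (x # w) - n" using * by simp
      ultimately show "length m = n" using * by linarith
    qed
    moreover have "v = drop n (x # w) \<and> n \<le> length (x # w) \<and> take n (x # w) = m" if "length m = n"
      using that unfolding m[symmetric] by simp
    ultimately have iff: "v = drop n (x # w) \<and> n \<le> length (x # w) \<longleftrightarrow> length m = n"
      and tk: "length m = n \<Longrightarrow> take n (x # w) = m" "length m = n \<Longrightarrow> v = drop n (x # w)" by blast+
    show "lin h (slice [] v (mon (x # w))) * mon v = (if v = drop n (x # w) \<and> n \<le> length (x # w)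
      then h (take n (x # w)) * mon (drop n (x # w)) else 0)"
    proof (cases "length m = n")
      case True
      have "h m * mon v = h (take n (x # w)) * mon (drop n (x # w))"
        unfolding tk(1)[OF True] tk(2)[OF True, symmetric] by (rule refl)
      then show ?thesis unfolding sl iff lin_single pm.scale_one if_P[OF True] .
    next
      case False
      show ?thesis unfolding sl iff lin_single pm.scale_one if_not_P[OF False] h[OF False]
        by (rule mult_zero_left)
    qed
  qed
  also have "\<dots> = (if n \<le> length (x # w) then h (take n (x # w)) * mon (drop n (x # w)) else 0)"
  proof (cases "n \<le> length (x # w)")
    case True
    have "drop n (x # w) \<in> V" using append_take_drop_id[of n "x # w"] unfolding V_def by blast
    then show ?thesis
      unfolding if_P[OF True] using True sum.delta[OF fin, of "drop n (x # w)"
        "\<lambda>_. h (take n (x # w)) * mon (drop n (x # w))"]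
      by (simp only: simp_thms if_True)
  next
    case False
    then show ?thesis by (simp only: simp_thms if_False sum.neutral_const)
  qed
  also have "(\<Sum>p\<in>(\<lambda>(u, v). (x # u, v)) ` frames (mon w :: _ \<Rightarrow>\<^sub>0 'b). ?t (x # w) p)
      = scal (\<chi> [x]) (mon [x] * window \<chi> h (mon w))"
  proof -
    let ?F = "\<lambda>(u :: 'a list, v :: 'a list). (x # u, v)" and ?A = "frames (mon w :: _ \<Rightarrow>\<^sub>0 'b)"
    have single_Cons: "single (x # u) (\<chi> (x # u)) =
        scal (\<chi> [x]) (mon [x] * single u (\<chi> u))" for u
      by (simp add: \<chi>(2)[of u] mult_single plus_list_def)
    have "(\<Sum>p\<in>?F ` ?A. ?t (x # w) p) = (\<Sum>p\<in>?A. ?t (x # w) (?F p))"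
    proof -
      have "inj_on ?F ?A" by (auto simp: inj_on_def)
      from sum.reindex[OF this, of "?t (x # w)"] show ?thesis by (simp only: comp_def)
    qed
    also have "\<dots> = (\<Sum>p\<in>?A. scal (\<chi> [x]) (mon [x] * ?t w p))"
    proof (intro sum.cong refl)
      fix p :: "'a list \<times> 'a list"
      obtain u v where p: "p = (u, v)" by (cases p)
      have "slice (x # u) v (mon (x # w)) = (slice u v (mon w) :: _ \<Rightarrow>\<^sub>0 'b)"
        by (simp add: slice_mon_Cons)
      then show "?t (x # w) (?F p) = scal (\<chi> [x]) (mon [x] * ?t w p)"
        unfolding p prod.case single_Cons by (simp only: scal_mult_left mult.assoc)
    qed
    also have "\<dots> = scal (\<chi> [x]) (mon [x] * window \<chi> h (mon w))"
      unfolding window_def sum_distrib_left pm.scale_sum_right ..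
    finally show ?thesis .
  qed
  finally show ?thesis .
qed

section \<open>Subspaces of the tensor algebra\<close>

text \<open>Koszul signs and projections to graded pieces are diagonal in the basis of words.\<close>

definition diag :: "('a \<Rightarrow> 'k) \<Rightarrow> ('a::monoid_add \<Rightarrow>\<^sub>0 'k::field) \<Rightarrow> ('a \<Rightarrow>\<^sub>0 'k)" where
  "diag \<chi> = lin (\<lambda>w. single w (\<chi> w))"

lemma plin_comp_component [plin_intros]: "plin F \<Longrightarrow> plin (\<lambda>x. component P (F x))"
  by (rule plinI) (simp_all add: plin_add plin_scal plin_add[OF plin_component] plin_scal[OF plin_component])

lemma plin_diag: "plin (diag \<chi>)"
  unfolding diag_def by (rule plin_lin)

lemma plin_comp_diag [plin_intros]: "plin F \<Longrightarrow> plin (\<lambda>x. diag \<chi> (F x))"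
  unfolding diag_def by (rule plin_comp_lin)

lemma lookup_diag [simp]: "lookup (diag \<chi> f) w = \<chi> w * lookup f w"
proof -
  have "lookup (diag \<chi> f) w =
      (\<Sum>v\<in>keys f. if v = w then lookup f v * \<chi> v else 0)"
    unfolding diag_def lin_def by (simp add: lookup_sum lookup_single when_def)
  also have "\<dots> = \<chi> w * lookup f w"
    by (simp add: sum.delta in_keys_iff)
  finally show ?thesis .
qed

lemma susp2_diag: "susp2 deg = diag (\<lambda>w. (- 1) ^ deg (hd w))"
  by (rule ext) (simp add: susp2_def diag_def lin_def mult.commute)

lemma q_diag: "q (diag \<chi> f) = diag \<chi> (q f)"
  unfolding q_def by (rule poly_mapping_eqI) simp

lemma lookup_q [simp]:
  "lookup (q f) w = (if length w = 2 then lookup f w else 0)"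
  by (simp add: q_def)

lemma plin_q: "plin q"
  unfolding q_def by (rule plin_component)

lemma plin_comp_q [plin_intros]: "plin F \<Longrightarrow> plin (\<lambda>x. q (F x))"
  unfolding q_def by (rule plin_comp_component)

lemma q_mon: "q (mon w) = (if length w = 2 then mon w else 0)"
  for w :: "'x list"
  by (auto intro!: poly_mapping_eqI simp: lookup_single when_def)

lemma T_iff: "f \<in> T X \<longleftrightarrow> (\<forall>w. lookup f w \<noteq> 0 \<longrightarrow> set w \<subseteq> X)"
  by (auto simp: T_def in_keys_iff lists_eq_set)

lemma Tpow_iff: "f \<in> Tpow X n \<longleftrightarrow>
    (\<forall>w. lookup f w \<noteq> 0 \<longrightarrow> set w \<subseteq> X \<and> length w = n)"
  by (auto simp: Tpow_def T_iff in_keys_iff)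

lemma Tle_iff: "f \<in> Tle X n \<longleftrightarrow>
    (\<forall>w. lookup f w \<noteq> 0 \<longrightarrow> set w \<subseteq> X \<and> length w \<le> n)"
  by (auto simp: Tle_def T_iff in_keys_iff)

lemma pm_subspaceI:
  assumes "0 \<in> S" "\<And>x y. x \<in> S \<Longrightarrow> y \<in> S \<Longrightarrow> x + y \<in> S" "\<And>c x. x \<in> S \<Longrightarrow> scal c x \<in> S"
  shows "pm.subspace S"
  using assms by (simp add: pm.subspace_def)

lemma lookup_add_nonzero:
  "lookup (f + g) w \<noteq> 0 \<Longrightarrow>
    lookup f w \<noteq> 0 \<or> lookup g w \<noteq> 0"
  by (auto simp: lookup_add)

lemma subspace_T: "pm.subspace (T X)"
  by (rule pm_subspaceI) (auto simp: T_iff dest!: lookup_add_nonzero)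

lemma mon_in_T: "mon w \<in> T X \<longleftrightarrow> set w \<subseteq> X"
  for w :: "'x list"
  by (auto simp: T_iff lookup_single when_def)

lemma mon_in_Tpow: "mon w \<in> Tpow X n \<longleftrightarrow> set w \<subseteq> X \<and> length w = n"
  for w :: "'x list"
  by (auto simp: Tpow_iff lookup_single when_def)

lemma T_mult: "f \<in> T X \<Longrightarrow> g \<in> T X \<Longrightarrow> f * g \<in> T X"
  for f g :: "'x list \<Rightarrow>\<^sub>0 'k::field"
  using keys_mult[of f g] by (fastforce simp: T_def plus_list_def)

lemma T_one: "1 \<in> T X"
  by (simp add: T_def zero_list_def)

lemma subspace_image:
  assumes "plin F" "pm.subspace S"
  shows "pm.subspace (F ` S)"
proof (rule pm_subspaceI)
  show "0 \<in> F ` S" using plin_0[OF assms(1)] pm.subspace_0[OF assms(2)] by (metis imageI)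
  show "x + y \<in> F ` S" if "x \<in> F ` S" "y \<in> F ` S" for x y
    using that pm.subspace_add[OF assms(2)] plin_add[OF assms(1)] by (metis (no_types) imageE imageI)
  show "scal c x \<in> F ` S" if "x \<in> F ` S" for c x
    using that pm.subspace_scale[OF assms(2)] plin_scal[OF assms(1)] by (metis (no_types) imageE imageI)
qed

lemma subspace_vimage:
  assumes "plin F" "pm.subspace S"
  shows "pm.subspace {x. F x \<in> S}"
  using assms(2) by (intro pm_subspaceI)
    (simp_all add: plin_0[OF assms(1)] plin_add[OF assms(1)] plin_scal[OF assms(1)]
      pm.subspace_0 pm.subspace_add pm.subspace_scale)

lemma slice_mult_left:
  fixes w :: "'a list \<Rightarrow>\<^sub>0 'k::field"
  assumes "length u' = length u"
  shows "slice u v (mon u' * w) = (if u' = u then slice [] v w else 0)"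
proof (rule plin_eq[of "\<lambda>w. slice u v (mon u' * w)"
    "\<lambda>w. if u' = u then slice [] v w else 0" w])
  show "plin (\<lambda>w. slice u v (mon u' * w))" by (intro plin_intros)
  show "plin (\<lambda>w. if u' = u then slice [] v w else 0)"
    by (cases "u' = u") (auto intro!: plinI simp: plin_add[OF plin_slice] plin_scal[OF plin_slice])
  fix z show "slice u v (mon u' * mon z :: 'a list \<Rightarrow>\<^sub>0 'k) = (if u' = u then slice [] v (mon z) else 0)"
    using assms by (auto intro!: poly_mapping_eqI simp: lookup_single when_def)
qed

lemma slice_mult_right:
  fixes w :: "'a list \<Rightarrow>\<^sub>0 'k::field"
  assumes "length v' = length v"
  shows "slice u v (w * mon v') = (if v' = v then slice u [] w else 0)"
proof (rule plin_eq[of "\<lambda>w. slice u v (w * mon v')"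
    "\<lambda>w. if v' = v then slice u [] w else 0" w])
  show "plin (\<lambda>w. slice u v (w * mon v'))" by (intro plin_intros)
  show "plin (\<lambda>w. if v' = v then slice u [] w else 0)"
    by (cases "v' = v") (auto intro!: plinI simp: plin_add[OF plin_slice] plin_scal[OF plin_slice])
  fix z show "slice u v (mon z * mon v' :: 'a list \<Rightarrow>\<^sub>0 'k) = (if v' = v then slice u [] (mon z) else 0)"
    using assms by (auto intro!: poly_mapping_eqI simp: lookup_single when_def
        append_assoc[symmetric] simp del: append_assoc)
qed

lemma slice_Tpow_mult:
  assumes "f \<in> Tpow X i" "length u = i"
  shows "slice u v (f * w) = scal (lookup f u) (slice [] v w)"
proof (rule plin_eq_on[of "\<lambda>f. slice u v (f * w)"
    "\<lambda>f. scal (lookup f u) (slice [] v w)" f])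
  show "plin (\<lambda>f. slice u v (f * w))" by (intro plin_intros)
  show "plin (\<lambda>f. scal (lookup f u) (slice [] v w))"
    by (rule plinI) (simp_all add: lookup_add pm.scale_left_distrib)
  fix z assume "z \<in> keys f"
  then have "length z = length u" using assms by (auto simp: Tpow_iff in_keys_iff)
  then show "slice u v (mon z * w) = scal (lookup (mon z) u) (slice [] v w)"
    by (simp add: slice_mult_left lookup_single when_def)
qed

lemma slice_mult_Tpow:
  assumes "f \<in> Tpow X j" "length v = j"
  shows "slice u v (w * f) = scal (lookup f v) (slice u [] w)"
proof (rule plin_eq_on[of "\<lambda>f. slice u v (w * f)"
    "\<lambda>f. scal (lookup f v) (slice u [] w)" f])
  show "plin (\<lambda>f. slice u v (w * f))" by (intro plin_intros)
  show "plin (\<lambda>f. scal (lookup f v) (slice u [] w))"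
    by (rule plinI) (simp_all add: lookup_add pm.scale_left_distrib)
  fix z assume "z \<in> keys f"
  then have "length z = length v" using assms by (auto simp: Tpow_iff in_keys_iff)
  then show "slice u v (w * mon z) = scal (lookup (mon z) v) (slice u [] w)"
    by (simp add: slice_mult_right lookup_single when_def)
qed

lemma Tpow_expand_slices:
  fixes f :: "'a list \<Rightarrow>\<^sub>0 'k::field"
  assumes f: "f \<in> Tpow X (i + 2 + j)"
  shows "f = (\<Sum>(u, v)\<in>{(u, v) \<in> frames f. length u = i \<and> length v = j}.
    mon u * (slice u v f * mon v))" (is "_ = sum _ ?J")
proof -
  have fin: "finite ?J" by (rule finite_subset[OF _ finite_frames[of f]]) auto
  have "(\<lambda>f. f) f = (\<lambda>f. \<Sum>p\<in>?J. mon (fst p) * (slice (fst p) (snd p) f * mon (snd p))) f"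
  proof (rule plin_eq_on[of "\<lambda>f. f"
      "\<lambda>f. \<Sum>p\<in>?J. mon (fst p) * (slice (fst p) (snd p) f * mon (snd p))" f])
    show "plin (\<lambda>f. f)" by (intro plin_intros)
    show "plin (\<lambda>f. \<Sum>p\<in>?J. mon (fst p) * (slice (fst p) (snd p) f * mon (snd p)))"
      by (intro plin_intros)
    fix w assume w: "w \<in> keys f"
    then have len: "length w = i + 2 + j" using f by (auto simp: Tpow_iff in_keys_iff)
    define p where "p = (take i w, drop (i + 2) w)"
    define m where "m = take 2 (drop i w)"
    have w_eq: "take i w @ m @ drop (i + 2) w = w"
      unfolding m_def by (metis add.commute append_take_drop_id drop_drop)
    have pJ: "p \<in> ?J"
      using w len exI[of "\<lambda>m. take i w @ m @ drop (i + 2) w \<in> keys f" m]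
      unfolding p_def frames_def w_eq by simp
    have summand: "mon (fst r) * (slice (fst r) (snd r) (mon w :: _ \<Rightarrow>\<^sub>0 'k) * mon (snd r)) = (if r = p then mon w else 0)"
      if "r \<in> ?J" for r
    proof (cases "\<exists>m. fst r @ m @ snd r = w")
      case True
      then obtain m' where m': "fst r @ m' @ snd r = w" ..
      have "slice (fst r) (snd r) (mon w :: _ \<Rightarrow>\<^sub>0 'k) = mon m'" unfolding m'[symmetric] by (rule slice_mon)
      moreover have "length (fst r) = i" "length (snd r) = j" using that by auto
      moreover from this have "length m' = 2" using len m'[symmetric] by simp
      then have "fst r = take i w" "snd r = drop (i + 2) w"
        using \<open>length (fst r) = i\<close> m'[symmetric] by simp_all
      ultimately show ?thesis using m' by (simp add: p_def prod_eq_iff)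
    next
      case False
      then have "slice (fst r) (snd r) (mon w :: _ \<Rightarrow>\<^sub>0 'k) = 0"
        by (intro poly_mapping_eqI) (auto simp: lookup_single when_def)
      moreover have "r \<noteq> p" using False w_eq unfolding p_def by auto
      ultimately show ?thesis by simp
    qed
    have "(\<Sum>r\<in>?J. mon (fst r) * (slice (fst r) (snd r) (mon w :: _ \<Rightarrow>\<^sub>0 'k) * mon (snd r)))
        = (\<Sum>r\<in>?J. if r = p then mon w else 0)"
      by (rule sum.cong[OF refl summand])
    also have "\<dots> = mon w" using fin pJ by (simp only: sum.delta if_True)
    finally show "(mon w :: _ \<Rightarrow>\<^sub>0 'k) = (\<Sum>r\<in>?J. mon (fst r) * (slice (fst r) (snd r) (mon w :: _ \<Rightarrow>\<^sub>0 'k) * mon (snd r)))" ..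
  qed
  then show ?thesis by (simp only: split_def)
qed

text \<open>For the forward direction it suffices to slice a product of homogeneous factors; for the
  converse, \<open>f\<close> is the sum of its slices multiplied by the outer words.\<close>

lemma tens_slices:
  fixes f :: "'a list \<Rightarrow>\<^sub>0 'k::field"
  assumes S: "pm.subspace S" and f: "f \<in> Tpow X (i + 2 + j)"
  shows "f \<in> Tpow X i \<oslash> S \<oslash> Tpow X j \<longleftrightarrow>
    (\<forall>u v. length u = i \<longrightarrow> length v = j \<longrightarrow> slice u v f \<in> S)"
proof
  assume *: "f \<in> Tpow X i \<oslash> S \<oslash> Tpow X j"
  have right: "w \<in> S \<oslash> Tpow X j \<Longrightarrow> slice [] v w \<in> S" if v: "length v = j" for v w
  proof -
    have "S \<oslash> Tpow X j \<subseteq> {w. slice [] v w \<in> S}" unfolding tens_def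
      by (intro pm.span_minimal subspace_vimage plin_slice S)
        (auto simp: slice_mult_Tpow[OF _ v] pm.subspace_scale[OF S])
    then show "w \<in> S \<oslash> Tpow X j \<Longrightarrow> slice [] v w \<in> S" by blast
  qed
  show "\<forall>u v. length u = i \<longrightarrow> length v = j \<longrightarrow> slice u v f \<in> S"
  proof (intro allI impI)
    fix u v :: "'a list" assume u: "length u = i" and v: "length v = j"
    have "Tpow X i \<oslash> S \<oslash> Tpow X j \<subseteq> {w. slice u v w \<in> S}"
      unfolding tens_def[of "Tpow X i"]
      by (intro pm.span_minimal subspace_vimage plin_slice S)
        (auto simp: slice_Tpow_mult[OF _ u] pm.subspace_scale[OF S] right[OF v])
    with * show "slice u v f \<in> S" by blast
  qed
next
  assume *: "\<forall>u v. length u = i \<longrightarrow> length v = j \<longrightarrow> slice u v f \<in> S"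
  let ?J = "{(u, v) \<in> frames f. length u = i \<and> length v = j}"
  have "(\<Sum>(u, v)\<in>?J. mon u * (slice u v f * mon v)) \<in> Tpow X i \<oslash> S \<oslash> Tpow X j"
  proof (rule pm.subspace_sum)
    show "pm.subspace (Tpow X i \<oslash> S \<oslash> Tpow X j)"
      unfolding tens_def by (rule pm.subspace_span)
    fix p assume "p \<in> ?J"
    then obtain u v where p: "p = (u, v)" "(u, v) \<in> frames f" "length u = i" "length v = j" by auto
    then obtain m where "lookup f (u @ m @ v) \<noteq> 0"
      by (auto simp: frames_def in_keys_iff)
    with f have "set u \<subseteq> X" "set v \<subseteq> X" unfolding Tpow_iff by (metis Un_subset_iff set_append)+
    then have u: "mon u \<in> Tpow X i" and v: "mon v \<in> Tpow X j" using p by (auto simp: mon_in_Tpow)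
    have "slice u v f \<in> S" using * p by blast
    then have "slice u v f * mon v \<in> S \<oslash> Tpow X j"
      unfolding tens_def using v by (intro pm.span_base) blast
    then have "mon u * (slice u v f * mon v) \<in> Tpow X i \<oslash> S \<oslash> Tpow X j"
      unfolding tens_def[of "Tpow X i"] using u by (intro pm.span_base) blast
    then show "(case p of (u, v) \<Rightarrow> mon u * (slice u v f * mon v)) \<in> Tpow X i \<oslash> S \<oslash> Tpow X j"
      using p by simp
  qed
  then show "f \<in> Tpow X i \<oslash> S \<oslash> Tpow X j"
    using Tpow_expand_slices[OF f] by metis
qed

section \<open>The relations of a QLC algebra\<close>

locale qlc =
  fixes X :: "'x set" and deg :: "'x \<Rightarrow> nat" and R :: "('x list \<Rightarrow>\<^sub>0 'k::field) set"
  assumes datum: "QLC_datum X deg R"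
begin

lemma R_subspace: "pm.subspace R"
  and R_le: "r \<in> R \<Longrightarrow> r \<in> Tle X 2"
  and R_homogeneous: "r \<in> R \<Longrightarrow> component (\<lambda>w. vdeg deg w = n) r \<in> R"
  and R_inter: "r \<in> R \<Longrightarrow> r \<in> Tle X 1 \<Longrightarrow> r = 0"
  and R_ideal: "ideal_gen X R \<inter> Tle X 2 = R"
  using datum unfolding QLC_datum_def by blast+

abbreviation S2 :: "('x list \<Rightarrow>\<^sub>0 'k) set" where
  "S2 \<equiv> susp2 deg ` q ` R"

lemma qR_subspace: "pm.subspace (q ` R)"
  by (intro subspace_image plin_q R_subspace)

lemma S2_subspace: "pm.subspace S2"
  unfolding susp2_diag by (intro subspace_image plin_diag qR_subspace)

text \<open>The difference of two relations with equal quadratic part lies in \<open>R \<inter> (k \<oplus> V) = 0\<close>.  This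
  uniqueness is what makes \<open>\<phi>\<close> and \<open>\<theta>\<close> well defined, and later it lets one identify a relation by
  its quadratic part alone.\<close>

lemma q_inj:
  assumes "r \<in> R" "r' \<in> R" "q r = q r'"
  shows "r = r'"
proof -
  have d: "r - r' \<in> R" using assms R_subspace by (simp add: pm.subspace_diff)
  have "r - r' \<in> Tle X 1" unfolding Tle_iff
  proof (intro allI impI conjI)
    fix w assume w: "lookup (r - r') w \<noteq> 0"
    then have "set w \<subseteq> X" "length w \<le> 2" using R_le[OF d] by (auto simp: Tle_iff)
    moreover have "length w \<noteq> 2"
      using w arg_cong[OF assms(3), of "\<lambda>f. lookup f w"] by (auto simp: lookup_minus)
    ultimately show "set w \<subseteq> X" "length w \<le> 1" by auto
  qed
  then show ?thesis using R_inter[OF d] by simp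
qed

lemma R_decompose:
  assumes "r \<in> R"
  shows "r = q r + component (\<lambda>w. length w = 1) r + single [] (lookup r [])"
proof (rule poly_mapping_eqI)
  fix w
  have "lookup r w = 0" if "length w > 2"
    using R_le[OF assms] that by (auto simp: Tle_iff not_less[symmetric])
  moreover have "length w = 0 \<or> length w = 1 \<or> length w = 2 \<or> length w > 2" by linarith
  ultimately show "lookup r w = lookup (q r + component (\<lambda>w. length w = 1) r
      + single [] (lookup r [])) w"
    by (auto simp: lookup_add lookup_single when_def)
qed

lemma phi_theta_unique:
  assumes r: "r \<in> R" and y: "y \<in> Tpow X 1" and "q r - y + single [] t \<in> R"
  shows "y = - component (\<lambda>w. length w = 1) r" "t = lookup r []"
proof -
  let ?r = "q r - y + single [] t"
  have "q ?r = q r"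
    using y by (intro poly_mapping_eqI) (auto simp: lookup_add lookup_minus lookup_single when_def Tpow_iff)
  then have eq: "?r = r" using q_inj assms by blast
  show "t = lookup r []"
  proof -
    have "lookup y [] = 0" using y unfolding Tpow_iff by fastforce
    then show ?thesis using arg_cong[OF eq, of "\<lambda>f. lookup f []"]
      by (simp add: lookup_add lookup_minus)
  qed
  show "y = - component (\<lambda>w. length w = 1) r"
  proof (rule poly_mapping_eqI)
    fix w show "lookup y w = lookup (- component (\<lambda>w. length w = 1) r) w"
      using y arg_cong[OF eq, of "\<lambda>f. lookup f w"]
      by (cases "length w = 1")
        (cases w; auto simp: lookup_add lookup_minus lookup_single when_def Tpow_iff algebra_simps
          eq_neg_iff_add_eq_0)+
  qed
qed

lemma component1_Tpow: "r \<in> R \<Longrightarrow> - component (\<lambda>w. length w = 1) r \<in> Tpow X 1"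
  using R_le by (force simp: Tpow_iff Tle_iff)

lemma phi_q: "r \<in> R \<Longrightarrow> phi X R (q r) = - component (\<lambda>w. length w = 1) r"
  unfolding phi_def
proof (rule the_equality)
  assume "r \<in> R"
  then show "- component (\<lambda>w. length w = 1) r \<in> Tpow X 1 \<and>
      (\<exists>t. q r - - component (\<lambda>w. length w = 1) r + single [] t \<in> R)"
    using component1_Tpow R_decompose[of r] by (metis diff_minus_eq_add)
qed (use phi_theta_unique in blast)

lemma theta_q: "r \<in> R \<Longrightarrow> theta X R (q r) = lookup r []"
  unfolding theta_def
proof (rule the_equality)
  assume "r \<in> R"
  then show "\<exists>y\<in>Tpow X 1. q r - y + single [] (lookup r []) \<in> R"
    using component1_Tpow R_decompose[of r] by (metis diff_minus_eq_add)
qed (use phi_theta_unique in blast)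

lemma relation_in_R:
  assumes "x \<in> q ` R"
  shows "x - phi X R x + single [] (theta X R x) \<in> R"
  using assms R_decompose by (auto simp: phi_q theta_q)

text \<open>\<open>R\<close> is spanned by homogeneous elements, on which such an operator is a scalar.  The case of
  the sign \<open>(-1)\<close> to the degree is needed to compare the two suspension conventions that occur at the
  left and at the right end of a tensor of weight three.\<close>

lemma diag_vdeg_R:
  assumes "r \<in> R"
  shows "diag (\<lambda>w. \<chi> (vdeg deg w)) r \<in> R"
proof -
  have "diag (\<lambda>w. \<chi> (vdeg deg w)) r =
      (\<Sum>n\<in>vdeg deg ` keys r. scal (\<chi> n) (component (\<lambda>w. vdeg deg w = n) r))"
  proof (rule poly_mapping_eqI)
    fix w
    have "lookup (\<Sum>n\<in>vdeg deg ` keys r.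
          scal (\<chi> n) (component (\<lambda>w. vdeg deg w = n) r)) w
        = (\<Sum>n\<in>vdeg deg ` keys r.
          if n = vdeg deg w then \<chi> n * lookup r w else 0)"
      unfolding lookup_sum lookup_scal lookup_component by (rule sum.cong) auto
    also have "\<dots> = (if vdeg deg w \<in> vdeg deg ` keys r
        then \<chi> (vdeg deg w) * lookup r w else 0)"
      by (rule sum.delta) simp
    also have "\<dots> = lookup (diag (\<lambda>w. \<chi> (vdeg deg w)) r) w"
      by (auto simp: in_keys_iff)
    finally show "lookup (diag (\<lambda>w. \<chi> (vdeg deg w)) r) w =
      lookup (\<Sum>n\<in>vdeg deg ` keys r.
          scal (\<chi> n) (component (\<lambda>w. vdeg deg w = n) r)) w" ..
  qed
  then show ?thesis
    using R_homogeneous[OF assms] R_subspace by (simp add: pm.subspace_sum pm.subspace_scale)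
qed

lemma diag_vdeg_qR: "x \<in> q ` R \<Longrightarrow> diag (\<lambda>w. \<chi> (vdeg deg w)) x \<in> q ` R"
  using diag_vdeg_R by (auto simp: q_diag[symmetric])

lemma diag_vdeg_S2:
  assumes "x \<in> S2"
  shows "diag (\<lambda>w. \<chi> (vdeg deg w)) x \<in> S2"
proof -
  obtain y where y: "y \<in> q ` R" "x = susp2 deg y" using assms by blast
  have "diag (\<lambda>w. \<chi> (vdeg deg w)) x = susp2 deg (diag (\<lambda>w. \<chi> (vdeg deg w)) y)"
    by (rule poly_mapping_eqI) (simp add: y(2) susp2_diag)
  then show ?thesis using diag_vdeg_qR[OF y(1)] by simp
qed

lemma S2_q: "x \<in> S2 \<Longrightarrow> q x = x"
  by (auto simp: susp2_diag q_diag intro!: arg_cong[where f = "diag _"] poly_mapping_eqI)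

lemma susp2_susp2: "susp2 deg (susp2 deg x) = x"
  by (rule poly_mapping_eqI) (simp add: susp2_diag mult.assoc[symmetric] power_mult_distrib[symmetric])

lemma susp2_S2: "x \<in> S2 \<Longrightarrow> susp2 deg x \<in> q ` R"
  by (auto simp: susp2_susp2)

lemma S2_iff: "x \<in> S2 \<longleftrightarrow> susp2 deg x \<in> q ` R"
  using susp2_S2 susp2_susp2 by (metis imageI)

text \<open>By \<open>tens_slices\<close>, lying in each of the subspaces \<open>(sV)\<^sup>i \<otimes> s\<^sup>2qR \<otimes> (sV)\<^sup>j\<close> means that
  all slices of length two lie in \<open>s\<^sup>2qR\<close>.  In this form the coalgebra is visibly closed under
  slices.\<close>

lemma dual_coalg_iff:
  "f \<in> dual_coalg X deg R \<longleftrightarrow> f \<in> T X \<and> (\<forall>u v. q (slice u v f) \<in> S2)"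
proof -
  have q: "q (slice u v f) = slice u v (component (\<lambda>w. length w = length u + 2 + length v) f)" for u v
    by (rule poly_mapping_eqI) auto
  have "component (\<lambda>w. length w = n) f \<in> dual_component X deg R n \<longleftrightarrow>
      (\<forall>u v. length u + 2 + length v = n \<longrightarrow> q (slice u v f) \<in> S2)" if "f \<in> T X" for n
  proof -
    let ?f = "component (\<lambda>w. length w = n) f"
    have f: "?f \<in> Tpow X n" using that by (auto simp: Tpow_iff T_iff)
    then have "?f \<in> dual_component X deg R n \<longleftrightarrow> (\<forall>i j. i + 2 + j = n \<longrightarrow>
        (\<forall>u v. length u = i \<longrightarrow> length v = j \<longrightarrow> slice u v ?f \<in> S2))"
      unfolding dual_component_def using tens_slices[OF S2_subspace, of ?f X] by (auto simp del: split_paired_All)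
    then show ?thesis unfolding q by (auto simp del: split_paired_All)
  qed
  then show ?thesis unfolding dual_coalg_def by auto
qed

subsection \<open>Homogeneous homogeneous_extensions of the structure maps\<close>

text \<open>Cutting each value \<open>F w\<close> down to the degree of \<open>w\<close> gives a degree-preserving map.  It agrees
  with \<open>F\<close> on every element whose homogeneous components \<open>F\<close> already respects.\<close>

lemma lin_homogenize:
  fixes F :: "('x list \<Rightarrow>\<^sub>0 'k) \<Rightarrow> ('x list \<Rightarrow>\<^sub>0 'k)"
  assumes F: "plin F"
    and x: "\<And>n. F (component (\<lambda>w. vdeg deg w = n) x) = component (\<lambda>w. vdeg deg w = n) (F x)"
  shows "lin (\<lambda>w. component (\<lambda>u. vdeg deg u = vdeg deg w) (F (mon w))) x = F x"
    (is "lin ?h x = _")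
proof (rule poly_mapping_eqI)
  fix u
  let ?c = "component (\<lambda>w. vdeg deg w = vdeg deg u)" and ?u = "component (\<lambda>w. w = u)"
  have "(\<lambda>x. ?u (lin ?h x)) x = (\<lambda>x. ?u (F (?c x))) x"
  proof (rule plin_eq[of "\<lambda>x. ?u (lin ?h x)" "\<lambda>x. ?u (F (?c x))" x])
    show "plin (\<lambda>x. ?u (lin ?h x))" by (intro plin_intros)
    have "plin (\<lambda>x. F (?c x))"
      by (rule plinI) (simp_all add: plin_add[OF plin_component] plin_scal[OF plin_component]
          plin_add[OF F] plin_scal[OF F])
    then show "plin (\<lambda>x. ?u (F (?c x)))" by (rule plin_comp_component)
    fix w
    have "F (?c (mon w)) = (if vdeg deg w = vdeg deg u then F (mon w) else 0)"
    proof (cases "vdeg deg w = vdeg deg u")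
      case True
      then have "?c (mon w) = (mon w :: 'x list \<Rightarrow>\<^sub>0 'k)"
        by (intro poly_mapping_eqI) (auto simp: lookup_single when_def)
      then have "F (?c (mon w)) = F (mon w)" by (rule arg_cong)
      then show ?thesis using True by simp
    next
      case False
      then have "?c (mon w) = (0 :: 'x list \<Rightarrow>\<^sub>0 'k)"
        by (intro poly_mapping_eqI) (auto simp: lookup_single when_def)
      then have "F (?c (mon w)) = F 0" by (rule arg_cong)
      then show ?thesis using False by (simp add: plin_0[OF F])
    qed
    then show "?u (lin ?h (mon w)) = ?u (F (?c (mon w)))"
      by (auto intro!: poly_mapping_eqI)
  qed
  then have "lookup (?u (lin ?h x)) u = lookup (?u (F (?c x))) u"
    by (rule arg_cong)
  then show "lookup (lin ?h x) u = lookup (F x) u"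
    by (simp add: x)
qed

text \<open>Complete quadratic tensors to relations by a linear left inverse of \<open>q\<close> on \<open>R\<close>, read off the
  linear and the constant terms, and make the result homogeneous.  Homogeneity matters: a contraction
  must change the degree by exactly one for the Koszul signs to cancel.  The sign of the suspension is absorbed, so that \<open>gam\<close> and \<open>tht\<close> apply to
  suspended words directly.  Both take values in tensors; those of \<open>tht\<close> are scalars, that is,
  multiples of the empty word.\<close>

lemma homogeneous_extensions:
  obtains gam tht :: "'x list \<Rightarrow> ('x list \<Rightarrow>\<^sub>0 'k)"
  where "\<And>w. length w \<noteq> 2 \<Longrightarrow> gam w = 0" "\<And>w. length w \<noteq> 2 \<Longrightarrow> tht w = 0"
    "\<And>w u. u \<in> keys (gam w) \<Longrightarrow> \<exists>x\<in>X. u = [x] \<and> deg x = vdeg deg w"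
    "\<And>w u. u \<in> keys (tht w) \<Longrightarrow> u = [] \<and> vdeg deg w = 0"
    "\<And>c. c \<in> dual_coalg X deg R \<Longrightarrow> lin gam c = phi X R (susp2 deg (q c))"
    "\<And>c. c \<in> dual_coalg X deg R \<Longrightarrow> lin tht c = single [] (theta_tilde X deg R c)"
proof -
  interpret vp: vector_space_pair
    "scal :: 'k \<Rightarrow> ('x list \<Rightarrow>\<^sub>0 'k) \<Rightarrow> _" "scal :: 'k \<Rightarrow> ('x list \<Rightarrow>\<^sub>0 'k) \<Rightarrow> _"
    by (simp add: vector_space_pair_def pm.vector_space_axioms)
  have "inj_on q R" by (rule inj_onI) (rule q_inj)
  \<comment> \<open>completes a quadratic tensor to a relation; it need not respect degrees off \<open>qR\<close>\<close>
  then obtain \<rho> :: "('x list \<Rightarrow>\<^sub>0 'k) \<Rightarrow> ('x list \<Rightarrow>\<^sub>0 'k)"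
    where \<rho>: "plin \<rho>" "range \<rho> \<subseteq> R" "\<And>r. r \<in> R \<Longrightarrow> \<rho> (q r) = r"
    using vp.linear_exists_left_inverse_on[OF plin_q R_subspace] by auto
  define F where "F = (\<lambda>x. - component (\<lambda>w. length w = 1) (\<rho> x))"
  define G where "G = (\<lambda>x. component (\<lambda>w. w = []) (\<rho> x))"
  have F: "plin F" and G: "plin G"
    unfolding F_def G_def by (intro plin_comp_neg plin_comp_component \<rho>(1))+
  define hF where "hF = (\<lambda>w. component (\<lambda>u. vdeg deg u = vdeg deg w) (F (mon w)))"
  define hG where "hG = (\<lambda>w. component (\<lambda>u. vdeg deg u = vdeg deg w) (G (mon w)))"
  have linF: "lin hF x = phi X R x" and linG: "lin hG x = single [] (theta X R x)"
    if xq: "x \<in> q ` R" for x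
  proof -
    obtain r where r: "r \<in> R" "x = q r" using xq by auto
    have comp_q: "component P (q r) = q (component P r)" for P
      by (rule poly_mapping_eqI) simp
    have c: "\<rho> (component (\<lambda>w. vdeg deg w = n) x) = component (\<lambda>w. vdeg deg w = n) r" for n
      using \<rho>(3)[OF R_homogeneous[OF r(1)]] by (simp add: r(2) comp_q)
    have x: "\<rho> x = r" using \<rho>(3)[OF r(1)] r(2) by simp
    have "lin hF x = F x" unfolding hF_def
      by (rule lin_homogenize[OF F]) (auto intro!: poly_mapping_eqI simp: F_def c x)
    then show "lin hF x = phi X R x" using phi_q[OF r(1)] by (simp add: F_def x r(2)[symmetric])
    have "lin hG x = G x" unfolding hG_def
      by (rule lin_homogenize[OF G]) (auto intro!: poly_mapping_eqI simp: G_def c x)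
    also have "G x = single [] (lookup r [])"
      by (auto intro!: poly_mapping_eqI simp: G_def x lookup_single when_def)
    finally show "lin hG x = single [] (theta X R x)" using theta_q[OF r(1)] by (simp add: r(2)[symmetric])
  qed
  define gam where "gam = (\<lambda>w. if length w = 2 then scal ((- 1) ^ deg (hd w)) (hF w) else 0)"
  define tht where "tht = (\<lambda>w. if length w = 2 then scal ((- 1) ^ deg (hd w)) (hG w) else 0)"
  have lin_q: "lin (\<lambda>w. if length w = 2 then scal ((- 1) ^ deg (hd w)) (h w) else 0) c = lin h (susp2 deg (q c))"
    for h :: "'x list \<Rightarrow> ('x list \<Rightarrow>\<^sub>0 'k)" and c
  proof (rule plin_eq[of "\<lambda>c. lin (\<lambda>w. if length w = 2 then scal ((- 1) ^ deg (hd w)) (h w) else 0) c"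
      "\<lambda>c. lin h (susp2 deg (q c))" c])
    show "plin (\<lambda>c. lin h (susp2 deg (q c)))" unfolding susp2_diag by (intro plin_intros)
    fix w :: "'x list"
    show "lin (\<lambda>w. if length w = 2 then scal ((- 1) ^ deg (hd w)) (h w) else 0) (mon w)
        = lin h (susp2 deg (q (mon w)))"
      by (simp add: q_mon susp2_diag diag_def)
  qed (rule plin_lin)
  show thesis
  proof (rule that[of gam tht])
    show "gam w = 0" "tht w = 0" if "length w \<noteq> 2" for w
      using that by (simp_all add: gam_def tht_def)
  next
    fix w u assume "u \<in> keys (gam w)"
    then have "vdeg deg u = vdeg deg w" "lookup (F (mon w)) u \<noteq> 0"
      by (auto simp: gam_def hF_def in_keys_iff split: if_splits)
    moreover have "\<rho> (mon w) \<in> R" using \<rho>(2) by blast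
    ultimately have "length u = 1" "set u \<subseteq> X" "vdeg deg u = vdeg deg w"
      using component1_Tpow[of "\<rho> (mon w)"] unfolding Tpow_iff F_def by metis+
    then show "\<exists>x\<in>X. u = [x] \<and> deg x = vdeg deg w"
      by (auto simp: length_Suc_conv vdeg_def)
  next
    fix w u assume "u \<in> keys (tht w)"
    then show "u = [] \<and> vdeg deg w = 0"
      by (auto simp: tht_def hG_def in_keys_iff G_def lookup_single when_def vdeg_def split: if_splits)
  next
    fix c assume "c \<in> dual_coalg X deg R"
    then have "q (slice [] [] c) \<in> S2" unfolding dual_coalg_iff by blast
    then have "susp2 deg (q c) \<in> q ` R" by (intro susp2_S2) simp
    then show "lin gam c = phi X R (susp2 deg (q c))"
      "lin tht c = single [] (theta_tilde X deg R c)"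
      unfolding gam_def tht_def lin_q theta_tilde_def by (simp_all add: linF linG)
  qed
qed

end

section \<open>Coderivations and derivations on words\<close>

lemma plin_comp_window [plin_intros]: "plin F \<Longrightarrow> plin (\<lambda>x. window \<chi> h (F x))"
  by (rule plinI) (simp_all add: plin_add plin_scal plin_add[OF plin_window] plin_scal[OF plin_window])

lemma desusp_lin: "desusp = lin (\<lambda>w. mon [w])"
  by (rule ext) (simp add: desusp_def lin_def)

lemma plin_comp_desusp [plin_intros]: "plin F \<Longrightarrow> plin (\<lambda>x. desusp (F x))"
  unfolding desusp_lin by (rule plin_comp_lin)

lemma desusp_mon [simp]: "desusp (mon w) = mon [w]"
  by (simp add: desusp_lin)

text \<open>Extensions of \<open>\<phi>\<close> and \<open>\<theta>\<close> to all words, as functions on basis words: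
  \<open>gam\<close> merges two letters into letters of the same total degree, hence has degree \<open>-1\<close> after
  suspension, and \<open>tht\<close> sees only pairs of letters of degree zero.\<close>

locale word_ops =
  fixes X :: "'x set" and deg :: "'x \<Rightarrow> nat"
    and gam tht :: "'x list \<Rightarrow> ('x list \<Rightarrow>\<^sub>0 'k::field)"
  assumes gam_length: "length w \<noteq> 2 \<Longrightarrow> gam w = 0"
    and tht_length: "length w \<noteq> 2 \<Longrightarrow> tht w = 0"
    and gam_keys: "u \<in> keys (gam w) \<Longrightarrow> \<exists>x\<in>X. u = [x] \<and> deg x = vdeg deg w"
    and tht_keys: "u \<in> keys (tht w) \<Longrightarrow> u = [] \<and> vdeg deg w = 0"
begin

abbreviation sg :: "'x list \<Rightarrow> 'k" where
  "sg w \<equiv> (- 1) ^ sdeg deg w"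

abbreviation csg :: "'x list list \<Rightarrow> 'k" where
  "csg W \<equiv> (- 1) ^ cobar_deg deg W"

lemma sdeg_Nil [simp]: "sdeg deg [] = 0"
  and sdeg_append [simp]: "sdeg deg (u @ v) = sdeg deg u + sdeg deg v"
  by (simp_all add: sdeg_def)

lemma sdeg_Cons: "sdeg deg (x # u) = sdeg deg [x] + sdeg deg u"
  by (simp add: sdeg_def)

lemma sg_Cons: "sg (x # u) = sg [x] * sg u"
  by (subst sdeg_Cons) (rule power_add)

lemma sg_square [simp]: "sg u * sg u = 1" "sg u * (sg u * a) = a"
  by (simp_all add: power_add[symmetric] mult.assoc[symmetric])

lemma cobar_deg_Cons: "cobar_deg deg (w # W) = cobar_deg deg [w] + cobar_deg deg W"
  by (simp add: cobar_deg_def)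

lemma csg_Cons: "csg (w # W) = csg [w] * csg W"
  by (subst cobar_deg_Cons) (rule power_add)

lemma csg_Nil [simp]: "csg [] = 1"
  by (simp add: cobar_deg_def)

lemma csg_single: "w \<noteq> [] \<Longrightarrow> csg [w] = - sg w"
  by (cases w) (simp_all add: cobar_deg_def sdeg_def)

text \<open>An extension of \<open>phi_tilde\<close> from the dual coalgebra to the full tensor coalgebra.\<close>

definition phl :: "('x list \<Rightarrow>\<^sub>0 'k) \<Rightarrow> ('x list \<Rightarrow>\<^sub>0 'k)" where
  "phl = window sg gam"

lemma plin_phl: "plin phl"
  unfolding phl_def by (rule plin_window)

lemma plin_comp_phl [plin_intros]: "plin F \<Longrightarrow> plin (\<lambda>x. phl (F x))"
  unfolding phl_def by (rule plin_comp_window)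

lemma phl_Nil: "phl (mon []) = 0"
  unfolding phl_def by (rule window_Nil) (simp add: gam_length)

lemma phl_Cons:
  "phl (mon (x # w)) = gam (take 2 (x # w)) * mon (drop 2 (x # w)) + scal (sg [x]) (mon [x] * phl (mon w))"
proof -
  have "phl (mon (x # w)) = (if 2 \<le> length (x # w) then gam (take 2 (x # w)) * mon (drop 2 (x # w)) else 0)
     + scal (sg [x]) (mon [x] * phl (mon w))"
    unfolding phl_def by (rule window_Cons, erule gam_length) (simp_all only: sg_Cons[symmetric] sdeg_Nil power_0)
  moreover have "gam (take 2 (x # w)) = 0" if "\<not> 2 \<le> length (x # w)"
    by (rule gam_length) (use that in simp)
  ultimately show ?thesis by (cases "2 \<le> length (x # w)") (simp_all only: if_True if_False mult_zero_left not_False_eq_True True_implies_equals)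
qed

lemma phl_single [simp]: "phl (mon [x]) = 0"
  using phl_Cons[of x "[]"] phl_Nil gam_length[of "[x]"] by simp

lemma phl_Cons2:
  "phl (mon (x # y # w)) = gam [x, y] * mon w + scal (sg [x]) (mon [x] * phl (mon (y # w)))"
  using phl_Cons[of x "y # w"] by (simp add: numeral_2_eq_2)

lemma keys_phl_mon:
  "u \<in> keys (phl (mon w)) \<Longrightarrow>
    Suc (length u) = length w \<and> Suc (sdeg deg u) = sdeg deg w \<and> (set w \<subseteq> X \<longrightarrow> set u \<subseteq> X)"
proof (induction w arbitrary: u)
  case Nil
  then show ?case using phl_Nil by (simp del: mon_Nil)
next
  case (Cons x w)
  show ?case
  proof (cases w)
    case Nil
    then show ?thesis using Cons.prems by simp
  next
    case (Cons y w')
    have "u \<in> keys (gam [x, y] * mon w' + scal (sg [x]) (mon [x] * phl (mon w)))"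
      using Cons.prems unfolding Cons phl_Cons2 .
    from subsetD[OF keys_add this]
    have "u \<in> keys (gam [x, y] * mon w') \<union>
        keys (scal (sg [x]) (mon [x] * phl (mon w)))" .
    then show ?thesis
    proof
      assume "u \<in> keys (gam [x, y] * mon w')"
      then obtain a where "a \<in> keys (gam [x, y])" "u = a @ w'"
        using keys_mult[of "gam [x, y]" "mon w'"] by (auto simp: plus_list_def)
      then show ?thesis using gam_keys[of a "[x, y]"] by (auto simp: Cons sdeg_def vdeg_def)
    next
      assume "u \<in> keys (scal (sg [x]) (mon [x] * phl (mon w)))"
      then have "u \<in> keys (mon [x] * phl (mon w))" by (auto simp: in_keys_iff)
      then obtain a where "a \<in> keys (phl (mon w))" "u = x # a"
        using keys_mult[of "mon [x]" "phl (mon w)"] by (auto simp: plus_list_def)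
      then show ?thesis using Cons.IH[of a] by (auto simp: sdeg_def)
    qed
  qed
qed

lemma keys_phl:
  assumes "u \<in> keys (phl f)"
  obtains w where "w \<in> keys f" "Suc (length u) = length w" "Suc (sdeg deg u) = sdeg deg w"
    "set w \<subseteq> X \<longrightarrow> set u \<subseteq> X"
proof -
  have "phl f = lin (\<lambda>w. phl (mon w)) f"
    by (rule plin_eq[OF plin_phl plin_lin]) simp
  with assms have "u \<in> keys (lin (\<lambda>w. phl (mon w)) f)" by simp
  from subsetD[OF keys_lin this]
  obtain w where w: "w \<in> keys f" "u \<in> keys (phl (mon w))"
    by (rule UN_E)
  show ?thesis by (rule that[OF w(1)]) (use keys_phl_mon[OF w(2)] in simp_all)
qed

lemma phl_T:
  assumes "f \<in> T X"
  shows "phl f \<in> T X"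
proof -
  have "set u \<subseteq> X" if u: "u \<in> keys (phl f)" for u
  proof -
    from u obtain w where "w \<in> keys f" "set w \<subseteq> X \<longrightarrow> set u \<subseteq> X" by (rule keys_phl)
    then show ?thesis using assms by (auto simp: T_def lists_eq_set)
  qed
  then show ?thesis by (auto simp: T_def lists_eq_set)
qed

lemma lookup_phl_Nil [simp]: "lookup (phl (mon w)) [] = 0"
proof (rule ccontr)
  assume "lookup (phl (mon w)) [] \<noteq> 0"
  then have "[] \<in> keys (phl (mon w))" by (simp add: in_keys_iff)
  from keys_phl_mon[OF this] have "\<exists>x. w = [x]" by (cases w) auto
  then show False using \<open>[] \<in> keys (phl (mon w))\<close> by auto
qed

lemma sg_gam_key:
  assumes "a \<in> keys (gam [x, y])"
  shows "sg a = - (sg [x] * sg [y])"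
  using gam_keys[OF assms] by (auto simp: sdeg_def vdeg_def power_add)

lemma gam_Tpow: "gam w \<in> Tpow X 1"
  using gam_keys[of _ w] by (fastforce simp: Tpow_iff in_keys_iff)

subsection \<open>The square of the coderivation\<close>

text \<open>The operator \<open>(\<theta> \<otimes> id - id \<otimes> \<theta>) \<Delta>\<close>.  On words of length less than two
  both terms vanish, because \<open>tht\<close> does; on words of length two they cancel.\<close>

definition cur :: "'x list \<Rightarrow> ('x list \<Rightarrow>\<^sub>0 'k)" where
  "cur w = tht (take 2 w) * mon (drop 2 w) - mon (take (length w - 2) w) * tht (drop (length w - 2) w)"

text \<open>The contraction of a new letter \<open>x\<close> with the first letter of a word: the term by which \<open>phl\<close>
  fails to commute with prefixing \<open>x\<close>.\<close>

definition graft :: "'x \<Rightarrow> ('x list \<Rightarrow>\<^sub>0 'k) \<Rightarrow> ('x list \<Rightarrow>\<^sub>0 'k)" where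
  "graft x = lin (\<lambda>w. gam (x # take 1 w) * mon (drop 1 w))"

lemma plin_comp_graft [plin_intros]: "plin F \<Longrightarrow> plin (\<lambda>t. graft x (F t))"
  unfolding graft_def by (rule plin_comp_lin)

lemma graft_Cons: "graft x (mon (y # w)) = gam [x, y] * mon w"
  by (simp add: graft_def)

lemma phl_mult_left: "phl (mon [x] * t) = graft x t + scal (sg [x]) (mon [x] * phl t)"
proof (rule plin_eq[of "\<lambda>t. phl (mon [x] * t)"
    "\<lambda>t. graft x t + scal (sg [x]) (mon [x] * phl t)" t])
  fix w show "phl (mon [x] * mon w) = graft x (mon w) + scal (sg [x]) (mon [x] * phl (mon w))"
    by (cases w) (simp_all add: phl_Cons2 graft_Cons phl_Nil graft_def gam_length del: mon_Nil)
qed (intro plin_intros)+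

lemma graft_mult: "graft x (mon [y] * t) = gam [x, y] * t"
proof (rule plin_eq[of "\<lambda>t. graft x (mon [y] * t)" "\<lambda>t. gam [x, y] * t" t])
  fix w show "graft x (mon [y] * mon w) = gam [x, y] * mon w" by (simp add: graft_Cons)
qed (intro plin_intros)+

lemma graft_gam: "graft x (gam m * mon w) = lin (\<lambda>u. gam (x # u)) (gam m) * mon w"
proof (rule plin_eq_on[of "\<lambda>t. graft x (t * mon w)"
    "\<lambda>t. lin (\<lambda>u. gam (x # u)) t * mon w" "gam m"])
  fix u assume "u \<in> keys (gam m)"
  then obtain a where "u = [a]" using gam_keys by blast
  then show "graft x (mon u * mon w) = lin (\<lambda>u. gam (x # u)) (mon u) * mon w"
    by (simp add: graft_Cons)
qed (intro plin_intros)+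

lemma phl_gam_mult:
  "phl (gam [x, y] * mon (z # w)) = lin (\<lambda>u. gam (u @ [z])) (gam [x, y]) * mon w
    - scal (sg [x] * sg [y]) (gam [x, y] * phl (mon (z # w)))"
proof (rule plin_eq_on[of "\<lambda>t. phl (t * mon (z # w))"
    "\<lambda>t. lin (\<lambda>u. gam (u @ [z])) t * mon w
    - scal (sg [x] * sg [y]) (t * phl (mon (z # w)))" "gam [x, y]"])
  fix u assume u: "u \<in> keys (gam [x, y])"
  then obtain a where "u = [a]" using gam_keys by blast
  then show "phl (mon u * mon (z # w)) = lin (\<lambda>u. gam (u @ [z])) (mon u) * mon w
    - scal (sg [x] * sg [y]) (mon u * phl (mon (z # w)))"
    using sg_gam_key[OF u] by (simp add: phl_Cons2)
qed (intro plin_intros)+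

lemma phl_gam: "phl (gam m) = 0"
proof (rule plin_eq_on[of phl "\<lambda>_. 0" "gam m"])
  fix u assume "u \<in> keys (gam m)"
  then show "phl (mon u) = 0" using gam_keys by fastforce
qed (auto intro: plin_phl plinI)

text \<open>The contraction of \<open>x\<close> with \<open>y\<close> and that of two letters after \<open>y\<close> can be done in either
  order, with opposite signs, and cancel.  What remains on top of \<open>x\<close> times the square on \<open>y # z # w\<close> are the two
  ways to contract \<open>x\<close>, \<open>y\<close>, \<open>z\<close> to a single letter.\<close>

lemma phl_phl_Cons3:
  "phl (phl (mon (x # y # z # w))) =
    (lin (\<lambda>u. gam (u @ [z])) (gam [x, y]) + scal (sg [x]) (lin (\<lambda>u. gam (x # u)) (gam [y, z]))) * mon w
    + mon [x] * phl (phl (mon (y # z # w)))"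
proof -
  have 1: "phl (phl (mon (x # y # z # w))) = phl (gam [x, y] * mon (z # w))
      + scal (sg [x]) (phl (mon [x] * phl (mon (y # z # w))))"
    by (simp only: phl_Cons2[of x y] plin_add[OF plin_phl] plin_scal[OF plin_phl])
  have 2: "graft x (phl (mon (y # z # w))) = lin (\<lambda>u. gam (x # u)) (gam [y, z]) * mon w
      + scal (sg [y]) (gam [x, y] * phl (mon (z # w)))"
    unfolding phl_Cons2[of y z] graft_def lin_add lin_scal
    unfolding graft_def[symmetric] graft_gam graft_mult ..
  show ?thesis
    unfolding 1 phl_gam_mult phl_mult_left 2
    by (simp add: pm.scale_right_distrib scal_mult_left distrib_right)
qed

lemma phl_phl_Cons:
  "phl (phl (mon (x # w))) =
    (if 3 \<le> length (x # w) then phl (phl (mon (take 3 (x # w)))) * mon (drop 3 (x # w)) else 0)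
    + mon [x] * phl (phl (mon w))"
proof (cases w)
  case Nil
  then show ?thesis using phl_Nil plin_0[OF plin_phl] by (simp del: mon_Nil)
next
  case (Cons y w')
  show ?thesis
  proof (cases w')
    case Nil
    then show ?thesis
      using Cons phl_Cons2[of x y "[]"] by (simp add: phl_gam plin_0[OF plin_phl])
  next
    case (Cons z w'')
    have "phl (phl (mon [x, y, z])) =
      lin (\<lambda>u. gam (u @ [z])) (gam [x, y]) + scal (sg [x]) (lin (\<lambda>u. gam (x # u)) (gam [y, z]))"
      using phl_phl_Cons3[of x y z "[]"] phl_Cons2[of y z "[]"] by (simp add: phl_gam)
    then show ?thesis using \<open>w = y # w'\<close> Cons phl_phl_Cons3[of x y z w'']
      by (simp add: numeral_3_eq_3)
  qed
qed

text \<open>The curvature telescopes: the term \<open>\<theta> \<otimes> id\<close> at the front of a word and the term \<open>id \<otimes> \<theta>\<close>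
  at its back are the ends of a sum in which the contributions of neighbouring subwords of length
  three cancel.\<close>

lemma cur_Cons:
  "cur (x # w) = (if 3 \<le> length (x # w) then cur (take 3 (x # w)) * mon (drop 3 (x # w)) else 0)
    + mon [x] * cur w"
proof (cases w)
  case Nil
  then show ?thesis by (simp add: cur_def tht_length)
next
  case (Cons y w')
  show ?thesis
  proof (cases w')
    case Nil
    then show ?thesis using Cons by (simp add: cur_def tht_length numeral_2_eq_2)
  next
    case (Cons z w'')
    have 3: "cur [x, y, z] = tht [x, y] * mon [z] - mon [x] * tht [y, z]"
      by (simp add: cur_def numeral_2_eq_2)
    have n: "length (x # y # z # w'') - 2 = Suc (length w'')" "length (y # z # w'') - 2 = length w''"
      by simp_all
    have "cur (x # y # z # w'') = tht [x, y] * mon (z # w'')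
        - mon [x] * (mon (take (length w'') (y # z # w'')) * tht (drop (length w'') (y # z # w'')))"
      unfolding cur_def n by (simp add: numeral_2_eq_2 mult.assoc[symmetric])
    moreover have "cur (y # z # w'') = tht [y, z] * mon w''
        - mon (take (length w'') (y # z # w'')) * tht (drop (length w'') (y # z # w''))"
      unfolding cur_def n by (simp add: numeral_2_eq_2)
    ultimately show ?thesis using \<open>w = y # w'\<close> Cons
      by (simp add: 3 numeral_3_eq_3 left_diff_distrib right_diff_distrib mult.assoc)
  qed
qed

text \<open>The failure of the curvature identity in weight three.\<close>

definition defect :: "'x list \<Rightarrow> ('x list \<Rightarrow>\<^sub>0 'k)" where
  "defect m = (if length m = 3 then phl (phl (mon m)) - cur m else 0)"

text \<open>The square of the coderivation and the curvature satisfy the same recursion along a word, so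
  their difference is determined by subwords of length three.\<close>

lemma phl_phl: "phl (phl f) = lin cur f + window (\<lambda>_. 1) defect f"
proof (rule plin_eq[of "\<lambda>f. phl (phl f)"
    "\<lambda>f. lin cur f + window (\<lambda>_. 1) defect f" f])
  fix w
  have "phl (phl (mon w)) - cur w = window (\<lambda>_. 1) defect (mon w)"
  proof (induction w)
    case Nil
    have "defect [] = 0" "cur [] = 0" by (simp_all add: defect_def cur_def tht_length)
    then show ?case
      using window_Nil[of defect "\<lambda>_. 1"] phl_Nil plin_0[OF plin_phl] by simp
  next
    case (Cons x w)
    have "window (\<lambda>_. 1) defect (mon (x # w)) =
        (if 3 \<le> length (x # w) then defect (take 3 (x # w)) * mon (drop 3 (x # w)) else 0)
        + scal 1 (mon [x] * window (\<lambda>_. 1) defect (mon w))"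
      by (rule window_Cons) (simp_all add: defect_def)
    moreover have "defect (take 3 (x # w)) = phl (phl (mon (take 3 (x # w)))) - cur (take 3 (x # w))"
      if "3 \<le> length (x # w)" using that by (simp add: defect_def)
    ultimately show ?case
      unfolding phl_phl_Cons[of x w] cur_Cons[of x w] Cons.IH[symmetric]
      by (cases "3 \<le> length (x # w)") (simp_all add: left_diff_distrib right_diff_distrib)
  qed
  then show "phl (phl (mon w)) = lin cur (mon w) + window (\<lambda>_. 1) defect (mon w)"
    by (simp add: algebra_simps)
qed (intro plin_intros)+

subsection \<open>Slices of the coderivation\<close>

text \<open>Removing an outer letter commutes with \<open>phl\<close> except for the terms in which that letter is
  itself the result of a contraction at the edge.\<close>

lemma slice_phl_left:
  "slice [x] [] (phl f) = lin (\<lambda>w. scal (lookup (gam (take 2 w)) [x]) (mon (drop 2 w))) f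
    + scal (sg [x]) (phl (slice [x] [] f))"
proof (rule plin_eq[of "\<lambda>f. slice [x] [] (phl f)"
    "\<lambda>f. lin (\<lambda>w. scal (lookup
    (gam (take 2 w)) [x]) (mon (drop 2 w))) f + scal (sg [x]) (phl (slice [x] [] f))" f])
  fix w
  have phl0: "phl 0 = 0" and phl1: "phl 1 = 0" and slice0: "slice [x] [] (0 :: _ \<Rightarrow>\<^sub>0 'k) = 0"
    using plin_0[OF plin_phl] phl_Nil plin_0[OF plin_slice] by auto
  show "slice [x] [] (phl (mon w)) = lin (\<lambda>w. scal (lookup (gam (take 2 w)) [x])
      (mon (drop 2 w))) (mon w) + scal (sg [x]) (phl (slice [x] [] (mon w)))"
  proof (cases w)
    case Nil
    have "slice [x] [] (mon [] :: _ \<Rightarrow>\<^sub>0 'k) = 0"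
      by (rule poly_mapping_eqI) (simp add: lookup_single when_def del: mon_Nil)
    then show ?thesis using Nil phl_Nil by (simp add: phl0 slice0 gam_length del: mon_Nil)
  next
    case (Cons y w')
    show ?thesis
    proof (cases w')
      case Nil
      have "slice [x] [] (mon [y] :: _ \<Rightarrow>\<^sub>0 'k) = (if x = y then mon [] else 0)"
        by (simp add: slice_mon_Cons)
      then show ?thesis using Cons Nil by (simp add: slice0 gam_length phl0 phl1)
    next
      case (Cons z w'')
      have "slice [x] [] (gam [y, z] * mon w'') = scal (lookup (gam [y, z]) [x]) (mon w'')"
        using slice_Tpow_mult[OF gam_Tpow, of "[x]" "[]" "[y, z]" "mon w''"] by simp
      moreover have "slice [x] [] (mon [y] * phl (mon w')) = (if y = x then phl (mon w') else 0)"
        using slice_mult_left[of "[y]" "[x]" "[]" "phl (mon w')"] by simp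
      moreover have "slice [x] [] (mon w :: _ \<Rightarrow>\<^sub>0 'k) = (if x = y then mon w' else 0)"
        using \<open>w = y # w'\<close> by (simp add: slice_mon_Cons)
      ultimately show ?thesis using \<open>w = y # w'\<close> Cons
        by (auto simp: phl_Cons2 plin_add[OF plin_slice] plin_scal[OF plin_slice] numeral_2_eq_2 phl0)
    qed
  qed
qed (intro plin_intros)+

lemma phl_snoc2:
  "phl (mon (w @ [y, z])) = phl (mon (w @ [y])) * mon [z] + scal (sg w) (mon w * gam [y, z])"
proof (induction w)
  case Nil
  then show ?case using phl_Cons2[of y z "[]"] by simp
next
  case (Cons a w)
  have 1: "take 2 (a # w @ [y, z]) = take 2 (a # w @ [y])" "drop 2 (a # w @ [y, z]) = drop 2 (a # w @ [y]) @ [z]"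
    by (cases w; simp add: numeral_2_eq_2)+
  have "phl (mon (a # w @ [y, z])) = gam (take 2 (a # w @ [y])) * mon (drop 2 (a # w @ [y])) * mon [z]
     + scal (sg [a]) (mon [a] * (phl (mon (w @ [y])) * mon [z] + scal (sg w) (mon w * gam [y, z])))"
    unfolding phl_Cons[of a "w @ [y, z]"] 1 Cons.IH by (simp add: mult.assoc)
  also have "\<dots> = phl (mon (a # w @ [y])) * mon [z] + scal (sg (a # w)) (mon (a # w) * gam [y, z])"
    unfolding phl_Cons[of a "w @ [y]"] sg_Cons[of a w]
    by (simp add: distrib_left distrib_right mult.assoc[symmetric] scal_mult_left[symmetric]
        scal_mult_right[symmetric] pm.scale_right_distrib)
  finally show ?case by simp
qed

lemma slice_phl_right:
  "slice [] [x] (phl f) = lin (\<lambda>w. scal (sg (take (length w - 2) w)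
      * lookup (gam (drop (length w - 2) w)) [x]) (mon (take (length w - 2) w))) f
    + phl (slice [] [x] f)"
proof (rule plin_eq[of "\<lambda>f. slice [] [x] (phl f)"
    "\<lambda>f. lin (\<lambda>w. scal (sg (take (length w - 2) w)
      * lookup (gam (drop (length w - 2) w)) [x]) (mon (take (length w - 2) w))) f
    + phl (slice [] [x] f)" f])
  fix w
  have phl0: "phl 0 = 0" and phl1: "phl 1 = 0" and slice0: "slice [] [x] (0 :: _ \<Rightarrow>\<^sub>0 'k) = 0"
    using plin_0[OF plin_phl] phl_Nil plin_0[OF plin_slice] by auto
  have slice_snoc: "slice [] [x] (mon (u @ [y]) :: _ \<Rightarrow>\<^sub>0 'k) = (if y = x then mon u else 0)" for u y
    using slice_mult_right[of "[y]" "[x]" "[]" "mon u :: _ \<Rightarrow>\<^sub>0 'k"] by simp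
  show "slice [] [x] (phl (mon w)) = lin (\<lambda>w. scal (sg (take (length w - 2) w)
      * lookup (gam (drop (length w - 2) w)) [x]) (mon (take (length w - 2) w))) (mon w)
    + phl (slice [] [x] (mon w))"
  proof (cases w rule: rev_cases)
    case Nil
    have "slice [] [x] (mon [] :: _ \<Rightarrow>\<^sub>0 'k) = 0"
      by (rule poly_mapping_eqI) (simp add: lookup_single when_def del: mon_Nil)
    then show ?thesis using Nil phl_Nil by (simp add: phl0 slice0 gam_length del: mon_Nil)
  next
    case (snoc w' z)
    show ?thesis
    proof (cases w' rule: rev_cases)
      case Nil
      then show ?thesis using \<open>w = w' @ [z]\<close> slice_snoc[of "[]" z]
        by (simp add: slice0 gam_length phl0 phl1)
    next
      case (snoc w'' y)
      have "slice [] [x] (mon w'' * gam [y, z]) = scal (lookup (gam [y, z]) [x]) (mon w'')"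
        using slice_mult_Tpow[OF gam_Tpow, of "[x]" "[]" "mon w''" "[y, z]"] by simp
      moreover have "slice [] [x] (phl (mon w') * mon [z]) = (if z = x then phl (mon w') else 0)"
        using slice_mult_right[of "[z]" "[x]" "[]" "phl (mon w')"] by simp
      moreover have "slice [] [x] (mon w :: _ \<Rightarrow>\<^sub>0 'k) = (if z = x then mon w' else 0)"
        using slice_snoc[of w' z] \<open>w = w' @ [z]\<close> by simp
      ultimately show ?thesis using \<open>w = w' @ [z]\<close> snoc phl_snoc2[of w'' y z]
        by (auto simp: plin_add[OF plin_slice] plin_scal[OF plin_slice] phl0)
    qed
  qed
qed (intro plin_intros)+

text \<open>The edge terms are linear combinations of slices, hence stay in every subspace that is closed
  under slices.\<close>

lemma left_contraction_slices:
  "lin (\<lambda>w. scal (\<alpha> (take 2 w)) (mon (drop 2 w))) f =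
    (\<Sum>m\<in>take 2 ` keys f. scal (\<alpha> m) (slice m [] f))"
  if \<alpha>: "\<And>m. length m \<noteq> 2 \<Longrightarrow> \<alpha> m = 0" for f :: "'x list \<Rightarrow>\<^sub>0 'k"
proof (rule plin_eq_on[of "\<lambda>g. lin (\<lambda>w. scal (\<alpha> (take 2 w)) (mon (drop 2 w))) g"
    "\<lambda>g. \<Sum>m\<in>take 2 ` keys f. scal (\<alpha> m) (slice m [] g)" f])
  fix w assume w: "w \<in> keys f"
  have "(\<Sum>m\<in>take 2 ` keys f. scal (\<alpha> m) (slice m [] (mon w)))
      = (\<Sum>m\<in>take 2 ` keys f. if m = take 2 w then scal (\<alpha> (take 2 w)) (mon (drop 2 w)) else 0)"
  proof (rule sum.cong[OF refl])
    fix m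
    show "scal (\<alpha> m) (slice m [] (mon w)) =
      (if m = take 2 w then scal (\<alpha> (take 2 w)) (mon (drop 2 w)) else 0)"
    proof (cases "length m = 2")
      case True
      have "slice m [] (mon w :: _ \<Rightarrow>\<^sub>0 'k) = (if m = take 2 w then mon (drop 2 w) else 0)"
      proof (cases "m = take 2 w")
        case eq: True
        then show ?thesis using slice_mon[of m "[]" "drop 2 w"] by simp
      next
        case False
        then have "w \<noteq> m @ k" for k using True by auto
        then show ?thesis using False by (intro poly_mapping_eqI) (simp add: lookup_single when_def)
      qed
      then show ?thesis by auto
    qed (auto simp: \<alpha>)
  qed
  also have "\<dots> = scal (\<alpha> (take 2 w)) (mon (drop 2 w))"
    using w by (subst sum.delta) auto
  finally show "lin (\<lambda>w. scal (\<alpha> (take 2 w)) (mon (drop 2 w))) (mon w)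
      = (\<Sum>m\<in>take 2 ` keys f. scal (\<alpha> m) (slice m [] (mon w)))"
    by simp
qed (intro plin_intros)+

lemma right_contraction_slices:
  "lin (\<lambda>w. scal (\<beta> (take (length w - 2) w) * \<alpha> (drop (length w - 2) w)) (mon (take (length w - 2) w))) f =
    (\<Sum>m\<in>(\<lambda>w. drop (length w - 2) w) ` keys f. scal (\<alpha> m) (diag \<beta> (slice [] m f)))"
  if \<alpha>: "\<And>m. length m \<noteq> 2 \<Longrightarrow> \<alpha> m = 0" for f :: "'x list \<Rightarrow>\<^sub>0 'k"
proof (rule plin_eq_on[of "\<lambda>g. lin (\<lambda>w. scal (\<beta> (take (length w - 2) w) * \<alpha> (drop (length w - 2) w))
      (mon (take (length w - 2) w))) g"
    "\<lambda>g. \<Sum>m\<in>(\<lambda>w. drop (length w - 2) w) ` keys f. scal (\<alpha> m) (diag \<beta> (slice [] m g))" f])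
  fix w assume w: "w \<in> keys f"
  let ?d = "\<lambda>w. drop (length w - 2) w" and ?t = "\<lambda>w. take (length w - 2) w"
  have "(\<Sum>m\<in>?d ` keys f. scal (\<alpha> m) (diag \<beta> (slice [] m (mon w))))
      = (\<Sum>m\<in>?d ` keys f. if m = ?d w then scal (\<beta> (?t w) * \<alpha> (?d w)) (mon (?t w)) else 0)"
  proof (rule sum.cong[OF refl])
    fix m
    show "scal (\<alpha> m) (diag \<beta> (slice [] m (mon w))) =
      (if m = ?d w then scal (\<beta> (?t w) * \<alpha> (?d w)) (mon (?t w)) else 0)"
    proof (cases "length m = 2")
      case True
      have "diag \<beta> (slice [] m (mon w)) = (if m = ?d w then scal (\<beta> (?t w)) (mon (?t w)) else 0)"
      proof (cases "m = ?d w")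
        case eq: True
        then have "slice [] m (mon w :: _ \<Rightarrow>\<^sub>0 'k) = mon (?t w)"
          using slice_mon[of "[]" m "?t w"] by simp
        then show ?thesis using eq by (simp add: diag_def)
      next
        case False
        then have "w \<noteq> k @ m" for k using True by auto
        then show ?thesis using False by (intro poly_mapping_eqI) (simp add: lookup_single when_def)
      qed
      then show ?thesis by (auto simp: mult.commute)
    qed (auto simp: \<alpha>)
  qed
  also have "\<dots> = scal (\<beta> (?t w) * \<alpha> (?d w)) (mon (?t w))"
    using w by (subst sum.delta) auto
  finally show "lin (\<lambda>w. scal (\<beta> (?t w) * \<alpha> (?d w)) (mon (?t w))) (mon w)
      = (\<Sum>m\<in>?d ` keys f. scal (\<alpha> m) (diag \<beta> (slice [] m (mon w))))"
    by simp
qed (intro plin_intros)+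

end

section \<open>Derivations of the cobar construction\<close>

context word_ops
begin

definition on_letters :: "('x list \<Rightarrow> ('x list list \<Rightarrow>\<^sub>0 'k)) \<Rightarrow> 'x list list \<Rightarrow> ('x list list \<Rightarrow>\<^sub>0 'k)" where
  "on_letters g W = (if length W = 1 then g (hd W) else 0)"

text \<open>Being a signed sum over subwords consisting of one letter, this is the derivation with value
  \<open>g w\<close> on the generator \<open>w\<close>.\<close>

definition der :: "('x list \<Rightarrow> ('x list list \<Rightarrow>\<^sub>0 'k)) \<Rightarrow> ('x list list \<Rightarrow>\<^sub>0 'k) \<Rightarrow> ('x list list \<Rightarrow>\<^sub>0 'k)" where
  "der g = window csg (on_letters g)"

lemma plin_der: "plin (der g)"
  unfolding der_def by (rule plin_window)

lemma plin_comp_der [plin_intros]: "plin F \<Longrightarrow> plin (\<lambda>x. der g (F x))"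
  unfolding der_def by (rule plin_comp_window)

lemma der_Nil: "der g (mon []) = 0"
  unfolding der_def by (rule window_Nil) (simp add: on_letters_def)

lemma der_one [simp]: "der g 1 = 0"
  using der_Nil[of g] by simp

lemma der_Cons: "der g (mon (w # W)) = g w * mon W + scal (csg [w]) (mon [w] * der g (mon W))"
proof -
  have "der g (mon (w # W)) = (if 1 \<le> length (w # W) then on_letters g (take 1 (w # W)) * mon (drop 1 (w # W)) else 0)
     + scal (csg [w]) (mon [w] * der g (mon W))"
    unfolding der_def by (rule window_Cons) (simp_all only: on_letters_def if_False csg_Cons[symmetric] csg_Nil)
  then show ?thesis by (simp add: on_letters_def)
qed

lemma der_letter [simp]: "der g (mon [w]) = g w"
  using der_Cons[of g w "[]"] by simp

lemma der_desusp: "der g (desusp c) = lin g c"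
  by (rule plin_eq[of "\<lambda>c. der g (desusp c)" "lin g" c]) (intro plin_intros plin_lin | simp)+

text \<open>The grading involution \<open>diag csg\<close> is multiplicative; it carries the sign in the Leibniz rule
  \<open>der_mult\<close>.\<close>

lemma diag_csg_mult: "diag csg (x * y) = diag csg x * diag csg y"
proof (rule plin_eq[of "\<lambda>x. diag csg (x * y)" "\<lambda>x. diag csg x * diag csg y" x])
  fix U
  show "diag csg (mon U * y) = diag csg (mon U) * diag csg y"
  proof (rule plin_eq[of "\<lambda>y. diag csg (mon U * y)"
      "\<lambda>y. diag csg (mon U) * diag csg y" y])
    fix V show "diag csg (mon U * mon V) = diag csg (mon U) * diag csg (mon V)"
      by (simp add: diag_def mult_single plus_list_def cobar_deg_def power_add)
  qed (intro plin_intros)+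
qed (intro plin_intros)+

lemma diag_csg_mon: "diag csg (mon W) = scal (csg W) (mon W)"
  by (simp add: diag_def)

lemma der_mult_mon: "der g (mon U * y) = der g (mon U) * y + scal (csg U) (mon U * der g y)"
proof (induction U)
  case Nil
  then show ?case by simp
next
  case (Cons w U)
  have "der g (mon [w] * z) = g w * z + scal (csg [w]) (mon [w] * der g z)" for z
  proof (rule plin_eq[of "\<lambda>z. der g (mon [w] * z)"
      "\<lambda>z. g w * z + scal (csg [w]) (mon [w] * der g z)" z])
    fix W show "der g (mon [w] * mon W) = g w * mon W + scal (csg [w]) (mon [w] * der g (mon W))"
      by (simp add: der_Cons)
  qed (intro plin_intros)+
  from this[of "mon U * y"] show ?case
    unfolding Cons.IH
    by (simp add: der_Cons[of g w U] csg_Cons[of w U] mult.assoc[symmetric] distrib_left distrib_right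
        pm.scale_right_distrib scal_mult_left[symmetric] scal_mult_right[symmetric])
qed

lemma der_mult: "der g (x * y) = der g x * y + diag csg x * der g y"
proof (rule plin_eq[of "\<lambda>x. der g (x * y)"
    "\<lambda>x. der g x * y + diag csg x * der g y" x])
  fix U show "der g (mon U * y) = der g (mon U) * y + diag csg (mon U) * der g y"
    by (simp add: der_mult_mon diag_csg_mon scal_mult_left)
qed (intro plin_intros)+

lemma der_add_gen: "der (\<lambda>w. g w + h w) x = der g x + der h x"
proof (rule plin_eq[of "der (\<lambda>w. g w + h w)" "\<lambda>x. der g x + der h x" x])
  fix W show "der (\<lambda>w. g w + h w) (mon W) = der g (mon W) + der h (mon W)"
    by (induction W) (simp_all add: der_Cons distrib_left distrib_right pm.scale_right_distrib)
qed (intro plin_intros plin_der)+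

lemma der_desusp2:
  "der g (mon [u, v]) = g u * mon [v] + scal (csg [u]) (mon [u] * g v)"
  using der_Cons[of g u "[v]"] by simp

text \<open>The derivation evaluates its generating map on tensor factors only, so any map which agrees
  with a linear one there gives the same result.\<close>

lemma derivation_eq_der:
  assumes "\<And>P Q. g (Poly_Mapping.map_key (\<lambda>w. P @ [w] @ Q) f) =
    lin h (Poly_Mapping.map_key (\<lambda>w. P @ [w] @ Q) f)"
  shows "derivation deg g f = der h f"
proof -
  let ?J = "{(P, Q). \<exists>w. P @ [w] @ Q \<in> keys f}"
  have key: "lin (on_letters h) (slice P Q f) = lin h (Poly_Mapping.map_key (\<lambda>w. P @ [w] @ Q) f)" for P Q
  proof -
    have "lin (on_letters h) F = lin h (Poly_Mapping.map_key (\<lambda>w. [w]) F)" for F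
    proof (rule plin_eq[of "lin (on_letters h)"
        "\<lambda>F. lin h (Poly_Mapping.map_key (\<lambda>w. [w]) F)" F])
      have inj1: "inj (\<lambda>w :: 'x list. [w])" by (simp add: inj_def)
      show "plin (\<lambda>F. lin h (Poly_Mapping.map_key (\<lambda>w. [w]) F))"
      proof (rule plin_comp_lin, rule plinI)
        fix c and F :: "'x list list \<Rightarrow>\<^sub>0 'k"
        show "Poly_Mapping.map_key (\<lambda>w. [w]) (scal c F) = scal c (Poly_Mapping.map_key (\<lambda>w. [w]) F)"
          by (rule poly_mapping_eqI) (simp add: map_key.rep_eq[OF inj1])
      qed (rule map_key_plus[OF inj1])
      fix W
      show "lin (on_letters h) (mon W) = lin h (Poly_Mapping.map_key (\<lambda>w. [w]) (mon W))"
      proof (cases "length W = 1")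
        case True
        then obtain w where W: "W = [w]" by (auto simp: length_Suc_conv)
        show ?thesis unfolding W by (simp add: map_key_single[OF inj1] on_letters_def)
      next
        case False
        then have "W \<noteq> [w]" for w by auto
        then have "Poly_Mapping.map_key (\<lambda>w. [w]) (mon W :: _ \<Rightarrow>\<^sub>0 'k) = 0"
          by (intro poly_mapping_eqI) (simp add: map_key.rep_eq[OF inj1] lookup_single when_def)
        then show ?thesis using False by (simp add: on_letters_def)
      qed
    qed (rule plin_lin)
    moreover have "Poly_Mapping.map_key (\<lambda>w. [w]) (slice P Q f) = Poly_Mapping.map_key (\<lambda>w. P @ [w] @ Q) f"
      by (rule poly_mapping_eqI) (simp add: map_key.rep_eq inj_def)
    ultimately show ?thesis by simp
  qed
  have sub: "?J \<subseteq> frames f" unfolding frames_def by blast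
  have "der h f = (\<Sum>p\<in>frames f. single (fst p) (csg (fst p)) *
      lin (on_letters h) (slice (fst p) (snd p) f) * mon (snd p))"
    unfolding der_def window_def by (simp add: split_def)
  also have "\<dots> = (\<Sum>p\<in>?J. single (fst p) (csg (fst p)) *
      lin (on_letters h) (slice (fst p) (snd p) f) * mon (snd p))"
  proof (rule sum.mono_neutral_right[OF finite_frames sub], rule ballI)
    fix p assume p: "p \<in> frames f - ?J"
    have "Poly_Mapping.map_key (\<lambda>w. fst p @ [w] @ snd p) f = 0"
      using p by (intro poly_mapping_eqI) (auto simp: map_key.rep_eq inj_def in_keys_iff)
    then show "single (fst p) (csg (fst p)) *
      lin (on_letters h) (slice (fst p) (snd p) f) * mon (snd p) = 0" by (simp add: key)
  qed
  also have "\<dots> = derivation deg g f"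
    unfolding derivation_def by (simp only: split_def key assms[symmetric])
  finally show ?thesis ..
qed

subsection \<open>The splitting part of the differential\<close>

text \<open>The values of \<open>d\<^sub>2\<close> on the generators, indexed by the cut points of the word.\<close>

definition gen2 :: "'x list \<Rightarrow> ('x list list \<Rightarrow>\<^sub>0 'k)" where
  "gen2 w = (\<Sum>i\<in>{1..<length w}. single [take i w, drop i w] (- sg (take i w)))"

lemma gen2_splits:
  "(\<Sum>(u, v)\<in>{(u, v). u \<noteq> [] \<and> v \<noteq> [] \<and> u @ v = w}. single [u, v] (- sg u * c))
    = scal c (gen2 w)"
proof -
  have "{(u, v). u \<noteq> [] \<and> v \<noteq> [] \<and> u @ v = w} = (\<lambda>i. (take i w, drop i w)) ` {1..<length w}"
  proof (intro equalityI subsetI)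
    fix p assume "p \<in> {(u, v). u \<noteq> [] \<and> v \<noteq> [] \<and> u @ v = w}"
    then obtain u v where p: "p = (u, v)" and *: "u \<noteq> []" "v \<noteq> []" "u @ v = w" by auto
    have "p = (take (length u) w, drop (length u) w)" using *(3) p by auto
    moreover have "length u \<in> {1..<length w}"
      using * by (cases u; cases v) auto
    ultimately show "p \<in> (\<lambda>i. (take i w, drop i w)) ` {1..<length w}" by blast
  qed auto
  moreover have "inj_on (\<lambda>i. (take i w, drop i w)) {1..<length w}"
  proof (rule inj_onI)
    fix i j assume "i \<in> {1..<length w}" "j \<in> {1..<length w}" "(take i w, drop i w) = (take j w, drop j w)"
    then have "length (take i w) = length (take j w)" by simp
    then show "i = j" using \<open>i \<in> _\<close> \<open>j \<in> _\<close> by simp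
  qed
  ultimately show ?thesis
    unfolding gen2_def pm.scale_sum_right by (simp add: sum.reindex mult.commute)
qed

lemma gen2_Nil [simp]: "gen2 [] = 0"
  and gen2_single [simp]: "gen2 [x] = 0"
  by (simp_all add: gen2_def)

text \<open>Cutting \<open>x # w\<close> after its first letter is special; all other cuts arise from those of \<open>w\<close> by
  adjoining \<open>x\<close> to the first piece, which is what \<open>prefix x\<close> does.\<close>

definition prefix :: "'x \<Rightarrow> ('x list list \<Rightarrow>\<^sub>0 'k) \<Rightarrow> ('x list list \<Rightarrow>\<^sub>0 'k)" where
  "prefix x = lin (\<lambda>W. mon ((x # hd W) # tl W))"

lemma plin_comp_prefix [plin_intros]: "plin F \<Longrightarrow> plin (\<lambda>t. prefix x (F t))"
  unfolding prefix_def by (rule plin_comp_lin)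

lemma prefix_mon [simp]: "prefix x (single (u # W) a) = single ((x # u) # W) a"
  by (simp add: prefix_def)

lemma gen2_Cons:
  assumes "w \<noteq> []"
  shows "gen2 (x # w) = scal (sg [x]) (prefix x (gen2 w) - mon [[x], w])"
proof -
  let ?t = "\<lambda>i. single [take i (x # w), drop i (x # w)] (- sg (take i (x # w)))"
  have "gen2 (x # w) = (\<Sum>i\<in>{1..<Suc (length w)}. ?t i)" by (simp add: gen2_def)
  also have "\<dots> = ?t 1 + (\<Sum>i\<in>{Suc 1..<Suc (length w)}. ?t i)"
    using assms by (intro sum.atLeast_Suc_lessThan) simp
  also have "(\<Sum>i\<in>{Suc 1..<Suc (length w)}. ?t i) = (\<Sum>i\<in>{1..<length w}. ?t (Suc i))"
    by (rule sum.shift_bounds_Suc_ivl)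
  also have "\<dots> = scal (sg [x]) (prefix x (gen2 w))"
    unfolding gen2_def prefix_def lin_sum pm.scale_sum_right
  proof (intro sum.cong refl)
    fix i
    show "?t (Suc i) = scal (sg [x]) (lin (\<lambda>W. mon ((x # hd W) # tl W))
        (single [take i w, drop i w] (- sg (take i w))))"
      using sg_Cons[of x "take i w"] by simp
  qed
  finally show ?thesis by (simp add: pm.scale_right_diff_distrib single_uminus)
qed

lemma keys_gen2: "W \<in> keys (gen2 w) \<Longrightarrow> \<exists>u v. W = [u, v] \<and> u \<noteq> [] \<and> v \<noteq> [] \<and> u @ v = w"
proof -
  assume "W \<in> keys (gen2 w)"
  then obtain i where i: "i \<in> {1..<length w}" "W \<in> keys
      (single [take i w, drop i w] (- sg (take i w)))"
    unfolding gen2_def by (rule UN_E[OF subsetD[OF keys_sum]])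
  then have "W = [take i w, drop i w]" by (simp split: if_splits)
  moreover have "take i w \<noteq> []" "drop i w \<noteq> []" using i(1) by auto
  ultimately show ?thesis by (metis append_take_drop_id)
qed

lemma lin_gen2_mult_left:
  assumes "lookup t [] = 0"
  shows "lin gen2 (mon [x] * t) = scal (sg [x]) (prefix x (lin gen2 t) - mon [[x]] * desusp t)"
proof (rule plin_eq_on[of "\<lambda>t. lin gen2 (mon [x] * t)"
    "\<lambda>t. scal (sg [x]) (prefix x (lin gen2 t) - mon [[x]] * desusp t)" t])
  fix w assume "w \<in> keys t"
  then have "w \<noteq> []" using assms by (auto simp: in_keys_iff)
  then show "lin gen2 (mon [x] * mon w) =
      scal (sg [x]) (prefix x (lin gen2 (mon w)) - mon [[x]] * desusp (mon w))"
    by (simp add: gen2_Cons)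
qed (intro plin_intros)+

lemma prefix_mult:
  assumes "lookup S [] = 0"
  shows "prefix x (S * y) = prefix x S * y"
proof (rule plin_eq_on[of "\<lambda>S. prefix x (S * y)" "\<lambda>S. prefix x S * y" S])
  fix W assume "W \<in> keys S"
  then obtain u V where W: "W = u # V" using assms by (cases W) (auto simp: in_keys_iff)
  show "prefix x (mon W * y) = prefix x (mon W) * y" unfolding W
  proof (rule plin_eq[of "\<lambda>y. prefix x (mon (u # V) * y)"
      "\<lambda>y. prefix x (mon (u # V)) * y" y])
    fix U show "prefix x (mon (u # V) * mon U) = prefix x (mon (u # V)) * mon U" by simp
  qed (intro plin_intros)+
qed (intro plin_intros)+

lemma prefix_desusp: "prefix x (desusp t) = desusp (mon [x] * t)"
  by (rule plin_eq[of "\<lambda>t. prefix x (desusp t)" "\<lambda>t. desusp (mon [x] * t)" t])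
    (intro plin_intros | simp)+

lemma lookup_desusp_Nil [simp]: "lookup (desusp c) [] = 0"
  by (simp add: lookup_desusp)

text \<open>On a pair of nonempty words, \<open>coder2\<close> is the derivation with value \<open>- desusp (phl w)\<close> on
  generators, and \<open>graft2\<close> is the correction term for prefixing \<open>x\<close> to the first word.\<close>

definition coder2 :: "'x list list \<Rightarrow> ('x list list \<Rightarrow>\<^sub>0 'k)" where
  "coder2 W = scal (sg (hd W)) (mon [hd W] * desusp (phl (mon (hd (tl W))))) - desusp (phl (mon (hd W))) * mon (tl W)"

definition graft2 :: "'x \<Rightarrow> 'x list list \<Rightarrow> ('x list list \<Rightarrow>\<^sub>0 'k)" where
  "graft2 x W = desusp (graft x (mon (hd W))) * mon (tl W)"

lemma coder2_prefix:
  assumes "\<And>W. W \<in> keys S \<Longrightarrow> length W = 2"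
  shows "lin coder2 (prefix x S) = scal (sg [x]) (prefix x (lin coder2 S)) - lin (graft2 x) S"
proof (rule plin_eq_on[of "\<lambda>S. lin coder2 (prefix x S)"
    "\<lambda>S. scal (sg [x]) (prefix x (lin coder2 S)) - lin (graft2 x) S" S])
  fix W assume "W \<in> keys S"
  then obtain u v where W: "W = [u, v]" using assms by (fastforce simp: length_Suc_conv numeral_2_eq_2)
  let ?A = "mon [x # u] * desusp (phl (mon v))" and ?B = "desusp (mon [x] * phl (mon u)) * mon [v]"
    and ?C = "desusp (graft x (mon u)) * mon [v]"
  have "prefix x (mon [u] * desusp (phl (mon v))) = ?A"
    by (subst prefix_mult) (simp_all add: lookup_single)
  moreover have "prefix x (desusp (phl (mon u)) * mon [v]) = ?B"
    by (subst prefix_mult) (simp_all add: prefix_desusp)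
  moreover have "prefix x (coder2 [u, v]) = scal (sg u) (prefix x (mon [u] * desusp (phl (mon v))))
      - prefix x (desusp (phl (mon u)) * mon [v])"
    by (simp add: coder2_def prefix_def lin_diff lin_scal)
  ultimately have P: "prefix x (coder2 [u, v]) = scal (sg u) ?A - ?B" by simp
  have "desusp (phl (mon (x # u))) = desusp (graft x (mon u)) + scal (sg [x]) (desusp (mon [x] * phl (mon u)))"
    using phl_mult_left[of x "mon u"] by (simp add: desusp_lin lin_add lin_scal)
  then have L: "coder2 [x # u, v] = scal (sg (x # u)) ?A - (?C + scal (sg [x]) ?B)"
    by (simp add: coder2_def distrib_right scal_mult_left)
  show "lin coder2 (prefix x (mon W)) =
      scal (sg [x]) (prefix x (lin coder2 (mon W))) - lin (graft2 x) (mon W)"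
    unfolding W prefix_mon lin_single pm.scale_one P L sg_Cons[of x u]
    by (simp add: graft2_def pm.scale_right_diff_distrib)
qed (intro plin_intros)+

lemma lin_gen2_gam_mult:
  assumes "w \<noteq> []"
  shows "lin gen2 (gam [x, y] * mon w) =
    scal (sg [x] * sg [y]) (desusp (gam [x, y]) * mon [w] - lin (\<lambda>a. prefix (hd a) (gen2 w)) (gam [x, y]))"
proof (rule plin_eq_on[of "\<lambda>g. lin gen2 (g * mon w)"
    "\<lambda>g. scal (sg [x] * sg [y]) (desusp g * mon [w] - lin (\<lambda>a. prefix (hd a) (gen2 w)) g)" "gam [x, y]"])
  fix u assume u: "u \<in> keys (gam [x, y])"
  then obtain a where a: "u = [a]" using gam_keys by blast
  with sg_gam_key[OF u] have "sg [a] = - (sg [x] * sg [y])" by simp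
  then show "lin gen2 (mon u * mon w) = scal (sg [x] * sg [y])
      (desusp (mon u) * mon [w] - lin (\<lambda>a. prefix (hd a) (gen2 w)) (mon u))"
    using assms unfolding a by (simp add: gen2_Cons pm.scale_right_diff_distrib single_uminus)
qed (intro plin_intros)+

lemma graft2_prefix:
  assumes "\<And>W. W \<in> keys S \<Longrightarrow> length W = 2"
  shows "lin (graft2 x) (prefix y S) = lin (\<lambda>a. prefix (hd a) S) (gam [x, y])"
proof (rule plin_eq_on[of "\<lambda>S. lin (graft2 x) (prefix y S)"
    "\<lambda>S. lin (\<lambda>a. prefix (hd a) S) (gam [x, y])" S])
  show "plin (\<lambda>S. lin (\<lambda>a. prefix (hd a) S) (gam [x, y]))"
    unfolding lin_def by (intro plin_intros)
  fix W assume "W \<in> keys S"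
  then obtain u v where W: "W = [u, v]" using assms by (fastforce simp: length_Suc_conv numeral_2_eq_2)
  have "desusp (gam [x, y] * mon u) * mon [v] = lin (\<lambda>a. prefix (hd a) (mon [u, v])) (gam [x, y])"
  proof (rule plin_eq_on[of "\<lambda>g. desusp (g * mon u) * mon [v]"
      "\<lambda>g. lin (\<lambda>a. prefix (hd a) (mon [u, v])) g" "gam [x, y]"])
    fix z assume "z \<in> keys (gam [x, y])"
    then obtain a where "z = [a]" using gam_keys by blast
    then show "desusp (mon z * mon u) * mon [v] = lin (\<lambda>a. prefix (hd a) (mon [u, v])) (mon z)"
      by simp
  qed (intro plin_intros)+
  then show "lin (graft2 x) (prefix y (mon W)) = lin (\<lambda>a. prefix (hd a) (mon W)) (gam [x, y])"
    unfolding W by (simp add: graft2_def graft_Cons)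
qed (intro plin_intros)

text \<open>This is the coderivation property \<open>\<Delta> phl = (phl \<otimes> id + id \<otimes> phl) \<Delta>\<close> after desuspension, and
  amounts to \<open>d\<^sub>1 d\<^sub>2 + d\<^sub>2 d\<^sub>1 = 0\<close>.  By induction along the word: the terms in which the first
  letter stays apart come from the shorter word, and those in which it is contracted match by
  \<open>graft2_prefix\<close>.\<close>

lemma coder2_gen2: "lin coder2 (gen2 w) = lin gen2 (phl (mon w))"
proof (induction w)
  case Nil
  then show ?case using phl_Nil by simp
next
  case (Cons x w)
  have len: "length W = 2" if "W \<in> keys (gen2 w)" for W w
    using keys_gen2[OF that] by auto
  show ?case
  proof (cases w)
    case Nil
    then show ?thesis by simp
  next
    case (Cons y w')
    have graft2: "lin (graft2 x) (gen2 w) = - scal (sg [x]) (lin gen2 (gam [x, y] * mon w'))"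
    proof (cases "w' = []")
      case True
      have "lin gen2 (gam [x, y]) = 0"
      proof (rule lin_eq_0)
        fix a assume "a \<in> keys (gam [x, y])"
        then obtain z where "a = [z]" using gam_keys by blast
        then show "gen2 a = 0" by simp
      qed
      then show ?thesis using Cons True by simp
    next
      case False
      have gp: "lin (graft2 x) (prefix y (gen2 w')) = lin (\<lambda>a. prefix (hd a) (gen2 w')) (gam [x, y])"
        by (rule graft2_prefix) (rule len)
      have "lin (graft2 x) (gen2 w) = scal (sg [y]) (lin (\<lambda>a. prefix (hd a) (gen2 w')) (gam [x, y])
          - desusp (gam [x, y]) * mon [w'])"
        unfolding Cons gen2_Cons[OF False] lin_scal lin_diff gp
        by (simp add: graft2_def graft_Cons[of x y "[]", simplified])
      then show ?thesis unfolding lin_gen2_gam_mult[OF False]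
        by (simp add: pm.scale_right_diff_distrib)
    qed
    have "lin coder2 (gen2 (x # w)) = scal (sg [x]) (lin coder2 (prefix x (gen2 w)) - coder2 [[x], w])"
      using Cons by (simp add: gen2_Cons lin_scal lin_diff)
    also have "lin coder2 (prefix x (gen2 w)) =
        scal (sg [x]) (prefix x (lin coder2 (gen2 w))) - lin (graft2 x) (gen2 w)"
      by (rule coder2_prefix) (rule len)
    also have "scal (sg [x]) (scal (sg [x]) (prefix x (lin coder2 (gen2 w))) - lin (graft2 x) (gen2 w) - coder2 [[x], w])
        = prefix x (lin gen2 (phl (mon w))) - mon [[x]] * desusp (phl (mon w))
        + lin gen2 (gam [x, y] * mon w')"
      unfolding Cons.IH graft2
      by (simp add: coder2_def desusp_lin pm.scale_right_diff_distrib pm.scale_right_distrib algebra_simps)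
    also have "\<dots> = lin gen2 (phl (mon (x # w)))"
    proof -
      have "lin gen2 (mon [x] * phl (mon w))
          = scal (sg [x]) (prefix x (lin gen2 (phl (mon w))) - mon [[x]] * desusp (phl (mon w)))"
        by (rule lin_gen2_mult_left) (rule lookup_phl_Nil)
      moreover have "phl (mon (x # w)) = gam [x, y] * mon w' + scal (sg [x]) (mon [x] * phl (mon w))"
        unfolding Cons by (rule phl_Cons2)
      ultimately show ?thesis by (simp add: lin_add lin_scal add.commute)
    qed
    finally show ?thesis .
  qed
qed

text \<open>The values of \<open>d\<^sub>0\<close> on the generators.\<close>

definition gen0 :: "'x list \<Rightarrow> ('x list list \<Rightarrow>\<^sub>0 'k)" where
  "gen0 w = single [] (lookup (tht w) [])"

lemma gen0_length: "length w \<noteq> 2 \<Longrightarrow> gen0 w = 0"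
  by (simp add: gen0_def tht_length)

lemma tht_scalar: "tht w = single [] (lookup (tht w) [])"
proof (rule poly_mapping_eqI)
  fix u show "lookup (tht w) u = lookup (single [] (lookup (tht w) [])) u"
    using tht_keys[of u w] by (cases "u = []") (auto simp: lookup_single in_keys_iff)
qed

lemma desusp_tht_mult: "desusp (tht m * mon v) = gen0 m * mon [v]" "desusp (mon v * tht m) = mon [v] * gen0 m"
proof -
  have "tht m * mon v = scal (lookup (tht m) []) (mon v)"
    "mon v * tht m = scal (lookup (tht m) []) (mon v)"
    by (subst tht_scalar, simp add: mult_single plus_list_def)+
  then show "desusp (tht m * mon v) = gen0 m * mon [v]" "desusp (mon v * tht m) = mon [v] * gen0 m"
    by (simp_all add: gen0_def desusp_lin mult_single plus_list_def)
qed

lemma lin_gen0: "lin gen0 f = single [] (lookup (lin tht f) [])"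
  unfolding lin_def gen0_def by (rule poly_mapping_eqI) (simp add: lookup_sum lookup_single when_def)

text \<open>\<open>tht\<close> is nonzero only on pairs of letters of degree zero, whose suspension has even degree.\<close>

lemma sg_gen0: "scal (sg u) (gen0 u) = gen0 u"
proof (cases "lookup (tht u) [] = 0")
  case True
  then show ?thesis by (simp add: gen0_def)
next
  case False
  then have "vdeg deg u = 0" using tht_keys[of "[]" u] by (simp add: in_keys_iff)
  moreover have "length u = 2" using False tht_length[of u] by fastforce
  ultimately have "sdeg deg u = 2"
    by (auto simp: sdeg_def vdeg_def length_Suc_conv numeral_2_eq_2)
  then show ?thesis by simp
qed

text \<open>\<open>d\<^sub>0\<close> sees a piece of a cut word only if that piece has length two, so the only cuts that
  contribute are those after the first two and before the last two letters.\<close>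

lemma der_gen0_gen2: "der gen0 (gen2 w) = - desusp (lin cur (mon w))"
proof -
  let ?n = "length w"
  \<comment> \<open>for words of length two both exceptional cut points lie outside the range of the sum\<close>
  have "der gen0 (gen2 w) = (\<Sum>i\<in>{1..<?n}. scal (- sg (take i w)) (der gen0 (mon [take i w, drop i w])))"
    unfolding gen2_def plin_sum[OF plin_der]
    by (intro sum.cong refl) (subst single_scal_mon, rule plin_scal[OF plin_der])
  also have "\<dots> = (\<Sum>i\<in>{1..<?n}. mon [take i w] * gen0 (drop i w) - gen0 (take i w) * mon [drop i w])"
  proof (intro sum.cong refl)
    fix i assume "i \<in> {1..<?n}"
    then have c: "csg [take i w] = - sg (take i w)" by (intro csg_single) auto
    have "scal (- sg (take i w)) (gen0 (take i w) * mon [drop i w]) = - (gen0 (take i w) * mon [drop i w])"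
      using sg_gen0[of "take i w"] by (simp add: scal_mult_left)
    then show "scal (- sg (take i w)) (der gen0 (mon [take i w, drop i w])) =
        mon [take i w] * gen0 (drop i w) - gen0 (take i w) * mon [drop i w]"
      unfolding der_desusp2 c by (simp add: pm.scale_right_diff_distrib)
  qed
  also have "\<dots> = (\<Sum>i\<in>{1..<?n}. mon [take i w] * gen0 (drop i w))
      - (\<Sum>i\<in>{1..<?n}. gen0 (take i w) * mon [drop i w])"
    by (rule sum_subtractf)
  also have "(\<Sum>i\<in>{1..<?n}. gen0 (take i w) * mon [drop i w]) =
      (\<Sum>i\<in>{1..<?n}. if i = 2 then gen0 (take 2 w) * mon [drop 2 w] else 0)"
    by (intro sum.cong refl) (auto simp: gen0_length)
  also have "(\<Sum>i\<in>{1..<?n}. mon [take i w] * gen0 (drop i w)) =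
      (\<Sum>i\<in>{1..<?n}. if i = ?n - 2 then mon [take (?n - 2) w] * gen0 (drop (?n - 2) w) else 0)"
    by (intro sum.cong refl) (auto simp: gen0_length)
  finally have *: "der gen0 (gen2 w) =
      (if ?n - 2 \<in> {1..<?n} then mon [take (?n - 2) w] * gen0 (drop (?n - 2) w) else 0)
      - (if 2 \<in> {1..<?n} then gen0 (take 2 w) * mon [drop 2 w] else 0)"
    by (simp only: sum.delta finite_atLeastLessThan)
  have "- desusp (cur w) = mon [take (?n - 2) w] * gen0 (drop (?n - 2) w) - gen0 (take 2 w) * mon [drop 2 w]"
    by (simp only: cur_def desusp_lin lin_diff minus_diff_eq) (simp only: desusp_lin[symmetric] desusp_tht_mult)
  moreover have "?n < 2 \<or> ?n = 2 \<or> ?n > 2" by linarith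
  ultimately show ?thesis
  proof (elim disjE)
    assume "?n < 2"
    then have "gen0 (drop (?n - 2) w) = 0" "gen0 (take 2 w) = 0" by (simp_all add: gen0_length)
    then show ?thesis using * \<open>- desusp (cur w) = _\<close> by simp
  next
    assume n: "?n = 2"
    then have "cur w = 0" by (simp add: cur_def)
    then show ?thesis using * n by (simp add: desusp_lin)
  next
    assume "?n > 2"
    then have "?n - 2 \<in> {1..<?n}" "2 \<in> {1..<?n}" by auto
    then show ?thesis using * \<open>- desusp (cur w) = _\<close> by simp
  qed
qed

subsection \<open>The full differential\<close>

definition gen :: "'x list \<Rightarrow> ('x list list \<Rightarrow>\<^sub>0 'k)" where
  "gen w = gen0 w - desusp (phl (mon w)) + gen2 w"

lemma lin_gen: "lin gen f = lin gen0 f - desusp (phl f) + lin gen2 f"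
  by (rule plin_eq[of "lin gen" "\<lambda>f. lin gen0 f - desusp (phl f) + lin gen2 f" f])
    (intro plin_intros plin_lin | simp add: gen_def)+

lemma coder2_der: "der (\<lambda>w. - desusp (phl (mon w))) (gen2 w) = lin coder2 (gen2 w)"
proof (rule plin_eq_on[OF plin_der plin_lin])
  fix W assume "W \<in> keys (gen2 w)"
  then obtain u v where "W = [u, v]" "u \<noteq> []" using keys_gen2 by blast
  then show "der (\<lambda>w. - desusp (phl (mon w))) (mon W) = lin coder2 (mon W)"
    by (simp add: der_desusp2 coder2_def csg_single)
qed

text \<open>The square of the differential on a generator, sorted by tensor length: a scalar term, a
  linear term in which the curvature has cancelled, and the square of \<open>d\<^sub>2\<close>.  The quadratic terms
  cancel by \<open>coder2_gen2\<close>.\<close>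

lemma der_gen_gen:
  "der gen (lin gen c) = desusp (window (\<lambda>_. 1) defect c) - lin gen0 (phl c) + der gen2 (lin gen2 c)"
proof (rule plin_eq[of "\<lambda>c. der gen (lin gen c)"
    "\<lambda>c. desusp (window (\<lambda>_. 1) defect c) - lin gen0 (phl c) + der gen2 (lin gen2 c)" c])
  fix w
  have gen: "gen = (\<lambda>w. (gen0 w + - desusp (phl (mon w))) + gen2 w)" by (simp add: gen_def fun_eq_iff)
  have "der gen (gen w) = der gen (gen0 w) - der gen (desusp (phl (mon w))) + der gen (gen2 w)"
    by (simp add: gen_def[of w] plin_add[OF plin_der] plin_diff[OF plin_der])
  moreover have "der gen (gen0 w) = 0"
    unfolding gen0_def by (subst single_scal_mon) (simp add: plin_scal[OF plin_der] del: scal_single)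
  moreover have "der gen (desusp (phl (mon w))) = lin gen0 (phl (mon w)) - desusp (phl (phl (mon w)))
      + lin gen2 (phl (mon w))"
    by (simp add: der_desusp lin_gen)
  moreover have "der gen (gen2 w) = - desusp (cur w) + lin gen2 (phl (mon w)) + der gen2 (gen2 w)"
    unfolding gen der_add_gen coder2_der coder2_gen2 der_gen0_gen2 by simp
  moreover have "desusp (phl (phl (mon w))) = desusp (cur w) + desusp (window (\<lambda>_. 1) defect (mon w))"
    using phl_phl[of "mon w"] by (simp add: desusp_lin lin_add)
  ultimately show "der gen (lin gen (mon w)) = desusp (window (\<lambda>_. 1) defect (mon w))
      - lin gen0 (phl (mon w)) + der gen2 (lin gen2 (mon w))"
    by simp
qed (intro plin_intros)+

end

section \<open>The Koszul dual curved coalgebra\<close>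

lemma ring_subalgebra_ring:
  fixes S :: "'b::ring_1 set"
  assumes "0 \<in> S" "1 \<in> S" "\<And>x y. x \<in> S \<Longrightarrow> y \<in> S \<Longrightarrow> x + y \<in> S"
    "\<And>x y. x \<in> S \<Longrightarrow> y \<in> S \<Longrightarrow> x * y \<in> S" "\<And>x. x \<in> S \<Longrightarrow> - x \<in> S"
  shows "ring (subalgebra_ring S)"
proof (rule ringI)
  show "abelian_group (subalgebra_ring S)"
  proof (rule abelian_groupI)
    fix x assume "x \<in> carrier (subalgebra_ring S)"
    then show "\<exists>y\<in>carrier (subalgebra_ring S). y \<oplus>\<^bsub>subalgebra_ring S\<^esub> x = \<zero>\<^bsub>subalgebra_ring S\<^esub>"
      using assms(5) by (intro bexI[of _ "- x"]) (simp_all add: subalgebra_ring_def)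
  qed (simp_all add: subalgebra_ring_def assms add.assoc add.commute)
  show "Group.monoid (subalgebra_ring S)"
    by (rule Group.monoidI) (simp_all add: subalgebra_ring_def assms mult.assoc)
qed (simp_all add: subalgebra_ring_def algebra_simps)

lemma T_0: "0 \<in> T X"
  by (simp add: T_iff)

lemma T_add: "f \<in> T X \<Longrightarrow> g \<in> T X \<Longrightarrow> f + g \<in> T X"
  and T_neg: "f \<in> T X \<Longrightarrow> - f \<in> T X"
  and T_scal: "f \<in> T X \<Longrightarrow> scal c f \<in> T X"
  for f g :: "'x list \<Rightarrow>\<^sub>0 'k::field"
  by (simp_all add: pm.subspace_add[OF subspace_T]
      pm.subspace_neg[OF subspace_T] pm.subspace_scale[OF subspace_T])

lemma ring_tensor_algebra: "ring (tensor_algebra X)"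
  by (rule ring_subalgebra_ring) (simp_all add: T_0 T_one T_add T_mult T_neg)

lemma carrier_subalgebra_ring [simp]: "carrier (subalgebra_ring S) = S"
  and add_subalgebra_ring [simp]: "x \<oplus>\<^bsub>subalgebra_ring S\<^esub> y = x + y"
  and mult_subalgebra_ring [simp]: "x \<otimes>\<^bsub>subalgebra_ring S\<^esub> y = x * y"
  and zero_subalgebra_ring [simp]: "\<zero>\<^bsub>subalgebra_ring S\<^esub> = 0"
  by (simp_all add: subalgebra_ring_def)

context qlc
begin

abbreviation I :: "('x list \<Rightarrow>\<^sub>0 'k) set" where
  "I \<equiv> ideal_gen X R"

lemma R_T: "R \<subseteq> T X"
  using R_le by (auto simp: Tle_def)

lemma ideal_I: "ideal I (tensor_algebra X)"
  by (rule ring.genideal_ideal[OF ring_tensor_algebra]) (simp add: R_T)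

lemma I_R: "R \<subseteq> I"
  using ring.genideal_self[OF ring_tensor_algebra, of R X] R_T by simp

lemma I_T: "I \<subseteq> T X"
  using ideal.Icarr[OF ideal_I] by auto

lemma I_mult: "a \<in> T X \<Longrightarrow> x \<in> I \<Longrightarrow> a * x \<in> I" "a \<in> T X \<Longrightarrow> x \<in> I \<Longrightarrow> x * a \<in> I"
  using ideal.I_l_closed[OF ideal_I, of x a] ideal.I_r_closed[OF ideal_I, of x a] by simp_all

lemma I_add: "x \<in> I \<Longrightarrow> y \<in> I \<Longrightarrow> x + y \<in> I"
  using additive_subgroup.a_closed[OF ideal.axioms(1)[OF ideal_I]] by simp

lemma I_subspace: "pm.subspace I"
proof (rule pm_subspaceI)
  show "0 \<in> I" using additive_subgroup.zero_closed[OF ideal.axioms(1)[OF ideal_I]] by simp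
  show "scal c x \<in> I" if "x \<in> I" for c x
  proof -
    have "single 0 c \<in> T X" by (simp add: T_def zero_list_def)
    then show ?thesis using I_mult(1) that unfolding scal_def by blast
  qed
qed (rule I_add)

end

text \<open>Relations together with homogeneous extensions of their structure maps.\<close>

locale qlc_words = qlc X deg R + word_ops X deg gam tht
  for X :: "'x set" and deg :: "'x \<Rightarrow> nat" and R :: "('x list \<Rightarrow>\<^sub>0 'k::field) set"
    and gam tht :: "'x list \<Rightarrow> ('x list \<Rightarrow>\<^sub>0 'k)" +
  assumes gam_dual: "c \<in> dual_coalg X deg R \<Longrightarrow> lin gam c = phi X R (susp2 deg (q c))"
    and tht_dual: "c \<in> dual_coalg X deg R \<Longrightarrow> lin tht c = single [] (theta_tilde X deg R c)"
begin

abbreviation C :: "('x list \<Rightarrow>\<^sub>0 'k) set" where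
  "C \<equiv> dual_coalg X deg R"

lemma C_T: "c \<in> C \<Longrightarrow> c \<in> T X"
  and C_q: "c \<in> C \<Longrightarrow> q (slice u v c) \<in> S2"
  by (simp_all add: dual_coalg_iff)

lemma C_q0: "c \<in> C \<Longrightarrow> q c \<in> S2"
  using C_q[of c "[]" "[]"] by simp

lemma slice_T:
  assumes "c \<in> T X"
  shows "slice u v c \<in> T X"
  unfolding T_iff lookup_slice
proof (intro allI impI)
  fix m assume "lookup c (u @ m @ v) \<noteq> 0"
  then have "set (u @ m @ v) \<subseteq> X" using assms unfolding T_iff by blast
  then show "set m \<subseteq> X" by simp
qed

lemma C_subspace: "pm.subspace C"
  by (rule pm_subspaceI)
    (simp_all add: dual_coalg_iff T_0 T_add T_scal plin_0[OF plin_slice] plin_0[OF plin_q]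
      plin_add[OF plin_slice] plin_add[OF plin_q] plin_scal[OF plin_slice] plin_scal[OF plin_q]
      pm.subspace_0[OF S2_subspace] pm.subspace_add[OF S2_subspace] pm.subspace_scale[OF S2_subspace])

lemma C_slice: "c \<in> C \<Longrightarrow> slice u v c \<in> C"
  using slice_T unfolding dual_coalg_iff by auto

lemma S2_Tpow:
  assumes "s \<in> S2"
  shows "s \<in> Tpow X 2"
proof -
  obtain r where r: "r \<in> R" "s = susp2 deg (q r)" using assms by blast
  show ?thesis unfolding Tpow_iff
  proof (intro allI impI)
    fix w assume "lookup s w \<noteq> 0"
    then have "length w = 2" "lookup r w \<noteq> 0"
      by (simp_all add: r(2) susp2_diag split: if_splits)
    then show "set w \<subseteq> X \<and> length w = 2" using R_le[OF r(1)] by (simp add: Tle_iff)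
  qed
qed

lemma S2_C:
  assumes "s \<in> S2"
  shows "s \<in> C"
  unfolding dual_coalg_iff
proof (intro conjI allI)
  show "s \<in> T X" using S2_Tpow[OF assms] unfolding Tpow_iff T_iff by blast
  fix u v
  show "q (slice u v s) \<in> S2"
  proof (cases "u = [] \<and> v = []")
    case True
    then have "q (slice u v s) = s" using S2_q[OF assms] by (simp only: slice_Nil)
    with assms show ?thesis by (rule ssubst[where P = "\<lambda>x. x \<in> S2", rotated])
  next
    case False
    have "lookup s (u @ m @ v) = 0" if "length m = 2" for m
    proof (rule ccontr)
      assume "lookup s (u @ m @ v) \<noteq> 0"
      then have "length (u @ m @ v) = 2" using S2_Tpow[OF assms] unfolding Tpow_iff by blast
      then show False using that False by simp
    qed
    then have "q (slice u v s) = 0" by (intro poly_mapping_eqI) simp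
    then show ?thesis using pm.subspace_0[OF S2_subspace] by simp
  qed
qed

text \<open>An operator depending on length and degree only restricts on each slice of length two to one
  depending on the degree only, which preserves \<open>s\<^sup>2qR\<close>.\<close>

lemma C_diag:
  assumes "c \<in> C"
  shows "diag (\<lambda>w. \<chi> (length w) (sdeg deg w)) c \<in> C"
  unfolding dual_coalg_iff
proof (intro conjI allI)
  show "diag (\<lambda>w. \<chi> (length w) (sdeg deg w)) c \<in> T X" using C_T[OF assms] by (auto simp: T_iff)
  fix u v
  define \<chi>' where "\<chi>' = (\<lambda>n. \<chi> (length u + 2 + length v) (sdeg deg u + (n + 2) + sdeg deg v))"
  have "sdeg deg m = vdeg deg m + 2" if "length m = 2" for m
    using that by (auto simp: sdeg_def vdeg_def length_Suc_conv numeral_2_eq_2)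
  then have "q (slice u v (diag (\<lambda>w. \<chi> (length w) (sdeg deg w)) c)) = diag (\<lambda>w. \<chi>' (vdeg deg w)) (q (slice u v c))"
    by (intro poly_mapping_eqI) (simp add: \<chi>'_def add.assoc)
  then show "q (slice u v (diag (\<lambda>w. \<chi> (length w) (sdeg deg w)) c)) \<in> S2"
    using diag_vdeg_S2[OF C_q[OF assms]] by simp
qed

lemma C_component:
  assumes "c \<in> C"
  shows "component (\<lambda>w. P (length w) (sdeg deg w)) c \<in> C"
proof -
  have "component (\<lambda>w. P (length w) (sdeg deg w)) c = diag (\<lambda>w. if P (length w) (sdeg deg w) then 1 else 0) c"
    by (rule poly_mapping_eqI) simp
  then show ?thesis using C_diag[OF assms, of "\<lambda>m n. if P m n then 1 else 0"] by simp
qed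

subsection \<open>The identities in weight three\<close>

text \<open>The full relation with (suspended) quadratic part \<open>s\<close>.\<close>

definition rel :: "('x list \<Rightarrow>\<^sub>0 'k) \<Rightarrow> ('x list \<Rightarrow>\<^sub>0 'k)" where
  "rel s = susp2 deg s - lin gam s + lin tht s"

lemma plin_comp_rel [plin_intros]: "plin F \<Longrightarrow> plin (\<lambda>x. rel (F x))"
  unfolding rel_def susp2_diag by (intro plin_intros)

lemma rel_R:
  assumes "s \<in> S2"
  shows "rel s \<in> R"
proof -
  have "susp2 deg s \<in> q ` R" using susp2_S2[OF assms] .
  from relation_in_R[OF this] show ?thesis
    unfolding rel_def gam_dual[OF S2_C[OF assms]] tht_dual[OF S2_C[OF assms]] theta_tilde_def S2_q[OF assms] .
qed

lemma lin_q_gam: "lin gam (q f) = lin gam f" "lin tht (q f) = lin tht f"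
proof -
  have *: "lin h (q f) = lin h f" if "\<And>w. length w \<noteq> 2 \<Longrightarrow> h w = 0" for h :: "'x list \<Rightarrow> ('x list \<Rightarrow>\<^sub>0 'k)"
  proof (rule plin_eq[of "\<lambda>f. lin h (q f)" "lin h" f])
    fix w :: "'x list"
    show "lin h (q (mon w)) = lin h (mon w)" using that[of w] by (simp add: q_mon)
  qed (intro plin_intros plin_lin)+
  show "lin gam (q f) = lin gam f" "lin tht (q f) = lin tht f"
    by (rule *, erule gam_length tht_length)+
qed

lemma lookup_lin_gam: "length u \<noteq> 1 \<Longrightarrow> lookup (lin gam f) u = 0"
proof (rule ccontr)
  assume u: "length u \<noteq> 1" "lookup (lin gam f) u \<noteq> 0"
  then have "u \<in> keys (lin gam f)" by (simp add: in_keys_iff)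
  from subsetD[OF keys_lin this] obtain w where "u \<in> keys (gam w)" by (rule UN_E)
  from gam_keys[OF this] u(1) show False by auto
qed

lemma lookup_lin_tht: "u \<noteq> [] \<Longrightarrow> lookup (lin tht f) u = 0"
proof (rule ccontr)
  assume u: "u \<noteq> []" "lookup (lin tht f) u \<noteq> 0"
  then have "u \<in> keys (lin tht f)" by (simp add: in_keys_iff)
  from subsetD[OF keys_lin this] obtain w where "u \<in> keys (tht w)" by (rule UN_E)
  from tht_keys[OF this] u(1) show False by auto
qed

text \<open>The curvature in weight three only, so that it depends linearly on an inhomogeneous
  element in the same way as \<open>q (phl c)\<close> does.\<close>

definition cur3 :: "'x list \<Rightarrow> ('x list \<Rightarrow>\<^sub>0 'k)" where
  "cur3 w = (if length w = 3 then cur w else 0)"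

lemma cur3_eq: "cur3 [x, y, z] = tht [x, y] * mon [z] - mon [x] * tht [y, z]"
  by (simp add: cur3_def cur_def numeral_2_eq_2)

lemma lookup_tht_mult:
  "length u \<noteq> 1 \<Longrightarrow> lookup (tht m * mon [z]) u = 0"
  "length u \<noteq> 1 \<Longrightarrow> lookup (mon [z] * tht m) u = 0"
  by (subst tht_scalar, force simp: mult_single plus_list_def lookup_single when_def)+

lemma lookup_lin_cur3:
  assumes "length u \<noteq> 1"
  shows "lookup (lin cur3 f) u = 0"
proof -
  have "lookup (cur3 w) u = 0" for w
  proof (cases "length w = 3")
    case True
    then obtain x y z where "w = [x, y, z]" by (auto simp: length_Suc_conv numeral_3_eq_3)
    then show ?thesis using assms by (simp add: cur3_eq lookup_minus lookup_tht_mult)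
  qed (simp add: cur3_def)
  then show ?thesis unfolding lin_def by (simp add: lookup_sum)
qed

lemma q_gam_mult: "q (gam m * mon [z]) = gam m * mon [z]" "q (mon [z] * gam m) = mon [z] * gam m"
proof -
  have 2: "q (mon [a, b] :: _ \<Rightarrow>\<^sub>0 'k) = mon [a, b]" for a b :: 'x
    by (intro poly_mapping_eqI) (auto simp: lookup_single when_def)
  show "q (gam m * mon [z]) = gam m * mon [z]"
  proof (rule plin_eq_on[of "\<lambda>g. q (g * mon [z])" "\<lambda>g. g * mon [z]" "gam m"])
    fix u assume "u \<in> keys (gam m)"
    then obtain a where "u = [a]" using gam_keys by blast
    then show "q (mon u * mon [z] :: _ \<Rightarrow>\<^sub>0 'k) = mon u * mon [z]" by (simp add: 2)
  qed (intro plin_intros)+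
  show "q (mon [z] * gam m) = mon [z] * gam m"
  proof (rule plin_eq_on[of "\<lambda>g. q (mon [z] * g)" "\<lambda>g. mon [z] * g" "gam m"])
    fix u assume "u \<in> keys (gam m)"
    then obtain a where "u = [a]" using gam_keys by blast
    then show "q (mon [z] * mon u :: _ \<Rightarrow>\<^sub>0 'k) = mon [z] * mon u" by (simp add: 2)
  qed (intro plin_intros)+
qed

text \<open>Only the component of weight three of \<open>c\<close> contributes.  Splitting off the first letter,
  respectively the last, and completing the remaining quadratic tensors to full relations gives two elements whose cubic parts
  agree, so that their difference has only quadratic and linear terms: these come from \<open>phl c\<close> and
  from the curvature.  On the word \<open>xyz\<close> the suspension sign is \<open>(-1)\<^bsup>|y|\<^esup>\<close> when the last two letters are
  desuspended, but \<open>(-1)\<^bsup>|x|\<^esup>\<close> when the first two are; the additional sign \<open>(-1)\<^bsup>|x| + |y|\<^esup>\<close> at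
  the right end corrects this.  The index sets \<open>A\<close> and \<open>B\<close> are arbitrary finite sets containing the
  letters that occur, so that both sides are linear in \<open>c\<close>.\<close>

lemma weight3_relation:
  assumes fin: "finite A" "finite B"
    and A: "\<And>x w. x # w \<in> keys c \<Longrightarrow> x \<in> A"
    and B: "\<And>x w. w @ [x] \<in> keys c \<Longrightarrow> x \<in> B"
  shows "(\<Sum>x\<in>A. mon [x] * rel (q (slice [x] [] c)))
    - (\<Sum>z\<in>B. rel (diag (\<lambda>w. (- 1) ^ vdeg deg w) (q (slice [] [z] c))) * mon [z])
    = susp2 deg (q (phl c)) - lin cur3 c"
proof (rule plin_eq_on[of "\<lambda>c. (\<Sum>x\<in>A. mon [x] * rel (q (slice [x] [] c)))
    - (\<Sum>z\<in>B. rel (diag (\<lambda>w. (- 1) ^ vdeg deg w) (q (slice [] [z] c))) * mon [z])"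
    "\<lambda>c. susp2 deg (q (phl c)) - lin cur3 c" c])
  show "plin (\<lambda>c. susp2 deg (q (phl c)) - lin cur3 c)" unfolding susp2_diag by (intro plin_intros)
  let ?\<epsilon> = "diag (\<lambda>w. (- 1) ^ vdeg deg w)"
  have rel0: "rel 0 = 0" by (simp add: rel_def susp2_def)
  have eps0: "?\<epsilon> (0 :: _ \<Rightarrow>\<^sub>0 'k) = 0" by (simp add: diag_def)
  fix w assume w: "w \<in> keys c"
  show "(\<Sum>x\<in>A. mon [x] * rel (q (slice [x] [] (mon w))))
      - (\<Sum>z\<in>B. rel (?\<epsilon> (q (slice [] [z] (mon w)))) * mon [z])
      = susp2 deg (q (phl (mon w))) - lin cur3 (mon w)"
  proof (cases "length w = 3")
    case False
    have "q (slice [x] [] (mon w)) = (0 :: _ \<Rightarrow>\<^sub>0 'k)" "q (slice [] [x] (mon w)) = (0 :: _ \<Rightarrow>\<^sub>0 'k)" for x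
      using False by (auto intro!: poly_mapping_eqI simp: lookup_single when_def)
    moreover have "q (phl (mon w)) = 0"
    proof (rule poly_mapping_eqI)
      fix u
      have "length u \<noteq> 2" if "u \<in> keys (phl (mon w))"
        using keys_phl_mon[OF that] False by linarith
      then show "lookup (q (phl (mon w))) u = lookup 0 u"
        by (auto simp: in_keys_iff)
    qed
    ultimately show ?thesis using False by (simp add: rel0 eps0 cur3_def susp2_def)
  next
    case True
    then obtain x y z where xyz: "w = [x, y, z]" by (auto simp: length_Suc_conv numeral_3_eq_3)
    have xA: "x \<in> A" and zB: "z \<in> B" using A[of x "[y, z]"] B[of "[x, y]" z] w xyz by auto
    have 1: "q (slice [a] [] (mon w)) = (if a = x then mon [y, z] else 0 :: _ \<Rightarrow>\<^sub>0 'k)" for a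
      unfolding xyz by (auto intro!: poly_mapping_eqI simp: slice_mon_Cons lookup_single when_def)
    have 2: "q (slice [] [a] (mon w)) = (if a = z then mon [x, y] else 0 :: _ \<Rightarrow>\<^sub>0 'k)" for a
    proof (rule poly_mapping_eqI)
      fix m
      have "[x, y, z] = m @ [a] \<longleftrightarrow> m = [x, y] \<and> a = z"
        using append_eq_append_conv[of "[a]" "[z]" m "[x, y]"] by auto
      then show "lookup (q (slice [] [a] (mon w))) m =
          lookup (if a = z then mon [x, y] else 0 :: _ \<Rightarrow>\<^sub>0 'k) m"
        unfolding xyz by (auto simp: lookup_single when_def)
    qed
    have sumA: "(\<Sum>a\<in>A. mon [a] * rel (q (slice [a] [] (mon w)))) = mon [x] * rel (mon [y, z])"
    proof -
      have "(\<Sum>a\<in>A. mon [a] * rel (q (slice [a] [] (mon w)))) =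
          (\<Sum>a\<in>A. if a = x then mon [x] * rel (mon [y, z]) else 0)"
        by (intro sum.cong refl) (simp add: 1 rel0)
      also have "\<dots> = mon [x] * rel (mon [y, z])" using fin xA by (simp add: sum.delta)
      finally show ?thesis .
    qed
    have sumB: "(\<Sum>a\<in>B. rel (?\<epsilon> (q (slice [] [a] (mon w)))) * mon [a]) = rel (?\<epsilon> (mon [x, y])) * mon [z]"
    proof -
      have "(\<Sum>a\<in>B. rel (?\<epsilon> (q (slice [] [a] (mon w)))) * mon [a]) =
          (\<Sum>a\<in>B. if a = z then rel (?\<epsilon> (mon [x, y])) * mon [z] else 0)"
        by (intro sum.cong refl) (simp add: 2 rel0 eps0)
      also have "\<dots> = rel (?\<epsilon> (mon [x, y])) * mon [z]" using fin zB by (simp add: sum.delta)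
      finally show ?thesis .
    qed
    have r1: "rel (mon [y, z]) = single [y, z] ((- 1) ^ deg y) - gam [y, z] + tht [y, z]"
      by (simp add: rel_def susp2_diag diag_def)
    have t: "scal ((- 1) ^ (deg x + deg y)) (tht [x, y]) = tht [x, y]"
    proof (cases "keys (tht [x, y]) = {}")
      case True
      then show ?thesis by simp
    next
      case False
      then obtain u where "u \<in> keys (tht [x, y])" by blast
      then have "deg x + deg y = 0" using tht_keys[of u "[x, y]"] by (simp add: vdeg_def)
      then show ?thesis by simp
    qed
    have r2: "rel (?\<epsilon> (mon [x, y])) = single [x, y] ((- 1) ^ deg y)
        - scal ((- 1) ^ (deg x + deg y)) (gam [x, y]) + tht [x, y]"
    proof -
      have "?\<epsilon> (mon [x, y]) = scal ((- 1) ^ (deg x + deg y)) (mon [x, y] :: _ \<Rightarrow>\<^sub>0 'k)"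
        by (simp add: diag_def vdeg_def)
      moreover have "(- 1) ^ (deg x + deg y) * (- 1) ^ deg x = ((- 1) ^ deg y :: 'k)"
        by (simp add: power_add mult.assoc[symmetric])
      ultimately show ?thesis
        by (simp add: rel_def lin_scal t susp2_diag plin_scal[OF plin_diag] diag_def del: scal_single)
          simp
    qed
    have len2: "q (gam [x, y] * mon [z]) = gam [x, y] * mon [z]" "q (mon [x] * gam [y, z]) = mon [x] * gam [y, z]"
      by (rule q_gam_mult)+
    have s1: "susp2 deg (gam [x, y] * mon [z]) = scal ((- 1) ^ (deg x + deg y)) (gam [x, y] * mon [z])"
    proof -
      have "diag (\<lambda>w. (- 1) ^ deg (hd w)) (gam [x, y] * mon [z]) = scal ((- 1) ^ (deg x + deg y)) (gam [x, y] * mon [z])"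
      proof (rule plin_eq_on[of "\<lambda>g. diag (\<lambda>w. (- 1) ^ deg (hd w)) (g * mon [z])"
          "\<lambda>g. scal ((- 1) ^ (deg x + deg y)) (g * mon [z])" "gam [x, y]"])
        fix u assume "u \<in> keys (gam [x, y])"
        then obtain a where "u = [a]" "deg a = deg x + deg y" using gam_keys by (fastforce simp: vdeg_def)
        then show "diag (\<lambda>w. (- 1) ^ deg (hd w)) (mon u * mon [z]) =
            scal ((- 1) ^ (deg x + deg y)) (mon u * mon [z])"
          by (simp add: diag_def)
      qed (intro plin_intros)+
      then show ?thesis by (simp add: susp2_diag)
    qed
    have s2: "susp2 deg (mon [x] * t) = scal ((- 1) ^ deg x) (mon [x] * t)" for t
    proof -
      have "diag (\<lambda>w. (- 1) ^ deg (hd w)) (mon [x] * t) = scal ((- 1) ^ deg x) (mon [x] * t)"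
      proof (rule plin_eq[of "\<lambda>t. diag (\<lambda>w. (- 1) ^ deg (hd w)) (mon [x] * t)"
          "\<lambda>t. scal ((- 1) ^ deg x) (mon [x] * t)" t])
        fix u show "diag (\<lambda>w. (- 1) ^ deg (hd w)) (mon [x] * mon u) = scal ((- 1) ^ deg x) (mon [x] * mon u)"
          by (simp add: diag_def)
      qed (intro plin_intros)+
      then show ?thesis by (simp add: susp2_diag)
    qed
    have sx: "sg [x] = - ((- 1) ^ deg x)" by (simp add: sdeg_def)
    have "phl (mon w) = gam [x, y] * mon [z] + scal (sg [x]) (mon [x] * gam [y, z])"
      unfolding xyz using phl_Cons2[of x y "[z]"] phl_Cons2[of y z "[]"] by simp
    then have "susp2 deg (q (phl (mon w))) =
        susp2 deg (gam [x, y] * mon [z]) + scal (sg [x]) (susp2 deg (mon [x] * gam [y, z]))"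
      by (simp only: plin_add[OF plin_q] plin_scal[OF plin_q] len2 plin_add[OF plin_diag]
          plin_scal[OF plin_diag] susp2_diag)
    then have "susp2 deg (q (phl (mon w))) =
        scal ((- 1) ^ (deg x + deg y)) (gam [x, y] * mon [z]) - mon [x] * gam [y, z]"
      unfolding s1 s2 sx by (simp add: power_mult_distrib[symmetric])
    then show ?thesis
      unfolding sumA sumB r1 r2
      by (simp add: xyz cur3_eq left_diff_distrib right_diff_distrib distrib_left distrib_right
          mult_single plus_list_def scal_mult_left)
  qed
qed (intro plin_intros)+

text \<open>For \<open>c\<close> in the dual coalgebra the left-hand side of \<open>weight3_relation\<close> lies in the ideal
  \<open>(R)\<close>, hence, having length at most two, in \<open>R\<close>.  So its quadratic part lies in \<open>qR\<close>, and by
  uniqueness it is the full relation with this quadratic part; comparing the linear and the constant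
  terms gives the other two identities.\<close>

lemma weight3_identities:
  assumes "c \<in> C"
  shows q_phl: "q (phl c) \<in> S2" and gam_phl: "lin gam (phl c) = lin cur3 c" and tht_phl: "lin tht (phl c) = 0"
proof -
  define A where "A = hd ` keys c \<inter> X"
  define B where "B = last ` keys c \<inter> X"
  have cX: "set w \<subseteq> X" if "w \<in> keys c" for w
    using C_T[OF assms] that by (auto simp: T_iff in_keys_iff)
  have A: "x # w \<in> keys c \<Longrightarrow> x \<in> A" for x w
    unfolding A_def using cX[of "x # w"] by (auto intro: rev_image_eqI)
  have B: "w @ [x] \<in> keys c \<Longrightarrow> x \<in> B" for x w
    unfolding B_def using cX[of "w @ [x]"] by (auto intro: rev_image_eqI)
  have fin: "finite A" "finite B" by (simp_all add: A_def B_def)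
  let ?E = "susp2 deg (q (phl c)) - lin cur3 c"
  have "(\<Sum>x\<in>A. mon [x] * rel (q (slice [x] [] c)))
    - (\<Sum>z\<in>B. rel (diag (\<lambda>w. (- 1) ^ vdeg deg w) (q (slice [] [z] c))) * mon [z]) \<in> I"
  proof (intro pm.subspace_diff[OF I_subspace] pm.subspace_sum[OF I_subspace])
    fix x assume "x \<in> A"
    then show "mon [x] * rel (q (slice [x] [] c)) \<in> I"
      using I_R rel_R[OF C_q[OF assms]] by (intro I_mult) (auto simp: A_def mon_in_T)
  next
    fix z assume "z \<in> B"
    then show "rel (diag (\<lambda>w. (- 1) ^ vdeg deg w) (q (slice [] [z] c))) * mon [z] \<in> I"
      using I_R rel_R[OF diag_vdeg_S2[OF C_q[OF assms]]] by (intro I_mult) (auto simp: B_def mon_in_T)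
  qed
  moreover have "(\<Sum>x\<in>A. mon [x] * rel (q (slice [x] [] c)))
    - (\<Sum>z\<in>B. rel (diag (\<lambda>w. (- 1) ^ vdeg deg w) (q (slice [] [z] c))) * mon [z]) = ?E"
    using fin A B by (rule weight3_relation)
  ultimately have "?E \<in> I" by simp
  moreover have "?E \<in> Tle X 2" unfolding Tle_iff
  proof (intro allI impI conjI)
    fix w assume w: "lookup ?E w \<noteq> 0"
    then show "set w \<subseteq> X" using subsetD[OF I_T \<open>?E \<in> I\<close>] unfolding T_iff by blast
    show "length w \<le> 2"
    proof (rule ccontr)
      assume "\<not> length w \<le> 2"
      then show False using w by (simp add: lookup_minus susp2_diag lookup_lin_cur3)
    qed
  qed
  ultimately have E: "?E \<in> R" using R_ideal by blast
  have qE: "q ?E = susp2 deg (q (phl c))"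
    by (intro poly_mapping_eqI) (simp add: lookup_minus susp2_diag lookup_lin_cur3)
  then have "susp2 deg (q (phl c)) \<in> q ` R" using E by (metis imageI)
  then show S2: "q (phl c) \<in> S2" by (simp add: S2_iff)
  have "q (rel (q (phl c))) = susp2 deg (q (phl c))"
  proof (rule poly_mapping_eqI)
    fix w :: "'x list"
    have "length w = 2 \<Longrightarrow> w \<noteq> []" by auto
    then show "lookup (q (rel (q (phl c)))) w = lookup (susp2 deg (q (phl c))) w"
      by (simp add: rel_def lookup_minus lookup_add susp2_diag lookup_lin_gam lookup_lin_tht)
  qed
  then have eq: "rel (q (phl c)) = ?E" using q_inj[OF rel_R[OF S2] E] qE by simp
  then have eq': "lin tht (phl c) - lin gam (phl c) = - lin cur3 c"
    by (simp add: rel_def lin_q_gam algebra_simps)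
  show "lin tht (phl c) = 0"
  proof (rule poly_mapping_eqI)
    fix u show "lookup (lin tht (phl c)) u = lookup 0 u"
      using arg_cong[OF eq', of "\<lambda>f. lookup f u"]
      by (cases "u = []") (simp_all add: lookup_minus lookup_lin_gam lookup_lin_tht lookup_lin_cur3)
  qed
  with eq' show "lin gam (phl c) = lin cur3 c" by simp
qed

lemma defect_dual:
  assumes "c \<in> C"
  shows "lin defect c = 0"
proof -
  have "lin defect c = lin gam (phl c) - lin cur3 c"
  proof (rule plin_eq[of "lin defect" "\<lambda>c. lin gam (phl c) - lin cur3 c" c])
    fix w
    have "lin gam (phl (mon w)) = (if length w = 3 then phl (phl (mon w)) else 0)"
    proof (cases "length w = 3")
      case True
      have "phl (phl (mon w)) = lin gam (phl (mon w))"
      proof (rule plin_eq_on[OF plin_phl plin_lin])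
        fix u assume "u \<in> keys (phl (mon w))"
        then have "length u = 2" using keys_phl_mon[of u w] True by simp
        then obtain x y where "u = [x, y]" by (auto simp: length_Suc_conv numeral_2_eq_2)
        then show "phl (mon u) = lin gam (mon u)" using phl_Cons2[of x y "[]"] by simp
      qed
      then show ?thesis using True by simp
    next
      case False
      have "lin gam (phl (mon w)) = 0"
      proof (rule lin_eq_0, rule gam_length)
        fix u assume "u \<in> keys (phl (mon w))"
        then show "length u \<noteq> 2" using keys_phl_mon[of u w] False by auto
      qed
      then show ?thesis using False by simp
    qed
    then show "lin defect (mon w) = lin gam (phl (mon w)) - lin cur3 (mon w)"
      by (simp add: defect_def cur3_def)
  qed (intro plin_intros plin_lin)+
  then show ?thesis using gam_phl[OF assms] by simp
qed

lemma window_defect_dual: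
  assumes "c \<in> C"
  shows "window (\<lambda>_. 1) defect c = 0"
  unfolding window_def by (intro sum.neutral) (auto simp: defect_dual[OF C_slice[OF assms]])

lemma gen0_phl_dual:
  assumes "c \<in> C"
  shows "lin gen0 (phl c) = 0"
  by (simp add: lin_gen0 tht_phl[OF assms])

subsection \<open>The coderivation preserves the subcoalgebra\<close>

text \<open>Consider the sums of an element of \<open>phl ` C\<close> and an element of \<open>C\<close>.  They are closed under
  removing outer letters, because the edge terms are combinations of slices, and by
  \<open>weight3_identities\<close> their quadratic parts lie in \<open>s\<^sup>2qR\<close>.  Hence all slices of such a sum have
  quadratic part in \<open>s\<^sup>2qR\<close>.\<close>

lemma C_phl:
  assumes "f \<in> C"
  shows "phl f \<in> C"
proof -
  define N where "N = {g. \<exists>f'\<in>C. \<exists>c\<in>C. g = phl f' + c}"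
  have diag_sg: "diag sg c \<in> C" if "c \<in> C" for c
    using C_diag[OF that, of "\<lambda>_ n. (- 1) ^ n"] .
  have left: "slice [x] [] g \<in> N" if g: "g \<in> N" for x g
  proof -
    obtain f' c where f: "f' \<in> C" "c \<in> C" "g = phl f' + c" using g unfolding N_def by blast
    let ?B = "\<Sum>m\<in>take 2 ` keys f'. scal (lookup (gam m) [x]) (slice m [] f')"
    have "slice [x] [] g = phl (scal (sg [x]) (slice [x] [] f')) + (?B + slice [x] [] c)"
      unfolding f(3) plin_add[OF plin_slice] slice_phl_left plin_scal[OF plin_phl]
      by (subst left_contraction_slices[of "\<lambda>m. lookup (gam m) [x]"])
        (simp_all add: gam_length)
    moreover have "?B + slice [x] [] c \<in> C"
      using f by (intro pm.subspace_add[OF C_subspace] pm.subspace_sum[OF C_subspace]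
          pm.subspace_scale[OF C_subspace] C_slice) auto
    moreover have "scal (sg [x]) (slice [x] [] f') \<in> C"
      using f by (intro pm.subspace_scale[OF C_subspace] C_slice)
    ultimately show ?thesis unfolding N_def by blast
  qed
  have right: "slice [] [x] g \<in> N" if g: "g \<in> N" for x g
  proof -
    obtain f' c where f: "f' \<in> C" "c \<in> C" "g = phl f' + c" using g unfolding N_def by blast
    let ?B = "\<Sum>m\<in>(\<lambda>w. drop (length w - 2) w) ` keys f'.
        scal (lookup (gam m) [x]) (diag sg (slice [] m f'))"
    have "slice [] [x] g = phl (slice [] [x] f') + (?B + slice [] [x] c)"
      unfolding f(3) plin_add[OF plin_slice] slice_phl_right
      by (subst right_contraction_slices[of "\<lambda>m. lookup (gam m) [x]"])
        (simp_all add: gam_length)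
    moreover have "?B + slice [] [x] c \<in> C"
      using f by (intro pm.subspace_add[OF C_subspace] pm.subspace_sum[OF C_subspace]
          pm.subspace_scale[OF C_subspace] diag_sg C_slice) auto
    moreover have "slice [] [x] f' \<in> C" using f by (intro C_slice)
    ultimately show ?thesis unfolding N_def by blast
  qed
  have N_left: "slice u [] g \<in> N" if "g \<in> N" for u g using that
  proof (induction u arbitrary: g)
    case (Cons x u)
    then show ?case using left[of g x] slice_slice[of u "[]" "[x]" "[]" g] by (metis append_Cons append_Nil)
  qed simp
  have N_right: "slice [] v g \<in> N" if "g \<in> N" for v g using that
  proof (induction v arbitrary: g rule: rev_induct)
    case (snoc x v)
    then show ?case using right[of g x] slice_slice[of "[]" v "[]" "[x]" g] by (metis append_Nil)
  qed simp
  have "phl f \<in> N" unfolding N_def using assms pm.subspace_0[OF C_subspace] by force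
  have "slice u v (phl f) \<in> N" for u v
    using N_right[OF N_left[OF \<open>phl f \<in> N\<close>, of u], of v] slice_slice[of "[]" v u "[]" "phl f"] by simp
  then have "q (slice u v (phl f)) \<in> S2" for u v
    unfolding N_def using q_phl C_q0 plin_add[OF plin_q] pm.subspace_add[OF S2_subspace]
    by (smt (verit, del_insts) mem_Collect_eq)
  then show ?thesis using phl_T[OF C_T[OF assms]] by (simp add: dual_coalg_iff)
qed

end

section \<open>The cobar construction\<close>

lemma plin_keys:
  assumes "plin F" "u \<in> keys (F f)"
  obtains w where "w \<in> keys f" "u \<in> keys (F (mon w))"
proof -
  have "F f = lin (\<lambda>w. F (mon w)) f" by (rule plin_eq[OF assms(1) plin_lin]) simp
  with assms(2) have "u \<in> keys (lin (\<lambda>w. F (mon w)) f)" by simp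
  from subsetD[OF keys_lin this] show ?thesis by (rule UN_E) (rule that)
qed

lemma slice_desusp_mult: "slice (w # P) Q (desusp c * y) = scal (lookup c w) (slice P Q y)"
proof -
  have "desusp c \<in> Tpow UNIV 1"
    by (auto simp: Tpow_iff lookup_desusp split: list.splits)
  then have "slice [w] Q (desusp c * y) = scal (lookup (desusp c) [w]) (slice [] Q y)"
    by (rule slice_Tpow_mult) simp
  moreover have "slice (w # P) Q (desusp c * y) = slice P [] (slice [w] Q (desusp c * y))"
    by simp
  ultimately show ?thesis
    by (simp add: lookup_desusp plin_scal[OF plin_slice] del: slice_slice) simp
qed

lemma lookup_desusp_mult:
  "lookup (desusp c * y) (w # W) = lookup c w * lookup y W"
  using arg_cong[OF slice_desusp_mult[of w "[]" "[]" c y], of "\<lambda>f. lookup f W"] by simp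

lemma component_lengths_desusp_mult:
  assumes "finite N" "length ` keys c \<subseteq> N"
  shows "component (\<lambda>W. P (map length W)) (desusp c * p) =
    (\<Sum>n\<in>N. desusp (component (\<lambda>w. length w = n) c) * component (\<lambda>W. P (n # map length W)) p)"
proof (rule poly_mapping_eqI)
  fix W
  show "lookup (component (\<lambda>W. P (map length W)) (desusp c * p)) W = lookup
    (\<Sum>n\<in>N. desusp (component (\<lambda>w. length w = n) c) * component (\<lambda>W. P (n # map length W)) p) W"
  proof (cases W)
    case Nil
    have "lookup (desusp c * p) [] = 0" for c and p :: "'a list list \<Rightarrow>\<^sub>0 'b"
    proof (rule ccontr)
      assume "lookup (desusp c * p) [] \<noteq> 0"
      then have "[] \<in> keys (desusp c * p)" by (simp add: in_keys_iff)
      from subsetD[OF keys_mult this] have "[] \<in> keys (desusp c)"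
        by (auto simp: plus_list_def)
      then show False by (simp add: in_keys_iff lookup_desusp)
    qed
    then show ?thesis unfolding Nil by (simp add: lookup_sum)
  next
    case (Cons w W')
    have "lookup (\<Sum>n\<in>N. desusp (component (\<lambda>w. length w = n) c) *
        component (\<lambda>W. P (n # map length W)) p) W =
      (\<Sum>n\<in>N. if n = length w then lookup c w *
        (if P (map length W) then lookup p W' else 0) else 0)"
      unfolding Cons lookup_sum lookup_desusp_mult by (intro sum.cong refl) simp
    also have "\<dots> = (if length w \<in> N then lookup c w *
        (if P (map length W) then lookup p W' else 0) else 0)"
      using assms(1) by (simp only: sum.delta)
    also have "\<dots> = lookup (component (\<lambda>W. P (map length W)) (desusp c * p)) W"
    proof (cases "w \<in> keys c")
      case True
      then have "length w \<in> N" using assms(2) by blast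
      then show ?thesis unfolding Cons by (simp add: lookup_desusp_mult)
    next
      case False
      then show ?thesis unfolding Cons by (simp add: lookup_desusp_mult in_keys_iff)
    qed
    finally show ?thesis ..
  qed
qed

context word_ops
begin

lemma keys_der:
  "W' \<in> keys (der g (mon W)) \<Longrightarrow>
    \<exists>A w B U. W = A @ [w] @ B \<and> U \<in> keys (g w) \<and> W' = A @ U @ B"
proof (induction W arbitrary: W')
  case Nil
  then show ?case using der_Nil[of g] by simp
next
  case (Cons w W)
  from subsetD[OF keys_add Cons.prems[unfolded der_Cons]] show ?case
  proof
    assume "W' \<in> keys (g w * mon W)"
    from subsetD[OF keys_mult this] obtain U where "U \<in> keys (g w)" "W' = U @ W"
      by (auto simp: plus_list_def)
    then show ?thesis by (intro exI[of _ "[]"] exI[of _ w] exI[of _ W] exI[of _ U]) simp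
  next
    assume "W' \<in> keys (scal (csg [w]) (mon [w] * der g (mon W)))"
    then have "W' \<in> keys (mon [w] * der g (mon W))" by (simp add: in_keys_iff)
    from subsetD[OF keys_mult this] obtain V where V: "V \<in> keys (der g (mon W))" "W' = w # V"
      by (auto simp: plus_list_def)
    from Cons.IH[OF V(1)] obtain A w' B U where "W = A @ [w'] @ B" "U \<in> keys (g w')" "V = A @ U @ B"
      by blast
    then show ?thesis using V(2)
      by (intro exI[of _ "w # A"] exI[of _ w'] exI[of _ B] exI[of _ U]) simp
  qed
qed

text \<open>\<open>wt\<close> is the weight, and \<open>syz\<close> the syzygy degree.  The truncated subtraction in the latter is
  harmless, as only nonempty letters occur in the cobar construction.\<close>

definition wt :: "'x list list \<Rightarrow> nat" where
  "wt W = sum_list (map length W)"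

definition syz :: "'x list list \<Rightarrow> nat" where
  "syz W = sum_list (map (\<lambda>n. n - 1) (map length W))"

lemma wt_simps [simp]: "wt [] = 0" "wt (w # W) = length w + wt W" "wt (U @ W) = wt U + wt W"
  and syz_simps [simp]: "syz [] = 0" "syz (w # W) = length w - 1 + syz W" "syz (U @ W) = syz U + syz W"
  by (simp_all add: wt_def syz_def)

text \<open>The part of the differential that lowers the weight, \<open>d\<^sub>0 + d\<^sub>1\<close>.\<close>

definition gen01 :: "'x list \<Rightarrow> ('x list list \<Rightarrow>\<^sub>0 'k)" where
  "gen01 w = gen0 w - desusp (phl (mon w))"

lemma gen_gen01_gen2: "der gen f = der gen01 f + der gen2 f"
proof -
  have "gen = (\<lambda>w. gen01 w + gen2 w)" by (simp add: gen_def gen01_def fun_eq_iff)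
  then show ?thesis by (simp add: der_add_gen)
qed

lemma keys_gen01: "U \<in> keys (gen01 w) \<Longrightarrow> wt U < length w \<and> Suc (syz U) = length w - 1
    \<and> csg U = - csg [w]"
proof -
  assume "U \<in> keys (gen01 w)"
  from subsetD[OF keys_diff this[unfolded gen01_def]] show ?thesis
  proof
    assume U: "U \<in> keys (gen0 w)"
    have "gen0 w \<noteq> 0" using U by auto
    then have "length w = 2" using gen0_length[of w] by blast
    moreover have "U = []" using U by (simp add: gen0_def split: if_splits)
    ultimately have Uw: "U = []" "length w = 2" by simp_all
    have "sg w * lookup (gen0 w) U = lookup (gen0 w) U"
      using arg_cong[OF sg_gen0[of w], of "\<lambda>f. lookup f U"] by simp
    moreover have "lookup (gen0 w) U \<noteq> 0" using U by (simp add: in_keys_iff)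
    ultimately have "sg w = 1" by simp
    then have "csg [w] = - 1" using Uw by (subst csg_single) auto
    then show ?thesis using Uw by simp
  next
    assume "U \<in> keys (desusp (phl (mon w)))"
    then obtain u where u: "U = [u]" "u \<in> keys (phl (mon w))"
      by (auto simp: in_keys_iff lookup_desusp split: list.splits)
    have u': "u \<noteq> []" using u(2) by (auto simp: in_keys_iff)
    have uw: "Suc (length u) = length w" "Suc (sdeg deg u) = sdeg deg w" using keys_phl_mon[OF u(2)] by auto
    then have "w \<noteq> []" by auto
    have "sg w = - sg u" using uw(2)[symmetric] by simp
    then have "csg [u] = - csg [w]" using csg_single[OF u'] csg_single[OF \<open>w \<noteq> []\<close>] by simp
    then show ?thesis using u uw u' by (cases u) auto
  qed
qed

lemma keys_gen2_degrees: "U \<in> keys (gen2 w) \<Longrightarrow> wt U = length w \<and> Suc (syz U) = length w - 1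
    \<and> csg U = - csg [w]"
proof -
  assume "U \<in> keys (gen2 w)"
  from keys_gen2[OF this] obtain u v where U: "U = [u, v]" "u \<noteq> []" "v \<noteq> []" "u @ v = w" by blast
  then have "w \<noteq> []" by auto
  have "csg U = csg [u] * csg [v]" unfolding U(1) by (rule csg_Cons)
  also have "\<dots> = - csg [w]"
    unfolding csg_single[OF U(2)] csg_single[OF U(3)] csg_single[OF \<open>w \<noteq> []\<close>]
    by (simp add: U(4)[symmetric] power_add)
  finally show ?thesis using U by (cases u; cases v) auto
qed

lemma keys_gen:
  assumes "U \<in> keys (gen w)"
  shows "Suc (syz U) = length w - 1" "csg U = - csg [w]"
proof -
  have "gen w = gen01 w + gen2 w" by (simp add: gen_def gen01_def)
  with assms have "U \<in> keys (gen01 w + gen2 w)" by simp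
  from subsetD[OF keys_add this]
  have "U \<in> keys (gen01 w) \<or> U \<in> keys (gen2 w)" by (rule Un_iff[THEN iffD1])
  then show "Suc (syz U) = length w - 1" "csg U = - csg [w]"
    using keys_gen01[of U w] keys_gen2_degrees[of U w] by blast+
qed

lemma keys_der_gen01: "W' \<in> keys (der gen01 (mon W)) \<Longrightarrow> wt W' < wt W"
  by (drule keys_der) (auto dest!: keys_gen01)

lemma keys_der_gen2: "W' \<in> keys (der gen2 (mon W)) \<Longrightarrow> wt W' = wt W \<and> Suc (syz W') = syz W"
  by (drule keys_der) (auto dest!: keys_gen2_degrees)

lemma keys_der_gen: "W' \<in> keys (der gen (mon W)) \<Longrightarrow> Suc (syz W') = syz W"
  by (drule keys_der) (auto dest!: keys_gen(1))

text \<open>The differential is odd, so it anticommutes with the grading involution.\<close>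

lemma diag_csg_gen: "diag csg (lin gen c) = - lin gen (diag (\<lambda>w. csg [w]) c)"
proof (rule plin_eq[of "\<lambda>c. diag csg (lin gen c)"
    "\<lambda>c. - lin gen (diag (\<lambda>w. csg [w]) c)" c])
  fix w
  have "diag csg (gen w) = - scal (csg [w]) (gen w)"
  proof (rule poly_mapping_eqI)
    fix U
    show "lookup (diag csg (gen w)) U = lookup (- scal (csg [w]) (gen w)) U"
      using keys_gen(2)[of U w] by (cases "U \<in> keys (gen w)") (auto simp: in_keys_iff)
  qed
  then show "diag csg (lin gen (mon w)) = - lin gen (diag (\<lambda>w. csg [w]) (mon w))"
    by (simp add: diag_def)
qed (intro plin_intros)+

lemma diag_csg_lift_desusp: "diag csg (desusp c) = desusp (diag (\<lambda>w. csg [w]) c)"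
  by (rule poly_mapping_eqI) (auto simp: lookup_desusp split: list.splits)

lemma diag_csg_diag_csg: "diag csg (diag csg x) = x"
  by (rule poly_mapping_eqI) (simp add: mult.assoc[symmetric] power_add[symmetric])

end

text \<open>\<open>K\<close> below is the underlying space of the cobar construction, and \<open>CB\<close> the positive weight
  part of the dual coalgebra.\<close>

locale koszul_words = qlc_words X deg R gam tht
  for X :: "'x set" and deg :: "'x \<Rightarrow> nat" and R :: "('x list \<Rightarrow>\<^sub>0 'k::field) set" and gam tht +
  assumes koszul: "qA_Koszul X deg R"
begin

abbreviation K :: "('x list list \<Rightarrow>\<^sub>0 'k) set" where
  "K \<equiv> cobar_carrier X deg R"

abbreviation CB :: "('x list \<Rightarrow>\<^sub>0 'k) set" where
  "CB \<equiv> cbar X deg R"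

lemma CB_iff: "c \<in> CB \<longleftrightarrow> c \<in> C \<and> lookup c [] = 0"
  by (auto simp: cbar_def)

lemma CB_C: "c \<in> CB \<Longrightarrow> c \<in> C"
  by (simp add: CB_iff)

lemma CB_subspace: "pm.subspace CB"
  by (rule pm_subspaceI) (simp_all add: CB_iff pm.subspace_0[OF C_subspace]
      pm.subspace_add[OF C_subspace] pm.subspace_scale[OF C_subspace] lookup_add)

lemma CB_component:
  assumes "c \<in> CB"
  shows "component (\<lambda>w. length w = n) c \<in> CB"
  using assms C_component[of c "\<lambda>l _. l = n"] by (simp add: CB_iff)

lemma CB_diag: "c \<in> CB \<Longrightarrow> diag (\<lambda>w. csg [w]) c \<in> CB"
  using C_diag[of c "\<lambda>_ n. (- 1) ^ (n - 1)"] by (simp add: CB_iff cobar_deg_def)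

lemma CB_phl:
  assumes "c \<in> CB"
  shows "phl c \<in> CB"
proof -
  have "lookup (phl c) [] = 0"
  proof (rule ccontr)
    assume "lookup (phl c) [] \<noteq> 0"
    then have "[] \<in> keys (phl c)" by (simp add: in_keys_iff)
    from plin_keys[OF plin_phl this] obtain w where "[] \<in> keys (phl (mon w))" by blast
    then show False by (simp add: in_keys_iff)
  qed
  then show ?thesis using C_phl assms by (simp add: CB_iff)
qed

lemma K_subspace: "pm.subspace K"
  unfolding cobar_carrier_def by (rule pm.subspace_span)

lemma K_prod: "set cs \<subseteq> CB \<Longrightarrow> prod_list (map desusp cs) \<in> K"
  unfolding cobar_carrier_def by (rule pm.span_base) (auto simp: lists_eq_set)

lemma K_induct:
  assumes "x \<in> K" "pm.subspace S" "\<And>cs. set cs \<subseteq> CB \<Longrightarrow> prod_list (map desusp cs) \<in> S"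
  shows "x \<in> S"
proof -
  have "K \<subseteq> S" unfolding cobar_carrier_def
    by (rule pm.span_minimal) (use assms(2,3) in \<open>auto simp: lists_eq_set\<close>)
  then show ?thesis using assms(1) by blast
qed

lemma K_one: "1 \<in> K"
  using K_prod[of "[]"] by simp

lemma K_desusp: "c \<in> CB \<Longrightarrow> desusp c \<in> K"
  using K_prod[of "[c]"] by simp

lemma K_mult:
  assumes "x \<in> K" "y \<in> K"
  shows "x * y \<in> K"
proof -
  have "x \<in> {x. x * y \<in> K}"
  proof (rule K_induct[OF assms(1)])
    show "pm.subspace {x. x * y \<in> K}" by (rule subspace_vimage[OF _ K_subspace]) (intro plin_intros)
    fix cs assume cs: "set cs \<subseteq> CB"
    have "y \<in> {y. prod_list (map desusp cs) * y \<in> K}"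
    proof (rule K_induct[OF assms(2)])
      show "pm.subspace {y. prod_list (map desusp cs) * y \<in> K}"
        by (rule subspace_vimage[OF _ K_subspace]) (intro plin_intros)
      fix cs' assume "set cs' \<subseteq> CB"
      then show "prod_list (map desusp cs') \<in> {y. prod_list (map desusp cs) * y \<in> K}"
        using K_prod[of "cs @ cs'"] cs by simp
    qed
    then show "prod_list (map desusp cs) \<in> {x. x * y \<in> K}" by simp
  qed
  then show ?thesis by simp
qed

text \<open>To check a linear condition on the cobar construction, multiply generators from the left.\<close>

lemma K_linear_induct [consumes 3, case_names one mult]:
  assumes "x \<in> K" "plin F" "pm.subspace S" and one: "F 1 \<in> S"
    and mult: "\<And>c p. c \<in> CB \<Longrightarrow> p \<in> K \<Longrightarrow> F p \<in> S \<Longrightarrow> F (desusp c * p) \<in> S"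
  shows "F x \<in> S"
proof -
  have "x \<in> {x. F x \<in> S}"
  proof (rule K_induct[OF assms(1)])
    show "pm.subspace {x. F x \<in> S}" by (rule subspace_vimage[OF assms(2,3)])
    fix cs assume "set cs \<subseteq> CB"
    then have "F (prod_list (map desusp cs)) \<in> S"
      by (induction cs) (simp_all add: one mult K_prod)
    then show "prod_list (map desusp cs) \<in> {x. F x \<in> S}" by simp
  qed
  then show ?thesis by simp
qed

text \<open>The derivations of the cobar construction are evaluated on tensor factors, which is the reason
  for knowing that these belong to the coalgebra again.\<close>

lemma K_slice:
  assumes "f \<in> K"
  shows "Poly_Mapping.map_key (\<lambda>w. P @ [w] @ Q) f \<in> CB"
proof -
  define m where "m = (\<lambda>P Q (f :: 'x list list \<Rightarrow>\<^sub>0 'k). Poly_Mapping.map_key (\<lambda>w. P @ [w] @ Q) f)"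
  have lookup_m [simp]: "lookup (m P Q f) w = lookup f (P @ [w] @ Q)" for P Q f w
    unfolding m_def by (simp add: map_key.rep_eq inj_def)
  have m: "plin (m P Q)" for P Q
    by (rule plinI) (auto intro!: poly_mapping_eqI simp: lookup_add)
  have "f \<in> {f. m P Q f \<in> CB}"
  proof (rule K_induct[OF assms])
    show "pm.subspace {f. m P Q f \<in> CB}" by (rule subspace_vimage[OF m CB_subspace])
    fix cs assume "set cs \<subseteq> CB"
    then have "m P Q (prod_list (map desusp cs)) \<in> CB"
    proof (induction cs arbitrary: P)
      case Nil
      have "m P Q 1 = 0" by (rule poly_mapping_eqI) (simp add: lookup_one zero_list_def when_def)
      then show ?case using pm.subspace_0[OF CB_subspace] by simp
    next
      case (Cons c cs)
      let ?p = "prod_list (map desusp cs)"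
      show ?case
      proof (cases P)
        case Nil
        have "m [] Q (desusp c * ?p) = scal (lookup ?p Q) c"
          by (rule poly_mapping_eqI) (simp add: lookup_desusp_mult)
        then show ?thesis using Cons.prems Nil pm.subspace_scale[OF CB_subspace] by simp
      next
        case (Cons w P')
        have "m (w # P') Q (desusp c * ?p) = scal (lookup c w) (m P' Q ?p)"
          by (rule poly_mapping_eqI) (simp add: lookup_desusp_mult)
        then show ?thesis using Cons.IH[of P'] Cons.prems Cons pm.subspace_scale[OF CB_subspace]
          \<open>\<And>P. set cs \<subseteq> CB \<Longrightarrow> m P Q (prod_list (map desusp cs)) \<in> CB\<close> \<open>set (c # cs) \<subseteq> CB\<close> by simp
      qed
    qed
    then show "prod_list (map desusp cs) \<in> {f. m P Q f \<in> CB}" by simp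
  qed
  then show ?thesis unfolding m_def by simp
qed

lemma K_keys_nonempty:
  assumes "f \<in> K" "W \<in> keys f"
  shows "[] \<notin> set W"
proof
  assume "[] \<in> set W"
  then obtain P Q where "W = P @ [[]] @ Q" by (metis append_Cons append_Nil split_list)
  moreover have "lookup (Poly_Mapping.map_key (\<lambda>w. P @ [w] @ Q) f) [] = lookup f (P @ [[]] @ Q)"
    by (simp add: map_key.rep_eq inj_def)
  ultimately show False using assms(2) K_slice[OF assms(1), of P Q] by (simp add: CB_iff in_keys_iff)
qed

text \<open>\<open>K\<close> is spanned by products of elements of the coalgebra that are homogeneous in length.  On the
  words of such a product the list of letter lengths is constant, so the projection either fixes or
  kills it.\<close>

lemma K_component:
  assumes "f \<in> K"
  shows "component (\<lambda>W. P (map length W)) f \<in> K"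
proof -
  have "f \<in> {f. component (\<lambda>W. P (map length W)) f \<in> K}"
  proof (rule K_induct[OF assms])
    show "pm.subspace {f. component (\<lambda>W. P (map length W)) f \<in> K}"
      by (rule subspace_vimage[OF plin_component K_subspace])
    fix cs assume "set cs \<subseteq> CB"
    then have "component (\<lambda>W. P (map length W)) (prod_list (map desusp cs)) \<in> K"
    proof (induction cs arbitrary: P)
      case Nil
      have "component (\<lambda>W. P (map length W)) (1 :: 'x list list \<Rightarrow>\<^sub>0 'k) = (if P [] then 1 else 0)"
        by (rule poly_mapping_eqI) (auto simp: lookup_one zero_list_def when_def)
      then show ?case using K_one pm.subspace_0[OF K_subspace] by simp
    next
      case (Cons c cs)
      have "component (\<lambda>W. P (map length W)) (desusp c * prod_list (map desusp cs)) \<in> K"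
        unfolding component_lengths_desusp_mult[OF finite_imageI[OF finite_keys] order_refl]
      proof (rule pm.subspace_sum[OF K_subspace], rule K_mult)
        fix n
        show "desusp (component (\<lambda>w. length w = n) c) \<in> K"
          using Cons.prems by (intro K_desusp CB_component) simp
        show "component (\<lambda>W. P (n # map length W)) (prod_list (map desusp cs)) \<in> K"
          using Cons.IH[of "\<lambda>l. P (n # l)"] Cons.prems by simp
      qed
      then show ?case by simp
    qed
    then show "prod_list (map desusp cs) \<in> {f. component (\<lambda>W. P (map length W)) f \<in> K}" by simp
  qed
  then show ?thesis by simp
qed

subsection \<open>Comparison of the differentials\<close>

lemma phi_tilde_phl:
  assumes "c \<in> C"
  shows "phi_tilde X deg R c = phl c"
  unfolding phi_tilde_def coderivation_def phl_def window_def frames_def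
  using gam_dual[OF C_slice[OF assms]] by (simp add: slice_def)

lemma gen0_theta:
  assumes "c \<in> C"
  shows "lin gen0 c = single [] (theta_tilde X deg R c)"
  by (simp add: lin_gen0 tht_dual[OF assms])

lemma d2_der: "d2 deg f = der gen2 f"
  unfolding d2_def
proof (rule derivation_eq_der)
  fix P Q
  show "(\<lambda>c. \<Sum>w\<in>keys c. \<Sum>(u, v)\<in>{(u, v). u \<noteq> [] \<and> v \<noteq> [] \<and> u @ v = w}.
      single [u, v] (- ((- 1) ^ sdeg deg u) * lookup c w))
      (Poly_Mapping.map_key (\<lambda>w. P @ [w] @ Q) f) = lin gen2 (Poly_Mapping.map_key (\<lambda>w. P @ [w] @ Q) f)"
    unfolding lin_def by (simp only: gen2_splits)
qed

lemma cobar_diff_der: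
  assumes "f \<in> K"
  shows "cobar_diff X deg R f = der gen f"
proof -
  have "d0 X deg R f = der gen0 f" unfolding d0_def
    by (rule derivation_eq_der) (simp only: gen0_theta[OF CB_C[OF K_slice[OF assms]]])
  moreover have "d1 X deg R f = der (\<lambda>w. - desusp (phl (mon w))) f" unfolding d1_def
  proof (rule derivation_eq_der)
    fix P Q
    have neg: "- desusp (phl c) = lin (\<lambda>w. - desusp (phl (mon w))) c" for c
      by (rule plin_eq[of "\<lambda>c. - desusp (phl c)" "lin (\<lambda>w. - desusp (phl (mon w)))" c])
        (intro plin_intros plin_lin | simp)+
    show "- desusp (phi_tilde X deg R (Poly_Mapping.map_key (\<lambda>w. P @ [w] @ Q) f)) =
        lin (\<lambda>w. - desusp (phl (mon w))) (Poly_Mapping.map_key (\<lambda>w. P @ [w] @ Q) f)"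
      unfolding phi_tilde_phl[OF CB_C[OF K_slice[OF assms]]] by (rule neg)
  qed
  moreover have "gen = (\<lambda>w. (gen0 w + - desusp (phl (mon w))) + gen2 w)" by (simp add: gen_def fun_eq_iff)
  then have "der gen f = der gen0 f + der (\<lambda>w. - desusp (phl (mon w))) f + der gen2 f"
    by (simp only: der_add_gen)
  ultimately show ?thesis by (simp add: cobar_diff_def d2_der)
qed

lemma chain_complex_d2: "chain_complex (cobar X deg R) (d2 deg)"
  using koszul unfolding qA_Koszul_def quasi_iso_def chain_map_def by blast

text \<open>That \<open>d\<^sub>2\<close> preserves the cobar construction and squares to zero is part of the Koszulness
  assumption, which speaks of a chain map.\<close>

lemma K_gen2: "x \<in> K \<Longrightarrow> der gen2 x \<in> K"
  and gen2_gen2: "x \<in> K \<Longrightarrow> der gen2 (der gen2 x) = 0"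
  using chain_complex_d2 unfolding chain_complex_def
  by (auto simp: d2_der cobar_def)

lemma abelian_group_cobar: "abelian_group (cobar X deg R)"
  using chain_complex_d2 unfolding chain_complex_def by blast

lemma K_diag:
  assumes "x \<in> K"
  shows "diag csg x \<in> K"
  using assms plin_diag K_subspace
proof (induction rule: K_linear_induct)
  case one
  have "diag csg 1 = 1" using diag_csg_mon[of "[]"] by simp
  then show ?case using K_one by simp
next
  case (mult c p)
  then show ?case by (simp add: diag_csg_mult diag_csg_lift_desusp K_mult K_desusp CB_diag)
qed

lemma K_lin_gen:
  assumes "c \<in> CB"
  shows "lin gen c \<in> K"
proof -
  have "lin gen2 c \<in> K" using K_gen2[OF K_desusp[OF assms]] by (simp add: der_desusp)
  moreover have "lin gen0 c \<in> K"
  proof -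
    have "single [] a = scal a (1 :: 'x list list \<Rightarrow>\<^sub>0 'k)" for a
      using single_scal_mon[of "[]" a] by simp
    then show ?thesis using gen0_theta[OF CB_C[OF assms]] pm.subspace_scale[OF K_subspace K_one] by simp
  qed
  ultimately show ?thesis
    using K_desusp[OF CB_phl[OF assms]] by (simp add: lin_gen pm.subspace_add[OF K_subspace] pm.subspace_diff[OF K_subspace])
qed

lemma K_gen:
  assumes "x \<in> K"
  shows "der gen x \<in> K"
  using assms plin_der K_subspace
proof (induction rule: K_linear_induct)
  case one
  then show ?case using pm.subspace_0[OF K_subspace] by simp
next
  case (mult c p)
  then show ?case
    by (simp add: der_mult der_desusp K_mult K_lin_gen K_diag K_desusp pm.subspace_add[OF K_subspace])
qed

text \<open>The square of an odd derivation is a derivation, so it vanishes once it vanishes on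
  generators.\<close>

lemma gen_gen:
  assumes "x \<in> K"
  shows "der gen (der gen x) = 0"
proof -
  have "plin (\<lambda>x. der gen (der gen x))" by (intro plin_intros plin_der)
  moreover have "pm.subspace {0 :: 'x list list \<Rightarrow>\<^sub>0 'k}" by simp
  ultimately have "der gen (der gen x) \<in> {0}"
  proof (rule K_linear_induct[OF assms])
    show "der gen (der gen 1) \<in> {0}" by (simp add: plin_0[OF plin_der])
    fix c p assume c: "c \<in> CB" and p: "der gen (der gen p) \<in> {0}"
    have "der gen2 (lin gen2 c) = 0" using gen2_gen2[OF K_desusp[OF c]] by (simp add: der_desusp)
    then have "der gen (lin gen c) = 0"
      unfolding der_gen_gen window_defect_dual[OF CB_C[OF c]] gen0_phl_dual[OF CB_C[OF c]]
      by (simp add: desusp_def)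
    moreover have "der gen (diag csg (desusp c)) = - diag csg (lin gen c)"
      by (simp add: diag_csg_lift_desusp der_desusp diag_csg_gen)
    ultimately show "der gen (der gen (desusp c * p)) \<in> {0}"
      using p by (simp add: der_mult der_desusp plin_add[OF plin_der])
  qed
  then show ?thesis by simp
qed

end

section \<open>Quasi-isomorphisms onto complexes with zero differential\<close>

lemma chain_map_zero:
  assumes "chain_map (subalgebra_ring K) d S e f" "0 \<in> K"
  shows "d 0 = 0" "f 0 = \<zero>\<^bsub>S\<^esub>"
proof -
  have d: "d (x + y) = d x + d y" if "x \<in> K" "y \<in> K" for x y
    using assms(1) that by (simp add: chain_map_def chain_complex_def)
  show "d 0 = 0" using d[OF assms(2) assms(2)] by simp
  have f: "f 0 \<in> carrier S" "f (0 + 0) = f 0 \<oplus>\<^bsub>S\<^esub> f 0" and S: "abelian_group S"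
    using assms by (auto simp: chain_map_def chain_complex_def)
  show "f 0 = \<zero>\<^bsub>S\<^esub>"
  proof -
    have "f 0 \<oplus>\<^bsub>S\<^esub> f 0 = f 0 \<oplus>\<^bsub>S\<^esub> \<zero>\<^bsub>S\<^esub>"
      using f abelian_monoid.r_zero[OF abelian_group.axioms(1)[OF S] f(1)] by simp
    then show ?thesis
      using abelian_groupE(1)[OF S] abelian_group.a_group[OF S] f(1)
      by (metis S abelian_group.r_neg1 abelian_groupE(2))
  qed
qed

text \<open>The homology of the target consists of singletons, and the class of a cycle is sent to the
  singleton of its image.\<close>

lemma quasi_iso_onto_zero_differential:
  assumes cm: "chain_map (subalgebra_ring K) d S (\<lambda>_. \<zero>\<^bsub>S\<^esub>) f"
    and K0: "0 \<in> K" and Kdiff: "\<forall>x\<in>K. \<forall>y\<in>K. x - y \<in> K"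
  shows "quasi_iso (subalgebra_ring K) d S (\<lambda>_. \<zero>\<^bsub>S\<^esub>) f \<longleftrightarrow>
    (\<forall>z\<in>K. d z = 0 \<longrightarrow> f z = \<zero>\<^bsub>S\<^esub> \<longrightarrow> z \<in> d ` K) \<and>
    (\<forall>y\<in>carrier S. \<exists>z\<in>K. d z = 0 \<and> f z = y)"
proof -
  have K: "0 \<in> K" "\<And>x y. x \<in> K \<Longrightarrow> y \<in> K \<Longrightarrow> x - y \<in> K"
    using K0 Kdiff by blast+
  have S: "abelian_group S" and fS: "\<And>x. x \<in> K \<Longrightarrow> f x \<in> carrier S"
    and dK: "\<And>x. x \<in> K \<Longrightarrow> d x \<in> K"
    and d: "\<And>x y. x \<in> K \<Longrightarrow> y \<in> K \<Longrightarrow> d (x + y) = d x + d y"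
    and f: "\<And>x y. x \<in> K \<Longrightarrow> y \<in> K \<Longrightarrow> f (x + y) = f x \<oplus>\<^bsub>S\<^esub> f y"
    and fd: "\<And>x. x \<in> K \<Longrightarrow> f (d x) = \<zero>\<^bsub>S\<^esub>"
    using cm by (auto simp: chain_map_def chain_complex_def)
  note d0 = chain_map_zero(1)[OF cm K(1)] and f0 = chain_map_zero(2)[OF cm K(1)]
  have Kneg: "- x \<in> K" if "x \<in> K" for x using K(2)[OF K(1) that] by simp
  have Kadd: "x + y \<in> K" if "x \<in> K" "y \<in> K" for x y using K(2)[OF that(1) Kneg[OF that(2)]] by simp
  have dminus: "d (x - y) = d x - d y" if "x \<in> K" "y \<in> K" for x y
    using d[OF K(2)[OF that] that(2)] by simp
  interpret S: abelian_group S by (rule S)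
  define cos where "cos = (\<lambda>z. (d ` K) +>\<^bsub>subalgebra_ring K\<^esub> z)"
  have cos: "cos z = {d a + z | a. a \<in> K}" for z
    unfolding cos_def a_r_coset_def' by auto
  have hS: "homology S (\<lambda>_. \<zero>\<^bsub>S\<^esub>) = (\<lambda>y. {y}) ` carrier S"
  proof -
    have "(\<lambda>_. \<zero>\<^bsub>S\<^esub>) ` carrier S = {\<zero>\<^bsub>S\<^esub>}" using S.zero_closed by blast
    then show ?thesis unfolding homology_def a_r_coset_def' by (auto intro!: image_cong)
  qed
  have hm: "homology_map S (\<lambda>_. \<zero>\<^bsub>S\<^esub>) f (cos z) = {f z}" if z: "z \<in> K" for z
  proof -
    have "(\<lambda>_. \<zero>\<^bsub>S\<^esub>) ` carrier S = {\<zero>\<^bsub>S\<^esub>}" using S.zero_closed by blast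
    moreover have "\<zero>\<^bsub>S\<^esub> \<oplus>\<^bsub>S\<^esub> f (d a + z) = f z" if "a \<in> K" for a
      using f[OF dK[OF that] z] fd[OF that] fS[OF z] by simp
    ultimately show ?thesis
      unfolding homology_map_def cos a_r_coset_def' using K(1) by auto
  qed
  let ?Z = "{z \<in> K. d z = 0}"
  have hK: "homology (subalgebra_ring K) d = cos ` ?Z"
    unfolding homology_def cos_def by simp
  have cos_eq: "cos z = cos z' \<longleftrightarrow> z - z' \<in> d ` K" if z: "z \<in> K" "z' \<in> K" for z z'
  proof
    assume "cos z = cos z'"
    moreover have "z \<in> cos z" unfolding cos using K(1) d0 by force
    ultimately show "z - z' \<in> d ` K" unfolding cos by auto
  next
    assume "z - z' \<in> d ` K"
    then obtain a where a: "a \<in> K" "z - z' = d a" by blast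
    have "d b + z = d (b + a) + z'" if "b \<in> K" for b using d[OF that a(1)] a(2) by (simp add: algebra_simps)
    moreover have "d b + z' = d (b - a) + z" if "b \<in> K" for b
      using dminus[OF that a(1)] a(2) by (simp add: algebra_simps)
    ultimately show "cos z = cos z'" unfolding cos using Kadd[OF _ a(1)] K(2)[OF _ a(1)] by blast
  qed
  have "quasi_iso (subalgebra_ring K) d S (\<lambda>_. \<zero>\<^bsub>S\<^esub>) f \<longleftrightarrow>
      inj_on (homology_map S (\<lambda>_. \<zero>\<^bsub>S\<^esub>) f) (cos ` ?Z) \<and>
      homology_map S (\<lambda>_. \<zero>\<^bsub>S\<^esub>) f ` (cos ` ?Z) = (\<lambda>y. {y}) ` carrier S"
    unfolding quasi_iso_def bij_betw_def hK hS using cm by blast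
  also have "inj_on (homology_map S (\<lambda>_. \<zero>\<^bsub>S\<^esub>) f) (cos ` ?Z) \<longleftrightarrow>
      (\<forall>z\<in>?Z. \<forall>z'\<in>?Z. f z = f z' \<longrightarrow> z - z' \<in> d ` K)"
    unfolding inj_on_def using hm cos_eq by auto
  also have "\<dots> \<longleftrightarrow> (\<forall>z\<in>K. d z = 0 \<longrightarrow> f z = \<zero>\<^bsub>S\<^esub> \<longrightarrow> z \<in> d ` K)"
  proof
    assume *: "\<forall>z\<in>?Z. \<forall>z'\<in>?Z. f z = f z' \<longrightarrow> z - z' \<in> d ` K"
    show "\<forall>z\<in>K. d z = 0 \<longrightarrow> f z = \<zero>\<^bsub>S\<^esub> \<longrightarrow> z \<in> d ` K"
    proof (intro ballI impI)
      fix z assume "z \<in> K" "d z = 0" "f z = \<zero>\<^bsub>S\<^esub>"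
      then have "z - 0 \<in> d ` K" using *[rule_format, of z 0] K(1) d0 f0 by simp
      then show "z \<in> d ` K" by simp
    qed
  next
    assume *: "\<forall>z\<in>K. d z = 0 \<longrightarrow> f z = \<zero>\<^bsub>S\<^esub> \<longrightarrow> z \<in> d ` K"
    show "\<forall>z\<in>?Z. \<forall>z'\<in>?Z. f z = f z' \<longrightarrow> z - z' \<in> d ` K"
    proof (intro ballI impI)
      fix z z' assume z: "z \<in> ?Z" "z' \<in> ?Z" "f z = f z'"
      then have zK: "z - z' \<in> K" "z' \<in> K" using K(2) by auto
      have "f z' = f (z - z') \<oplus>\<^bsub>S\<^esub> f z'" using f[OF zK] z(3) by simp
      then have "f (z - z') = \<zero>\<^bsub>S\<^esub>"
        using S.add.r_cancel_one'[of "f z'" "f (z - z')"] fS[OF zK(1)] fS[OF zK(2)] by simp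
      moreover have "d (z - z') = 0" using dminus z by simp
      ultimately show "z - z' \<in> d ` K" using * zK by blast
    qed
  qed
  also have "homology_map S (\<lambda>_. \<zero>\<^bsub>S\<^esub>) f ` (cos ` ?Z) = (\<lambda>y. {y}) ` carrier S \<longleftrightarrow>
      (\<forall>y\<in>carrier S. \<exists>z\<in>K. d z = 0 \<and> f z = y)"
  proof -
    have "homology_map S (\<lambda>_. \<zero>\<^bsub>S\<^esub>) f ` (cos ` ?Z) = (\<lambda>y. {y}) ` (f ` ?Z)"
      unfolding image_image using hm by (intro image_cong) auto
    moreover have "(\<lambda>y. {y}) ` (f ` ?Z) = (\<lambda>y. {y}) ` carrier S \<longleftrightarrow> f ` ?Z = carrier S"
      by (rule inj_image_eq_iff) (simp add: inj_def)
    moreover have "f ` ?Z = carrier S \<longleftrightarrow> (\<forall>y\<in>carrier S. \<exists>z\<in>K. d z = 0 \<and> f z = y)"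
    proof
      assume eq: "f ` ?Z = carrier S"
      show "\<forall>y\<in>carrier S. \<exists>z\<in>K. d z = 0 \<and> f z = y" unfolding eq[symmetric] by blast
    next
      assume *: "\<forall>y\<in>carrier S. \<exists>z\<in>K. d z = 0 \<and> f z = y"
      show "f ` ?Z = carrier S"
      proof (intro equalityI subsetI)
        fix y assume "y \<in> carrier S"
        with * obtain z where "z \<in> K" "d z = 0" "f z = y" by blast
        then show "y \<in> f ` ?Z" by blast
      qed (use fS in blast)
    qed
    ultimately show ?thesis by (simp only:)
  qed
  finally show ?thesis .
qed

section \<open>Comparison with the QLC algebra\<close>

lemma g_lift_lin: "g_lift = lin (\<lambda>W. prod_list (map kappa W))"
  by (rule ext) (simp add: g_lift_def lin_def)

lemma plin_g_lift: "plin g_lift"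
  unfolding g_lift_lin by (rule plin_lin)

lemma plin_comp_g_lift [plin_intros]: "plin F \<Longrightarrow> plin (\<lambda>x. g_lift (F x))"
  unfolding g_lift_lin by (rule plin_comp_lin)

lemma g_lift_mon:
  "g_lift (mon W) = (if \<forall>w\<in>set W. length w = 1 then mon (concat W) else 0 :: 'x list \<Rightarrow>\<^sub>0 'k::field)"
proof (induction W)
  case Nil
  then show ?case by (simp add: g_lift_lin del: mon_Nil) simp
next
  case (Cons w W)
  have "g_lift (mon (w # W)) = kappa w * (g_lift (mon W) :: 'x list \<Rightarrow>\<^sub>0 'k)"
    by (simp add: g_lift_lin)
  then show ?case unfolding Cons.IH by (simp add: kappa_def)
qed

lemma g_lift_mult: "g_lift (x * y) = g_lift x * g_lift y"
proof (rule plin_eq[of "\<lambda>x. g_lift (x * y)" "\<lambda>x. g_lift x * g_lift y" x])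
  fix U
  show "g_lift (mon U * y) = g_lift (mon U) * g_lift y"
  proof (rule plin_eq[of "\<lambda>y. g_lift (mon U * y)"
      "\<lambda>y. g_lift (mon U) * g_lift y" y])
    fix V show "g_lift (mon U * mon V) = g_lift (mon U) * g_lift (mon V)"
      by (simp add: g_lift_lin)
  qed (intro plin_intros)+
qed (intro plin_intros)+

text \<open>The section of \<open>g_lift\<close> that identifies \<open>T(V)\<close> with the part of syzygy degree zero.\<close>

definition emb :: "('x list \<Rightarrow>\<^sub>0 'k::field) \<Rightarrow> ('x list list \<Rightarrow>\<^sub>0 'k)" where
  "emb = lin (\<lambda>w. mon (map (\<lambda>x. [x]) w))"

lemma plin_emb: "plin emb"
  unfolding emb_def by (rule plin_lin)

lemma plin_comp_emb [plin_intros]: "plin F \<Longrightarrow> plin (\<lambda>x. emb (F x))"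
  unfolding emb_def by (rule plin_comp_lin)

lemma emb_mon: "emb (mon w) = mon (map (\<lambda>x. [x]) w)"
  by (simp add: emb_def)

lemma emb_mult: "emb (x * y) = emb x * emb y"
proof (rule plin_eq[of "\<lambda>x. emb (x * y)" "\<lambda>x. emb x * emb y" x])
  fix U
  show "emb (mon U * y) = emb (mon U) * emb y"
  proof (rule plin_eq[of "\<lambda>y. emb (mon U * y)" "\<lambda>y. emb (mon U) * emb y" y])
    fix V show "emb (mon U * mon V) = emb (mon U) * emb (mon V)" by (simp add: emb_def)
  qed (intro plin_intros)+
qed (intro plin_intros)+

lemma g_lift_emb: "g_lift (emb t) = t"
proof (rule plin_eq[of "\<lambda>t. g_lift (emb t)" "\<lambda>t. t" t])
  fix w :: "'a list"
  have "concat (map (\<lambda>x. [x]) w) = w" by (induction w) simp_all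
  then show "g_lift (emb (mon w)) = mon w" by (simp add: emb_mon g_lift_mon)
qed (intro plin_intros)+

context word_ops
begin

lemma gen_letter [simp]: "gen [x] = 0"
  by (simp add: gen_def gen0_length desusp_lin)

lemma der_gen_emb: "der gen (emb t) = 0"
proof (rule plin_eq[of "\<lambda>t. der gen (emb t)" "\<lambda>_. 0" t])
  fix w show "der gen (emb (mon w)) = 0"
    unfolding emb_mon by (induction w) (simp_all add: der_Cons)
  show "plin (\<lambda>_ :: 'x list \<Rightarrow>\<^sub>0 'k. 0 :: 'x list list \<Rightarrow>\<^sub>0 'k)" by (rule plinI) simp_all
qed (intro plin_intros)

lemma diag_csg_emb: "diag csg (emb t) = emb (diag (\<lambda>w. csg (map (\<lambda>x. [x]) w)) t)"
  by (rule plin_eq[of "\<lambda>t. diag csg (emb t)" "\<lambda>t. emb (diag (\<lambda>w. csg (map (\<lambda>x. [x]) w)) t)" t])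
    (intro plin_intros | simp add: emb_def diag_def)+

lemma emb_g_lift_mon:
  assumes "[] \<notin> set W"
  shows "emb (g_lift (mon W)) = (if syz W = 0 then mon W else 0)"
proof -
  have "syz W = 0 \<longleftrightarrow> (\<forall>w\<in>set W. length w = 1)"
    using assms by (induction W) (auto simp: length_Suc_conv le_Suc_eq neq_Nil_conv)
  moreover have "map (\<lambda>x. [x]) (concat W) = W" if "\<forall>w\<in>set W. length w = 1"
    using that by (induction W) (auto simp: length_Suc_conv)
  ultimately show ?thesis using plin_0[OF plin_emb] by (auto simp: g_lift_mon emb_mon)
qed

lemma g_lift_desusp: "g_lift (desusp f) = component (\<lambda>w. length w = 1) f"
proof (rule plin_eq[of "\<lambda>f. g_lift (desusp f)" "component (\<lambda>w. length w = 1)" f])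
  fix w
  show "g_lift (desusp (mon w)) = component (\<lambda>w. length w = 1) (mon w)"
    by (auto intro!: poly_mapping_eqI simp: g_lift_mon lookup_single when_def)
qed (intro plin_intros plin_component)+

end

context qlc_words
begin

text \<open>Only words of length two have a boundary with a term of syzygy degree zero.  For these the
  signs in the differential combine to those of the relation \<open>x - \<phi>(x) + \<theta>(x)\<close>.\<close>

lemma g_lift_gen: "g_lift (lin gen c) = rel (q c)"
proof (rule plin_eq[of "\<lambda>c. g_lift (lin gen c)" "\<lambda>c. rel (q c)" c])
  fix w :: "'x list"
  have g_gen: "g_lift (gen w) = g_lift (gen0 w) - g_lift (desusp (phl (mon w))) + g_lift (gen2 w)"
    by (simp add: gen_def plin_add[OF plin_g_lift] plin_diff[OF plin_g_lift])
  show "g_lift (lin gen (mon w)) = rel (q (mon w))"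
  proof (cases "length w = 2")
    case True
    then obtain x y where w: "w = [x, y]" by (auto simp: length_Suc_conv numeral_2_eq_2)
    have "g_lift (gen0 w) = tht w"
    proof -
      have "g_lift (gen0 w) = scal (lookup (tht w) []) (mon [])"
        by (simp add: gen0_def g_lift_lin)
      also have "\<dots> = tht w"
        unfolding scal_single mult_1_right by (rule tht_scalar[symmetric])
      finally show ?thesis .
    qed
    moreover have "g_lift (desusp (phl (mon w))) = gam w"
    proof -
      have "phl (mon w) = gam w" unfolding w using phl_Cons2[of x y "[]"] by simp
      moreover have "component (\<lambda>w. length w = 1) (gam w) = gam w"
        using gam_Tpow[of w] by (intro poly_mapping_eqI) (auto simp: Tpow_iff)
      ultimately show ?thesis by (simp add: g_lift_desusp)
    qed
    moreover have "g_lift (gen2 w) = susp2 deg (mon w)"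
    proof -
      have "gen2 w = scal (- sg [x]) (mon [[x], [y]])" unfolding w
        by (simp add: gen2_Cons single_uminus prefix_def pm.scale_right_diff_distrib)
      then have "g_lift (gen2 w) = scal (- sg [x]) (mon [x, y])"
        by (simp add: plin_scal[OF plin_g_lift] plin_neg[OF plin_g_lift] g_lift_mon del: scal_single)
      then show ?thesis unfolding w by (simp add: susp2_diag diag_def sdeg_def)
    qed
    ultimately show ?thesis using True by (simp add: g_gen q_mon rel_def)
  next
    case False
    have "component (\<lambda>w. length w = 1) (phl (mon w)) = 0"
    proof (rule poly_mapping_eqI)
      fix u
      have "length u \<noteq> 1" if "u \<in> keys (phl (mon w))"
        using keys_phl_mon[OF that] False by auto
      then show "lookup (component (\<lambda>w. length w = 1) (phl (mon w))) u = lookup 0 u"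
        by (auto simp: in_keys_iff)
    qed
    moreover have "g_lift (gen2 w) = 0"
    proof (rule plin_eq_on[of g_lift "\<lambda>_. 0" "gen2 w"])
      show "plin (\<lambda>_ :: 'x list list \<Rightarrow>\<^sub>0 'k. 0 :: 'x list \<Rightarrow>\<^sub>0 'k)" by (rule plinI) simp_all
      fix W assume "W \<in> keys (gen2 w)"
      from keys_gen2[OF this] obtain u v where "W = [u, v]" "u @ v = w" by blast
      then show "g_lift (mon W) = 0" using False by (auto simp: g_lift_mon)
    qed (rule plin_g_lift)
    moreover have "rel 0 = 0" by (simp add: rel_def susp2_def)
    ultimately show ?thesis using False
      by (simp add: g_gen q_mon g_lift_desusp gen0_length plin_0[OF plin_g_lift])
  qed
qed (intro plin_intros)+

end

context koszul_words
begin

lemma K_minus: "x \<in> K \<Longrightarrow> y \<in> K \<Longrightarrow> x - y \<in> K"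
  by (rule pm.subspace_diff[OF K_subspace])

lemma K_closed_minus: "\<forall>x\<in>K. \<forall>y\<in>K. x - y \<in> K"
  using K_minus by blast

lemma K_zero: "0 \<in> K"
  by (rule pm.subspace_0[OF K_subspace])

text \<open>Injectivity in homology of the comparison map for \<open>qA\<close>, applied to a cycle with image zero.\<close>

lemma gen2_exact:
  assumes z: "z \<in> K" "der gen2 z = 0" "g_lift z = 0"
  obtains y where "y \<in> K" "der gen2 y = z"
proof -
  let ?S = "QLC_algebra X (q ` R)" and ?f = "g_kappa X (q ` R)"
  have qi: "quasi_iso (subalgebra_ring K) (d2 deg) ?S (\<lambda>_. \<zero>\<^bsub>?S\<^esub>) ?f"
    using koszul unfolding qA_Koszul_def cobar_def .
  then have cm: "chain_map (subalgebra_ring K) (d2 deg) ?S (\<lambda>_. \<zero>\<^bsub>?S\<^esub>) ?f"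
    unfolding quasi_iso_def by blast
  have "?f z = ?f 0" by (simp add: g_kappa_def z(3) plin_0[OF plin_g_lift])
  then have "?f z = \<zero>\<^bsub>?S\<^esub>" using chain_map_zero(2)[OF cm K_zero] by simp
  moreover have "\<forall>z\<in>K. d2 deg z = 0 \<longrightarrow> ?f z = \<zero>\<^bsub>?S\<^esub> \<longrightarrow> z \<in> d2 deg ` K"
    using qi unfolding quasi_iso_onto_zero_differential[OF cm K_zero K_closed_minus] by (rule conjunct1)
  moreover have "d2 deg z = 0" using z(2) by (simp only: d2_der)
  ultimately have "z \<in> d2 deg ` K" using z(1) by blast
  then obtain y where "y \<in> K" "z = d2 deg y" by blast
  then show ?thesis using that[of y] by (simp add: d2_der)
qed

lemma K_g_lift_T:
  assumes "x \<in> K"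
  shows "g_lift x \<in> T X"
  using assms plin_g_lift subspace_T
proof (induction rule: K_linear_induct)
  case one
  have "g_lift (1 :: 'x list list \<Rightarrow>\<^sub>0 'k) = 1" using g_lift_mon[of "[]"] by simp
  then show ?case by (simp add: T_one)
next
  case (mult c p)
  have "g_lift (desusp c) \<in> T X"
    using C_T[OF CB_C[OF mult(1)]] by (simp add: g_lift_desusp T_iff)
  then show ?case using mult(3) by (simp add: g_lift_mult T_mult)
qed

text \<open>By the Leibniz rule and \<open>g_lift_gen\<close>, boundaries map into the ideal generated by the full
  relations.\<close>

lemma g_lift_der_gen:
  assumes "x \<in> K"
  shows "g_lift (der gen x) \<in> I"
proof -
  have "plin (\<lambda>x. g_lift (der gen x))" by (intro plin_intros plin_der)
  from assms this I_subspace show ?thesis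
  proof (induction rule: K_linear_induct)
    case one
    then show ?case using pm.subspace_0[OF I_subspace] by (simp add: plin_0[OF plin_g_lift])
  next
    case (mult c p)
    have "g_lift (lin gen c) \<in> I"
      unfolding g_lift_gen using rel_R[OF C_q0[OF CB_C[OF mult(1)]]] I_R by blast
    then show ?case
      using mult(3) K_g_lift_T[OF mult(2)] K_g_lift_T[OF K_diag[OF K_desusp[OF mult(1)]]]
      by (simp add: der_mult der_desusp plin_add[OF plin_g_lift] g_lift_mult I_add I_mult)
  qed
qed

lemma letter_CB:
  assumes "x \<in> X"
  shows "mon [x] \<in> CB"
proof -
  have "q (slice u v (mon [x])) = (0 :: _ \<Rightarrow>\<^sub>0 'k)" for u v
  proof (rule poly_mapping_eqI)
    fix m
    have "[x] \<noteq> u @ m @ v" if "length m = 2"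
    proof
      assume "[x] = u @ m @ v"
      then have "length [x] = length (u @ m @ v)" by (rule arg_cong)
      then show False using that by simp
    qed
    then show "lookup (q (slice u v (mon [x]))) m = lookup (0 :: _ \<Rightarrow>\<^sub>0 'k) m"
      by (simp add: lookup_single when_def)
  qed
  then show ?thesis
    using assms pm.subspace_0[OF S2_subspace] by (simp add: CB_iff dual_coalg_iff mon_in_T lookup_single)
qed

lemma K_emb:
  assumes "t \<in> T X"
  shows "emb t \<in> K"
proof -
  have "emb (mon w) \<in> K" if "set w \<subseteq> X" for w
  proof -
    have "(emb (mon w) :: _ \<Rightarrow>\<^sub>0 'k) = prod_list (map desusp (map (\<lambda>x. mon [x]) w))"
    proof (induction w)
      case (Cons x w)
      have "emb (mon (x # w) :: _ \<Rightarrow>\<^sub>0 'k) = mon [[x]] * emb (mon w)" by (simp add: emb_mon)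
      then show ?case unfolding Cons.IH by simp
    next
      case Nil
      have "(emb (mon []) :: _ \<Rightarrow>\<^sub>0 'k) = mon []" by (simp add: emb_mon del: mon_Nil)
      then show ?case by simp
    qed
    moreover have "set (map (\<lambda>x. mon [x]) w) \<subseteq> CB" using that letter_CB by auto
    ultimately show ?thesis using K_prod by metis
  qed
  moreover have "emb t = (\<Sum>w\<in>keys t. scal (lookup t w) (emb (mon w)))"
    by (rule plin_expand[OF plin_emb])
  moreover have "set w \<subseteq> X" if "w \<in> keys t" for w
    using assms that by (auto simp: T_iff in_keys_iff)
  ultimately show ?thesis
    by (simp add: pm.subspace_sum[OF K_subspace] pm.subspace_scale[OF K_subspace])
qed

lemma emb_g_lift:
  assumes "z \<in> K"
  shows "emb (g_lift z) = component (\<lambda>W. syz W = 0) z"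
proof (rule plin_eq_on[of "\<lambda>z. emb (g_lift z)" "component (\<lambda>W. syz W = 0)" z])
  fix W assume "W \<in> keys z"
  then have "[] \<notin> set W" by (rule K_keys_nonempty[OF assms])
  moreover have "component (\<lambda>W. syz W = 0) (mon W :: _ \<Rightarrow>\<^sub>0 'k) = (if syz W = 0 then mon W else 0)"
    by (auto intro!: poly_mapping_eqI simp: lookup_single when_def)
  ultimately show "emb (g_lift (mon W)) = component (\<lambda>W. syz W = 0) (mon W :: _ \<Rightarrow>\<^sub>0 'k)"
    by (simp add: emb_g_lift_mon)
qed (intro plin_intros plin_component)+

lemma component_der_gen2:
  "component (\<lambda>W. P (wt W) (Suc (syz W))) (der gen2 x) = der gen2 (component (\<lambda>W. P (wt W) (syz W)) x)"
proof (rule plin_eq[of "\<lambda>x. component (\<lambda>W. P (wt W) (Suc (syz W))) (der gen2 x)"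
    "\<lambda>x. der gen2 (component (\<lambda>W. P (wt W) (syz W)) x)" x])
  fix W
  have "component (\<lambda>W. P (wt W) (syz W)) (mon W :: _ \<Rightarrow>\<^sub>0 'k) = (if P (wt W) (syz W) then mon W else 0)"
    by (auto intro!: poly_mapping_eqI simp: lookup_single when_def)
  moreover have "component (\<lambda>W. P (wt W) (Suc (syz W))) (der gen2 (mon W)) =
      (if P (wt W) (syz W) then der gen2 (mon W) else 0)"
  proof (rule poly_mapping_eqI)
    fix W'
    show "lookup (component (\<lambda>W. P (wt W) (Suc (syz W))) (der gen2 (mon W))) W' =
      lookup (if P (wt W) (syz W) then der gen2 (mon W) else 0) W'"
    proof (cases "W' \<in> keys (der gen2 (mon W))")
      case True
      then show ?thesis using keys_der_gen2[OF True] by auto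
    qed (auto simp: in_keys_iff)
  qed
  ultimately show "component (\<lambda>W. P (wt W) (Suc (syz W))) (der gen2 (mon W)) =
      der gen2 (component (\<lambda>W. P (wt W) (syz W)) (mon W))"
    by (simp add: plin_0[OF plin_der])
qed (intro plin_intros)+

lemma K_component_wt_syz:
  assumes "x \<in> K"
  shows "component (\<lambda>W. P (wt W) (syz W)) x \<in> K"
  using K_component[OF assms, of "\<lambda>l. P (sum_list l) (sum_list (map (\<lambda>n. n - 1) l))"]
  by (simp only: wt_def syz_def)

text \<open>The component \<open>top z\<close> of highest weight is a \<open>d\<^sub>2\<close>-cycle of positive syzygy degree; these
  are killed by \<open>g_lift\<close>, so it is the \<open>d\<^sub>2\<close>-boundary of some \<open>y\<close>.  Subtracting the full boundary
  of \<open>y\<close> leaves a cycle of smaller weight.\<close>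

lemma gen_exact:
  assumes "z \<in> K" "der gen z = 0" "\<And>W. W \<in> keys z \<Longrightarrow> 0 < syz W \<and> wt W < N"
  shows "\<exists>y\<in>K. der gen y = z"
  using assms
proof (induction N arbitrary: z)
  case 0
  then have "keys z = {}" by blast
  then have "z = 0" by simp
  then show ?case using K_zero plin_0[OF plin_der] by blast
next
  case (Suc N)
  define top :: "('x list list \<Rightarrow>\<^sub>0 'k) \<Rightarrow> _" where "top = component (\<lambda>W. wt W = N)"
  have plin_top: "plin top" unfolding top_def by (rule plin_component)
  have gen01_top: "top (der gen01 f) = 0" if "\<And>W. W \<in> keys f \<Longrightarrow> wt W < Suc N" for f
  proof (rule poly_mapping_eqI)
    fix W'
    have "wt W' \<noteq> N" if W': "W' \<in> keys (der gen01 f)"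
    proof -
      from plin_keys[OF plin_der W'] obtain W where "W \<in> keys f"
        "W' \<in> keys (der gen01 (mon W))" by blast
      then show ?thesis using keys_der_gen01[of W' W] \<open>\<And>W. W \<in> keys f \<Longrightarrow> wt W < Suc N\<close>[of W]
        by simp
    qed
    then show "lookup (top (der gen01 f)) W' = lookup 0 W'"
      by (auto simp: top_def in_keys_iff)
  qed
  have zt: "top z \<in> K" unfolding top_def using K_component_wt_syz[OF Suc.prems(1), of "\<lambda>p _. p = N"] .
  have "der gen2 (top z) = top (der gen2 z)"
    unfolding top_def by (rule component_der_gen2[of "\<lambda>p _. p = N", symmetric])
  also have "\<dots> = top (der gen z) - top (der gen01 z)"
    by (simp add: gen_gen01_gen2 plin_add[OF plin_top])
  also have "\<dots> = 0"
    using Suc.prems gen01_top[of z] plin_0[OF plin_top] by simp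
  finally have cyc: "der gen2 (top z) = 0" .
  have "g_lift (top z) = 0"
  proof (rule plin_eq_on[of g_lift "\<lambda>_. 0" "top z"])
    show "plin (\<lambda>_ :: 'x list list \<Rightarrow>\<^sub>0 'k. 0 :: 'x list \<Rightarrow>\<^sub>0 'k)" by (rule plinI) simp_all
    fix W assume W: "W \<in> keys (top z)"
    then have "W \<in> keys z" by (simp add: top_def in_keys_iff split: if_splits)
    then have "syz W \<noteq> 0" "[] \<notin> set W" using Suc.prems(3) K_keys_nonempty[OF Suc.prems(1)] by auto
    then have "emb (g_lift (mon W :: _ \<Rightarrow>\<^sub>0 'k)) = 0" by (simp add: emb_g_lift_mon)
    then show "g_lift (mon W) = (0 :: 'x list \<Rightarrow>\<^sub>0 'k)"
      using g_lift_emb[of "g_lift (mon W :: _ \<Rightarrow>\<^sub>0 'k)"] by (simp add: plin_0[OF plin_g_lift])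
  qed (rule plin_g_lift)
  then obtain y0 where y0: "y0 \<in> K" "der gen2 y0 = top z" using gen2_exact[OF zt cyc] by blast
  \<comment> \<open>syzygy degree at least two keeps the full boundary of \<open>y\<close> in positive degree\<close>
  define y where "y = component (\<lambda>W. wt W = N \<and> 2 \<le> syz W) y0"
  have yK: "y \<in> K" unfolding y_def using K_component_wt_syz[OF y0(1), of "\<lambda>p s. p = N \<and> 2 \<le> s"] .
  have "der gen2 y = component (\<lambda>W. wt W = N \<and> 2 \<le> Suc (syz W)) (top z)"
    unfolding y_def y0(2)[symmetric] by (rule component_der_gen2[of "\<lambda>p s. p = N \<and> 2 \<le> s", symmetric])
  also have "\<dots> = top z"
  proof (rule poly_mapping_eqI)
    fix W
    show "lookup (component (\<lambda>W. wt W = N \<and> 2 \<le> Suc (syz W)) (top z)) W = lookup (top z) W"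
      using Suc.prems(3)[of W] by (cases "W \<in> keys z") (auto simp: top_def in_keys_iff)
  qed
  finally have dy: "der gen2 y = top z" .
  have y_keys: "wt W = N \<and> 2 \<le> syz W" if "W \<in> keys y" for W
    using that by (simp add: y_def in_keys_iff split: if_splits)
  let ?z = "z - der gen y"
  have "0 < syz W \<and> wt W < N" if W: "W \<in> keys ?z" for W
  proof
    have "W \<in> keys z \<or> W \<in> keys (der gen y)"
      using subsetD[OF keys_diff W] by (rule Un_iff[THEN iffD1])
    then show "0 < syz W"
    proof
      assume "W \<in> keys (der gen y)"
      from plin_keys[OF plin_der this] obtain V where "V \<in> keys y"
        "W \<in> keys (der gen (mon V))" by blast
      then show ?thesis using keys_der_gen[of W V] y_keys[of V] by simp
    qed (use Suc.prems(3) in blast)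
    have "?z = (z - top z) - der gen01 y" using dy by (simp add: gen_gen01_gen2)
    with W have "W \<in> keys ((z - top z) - der gen01 y)" by simp
    from subsetD[OF keys_diff this] show "wt W < N"
    proof
      assume "W \<in> keys (z - top z)"
      then have "W \<in> keys z" "wt W \<noteq> N"
        by (auto simp: top_def in_keys_iff lookup_minus split: if_splits)
      then show ?thesis using Suc.prems(3)[of W] by simp
    next
      assume "W \<in> keys (der gen01 y)"
      from plin_keys[OF plin_der this] obtain V where "V \<in> keys y"
        "W \<in> keys (der gen01 (mon V))" by blast
      then show ?thesis using keys_der_gen01[of W V] y_keys[of V] by simp
    qed
  qed
  moreover have "?z \<in> K" using Suc.prems(1) K_gen[OF yK] by (rule K_minus)
  moreover have "der gen ?z = 0"
    using Suc.prems(2) gen_gen[OF yK] by (simp add: plin_diff[OF plin_der])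
  ultimately obtain y' where y': "y' \<in> K" "der gen y' = ?z" using Suc.IH by blast
  have "der gen (y' + y) = z" using y'(2) by (simp add: plin_add[OF plin_der])
  then show ?case using pm.subspace_add[OF K_subspace y'(1) yK] by blast
qed

text \<open>The tensors that are boundaries form a two-sided ideal, since \<open>T(V)\<close> consists of cycles, and
  this ideal contains the relation with quadratic part \<open>x\<close> as the boundary of \<open>s\<^sup>-\<^sup>1s\<^sup>2x\<close>.\<close>

lemma emb_relation_boundary:
  assumes "t \<in> I"
  shows "\<exists>y\<in>K. der gen y = emb t"
proof -
  define J where "J = {t \<in> T X. \<exists>y\<in>K. der gen y = emb t}"
  have "ideal J (tensor_algebra X)"
  proof (rule idealI[OF ring_tensor_algebra])
    show "subgroup J (add_monoid (tensor_algebra X))"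
    proof (rule group.subgroupI)
      show "Group.group (add_monoid (tensor_algebra X))"
        using ring.is_abelian_group[OF ring_tensor_algebra] abelian_group.a_group by blast
      show "J \<subseteq> carrier (add_monoid (tensor_algebra X))" by (auto simp: J_def)
      have "0 \<in> J" unfolding J_def
        by (intro CollectI conjI bexI[of _ 0] T_0 K_zero) (simp add: plin_0[OF plin_der] plin_0[OF plin_emb])
      then show "J \<noteq> {}" by blast
    next
      fix a assume a: "a \<in> J"
      then obtain y where y: "a \<in> T X" "y \<in> K" "der gen y = emb a" by (auto simp: J_def)
      have "inv\<^bsub>add_monoid (tensor_algebra X)\<^esub> a = - a"
        using y(1) T_neg[OF y(1)]
        by (intro group.inv_equality abelian_group.a_group ring.is_abelian_group ring_tensor_algebra) simp_all
      moreover have "- a \<in> J"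
        using y T_neg[OF y(1)] pm.subspace_neg[OF K_subspace y(2)] plin_neg[OF plin_der] plin_neg[OF plin_emb]
        unfolding J_def by (metis (mono_tags, lifting) mem_Collect_eq)
      ultimately show "inv\<^bsub>add_monoid (tensor_algebra X)\<^esub> a \<in> J" by simp
    next
      fix a b assume "a \<in> J" "b \<in> J"
      then obtain y y' where y: "a \<in> T X" "y \<in> K" "der gen y = emb a" "b \<in> T X" "y' \<in> K" "der gen y' = emb b"
        by (auto simp: J_def)
      then have "der gen (y + y') = emb (a + b)" by (simp add: plin_add[OF plin_der] plin_add[OF plin_emb])
      then have "a + b \<in> J" using y T_add pm.subspace_add[OF K_subspace y(2,5)] unfolding J_def by blast
      then show "a \<otimes>\<^bsub>add_monoid (tensor_algebra X)\<^esub> b \<in> J" by simp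
    qed
  next
    fix a x :: "'x list \<Rightarrow>\<^sub>0 'k" assume "a \<in> J" and x: "x \<in> carrier (tensor_algebra X)"
    then obtain y where y: "a \<in> T X" "y \<in> K" "der gen y = emb a" by (auto simp: J_def)
    have xT: "x \<in> T X" using x by simp
    \<comment> \<open>the involution compensates the sign in the Leibniz rule\<close>
    let ?e = "diag csg (emb x)"
    have e: "der gen ?e = 0" unfolding diag_csg_emb by (rule der_gen_emb)
    have "der gen (?e * y) = emb (x * a)"
      by (simp add: der_mult e diag_csg_diag_csg y(3) emb_mult)
    moreover have "?e * y \<in> K" using K_mult[OF K_diag[OF K_emb[OF xT]] y(2)] .
    ultimately have "x * a \<in> J" using T_mult[OF xT y(1)] unfolding J_def by blast
    then show "x \<otimes>\<^bsub>tensor_algebra X\<^esub> a \<in> J" by simp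
    have "der gen (y * emb x) = emb (a * x)"
      by (simp add: der_mult der_gen_emb y(3) emb_mult)
    moreover have "y * emb x \<in> K" using K_mult[OF y(2) K_emb[OF xT]] .
    ultimately have "a * x \<in> J" using T_mult[OF y(1) xT] unfolding J_def by blast
    then show "a \<otimes>\<^bsub>tensor_algebra X\<^esub> x \<in> J" by simp
  qed
  moreover have "R \<subseteq> J"
  proof
    fix r assume r: "r \<in> R"
    define s where "s = susp2 deg (q r)"
    have s: "s \<in> S2" unfolding s_def using r by blast
    have sCB: "s \<in> CB" using S2_C[OF s] S2_Tpow[OF s] by (force simp: CB_iff Tpow_iff)
    have "q (rel s) = q r"
    proof -
      have "q (rel s) = q (susp2 deg s)"
      proof (rule poly_mapping_eqI)
        fix w :: "'x list"
        have "length w = 2 \<Longrightarrow> w \<noteq> []" by auto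
        then show "lookup (q (rel s)) w = lookup (q (susp2 deg s)) w"
          by (simp add: rel_def lookup_minus lookup_add lookup_lin_gam lookup_lin_tht)
      qed
      also have "\<dots> = q r" unfolding s_def susp2_susp2 by (rule poly_mapping_eqI) simp
      finally show ?thesis .
    qed
    then have rel: "rel (q s) = r" using q_inj[OF rel_R[OF s] r] S2_q[OF s] by simp
    have "lin gen s = component (\<lambda>W. syz W = 0) (lin gen s)"
    proof (rule poly_mapping_eqI)
      fix W
      have "syz W = 0" if "W \<in> keys (lin gen s)"
      proof -
        from subsetD[OF keys_lin that] obtain w where w: "w \<in> keys s" "W \<in> keys (gen w)"
          by (rule UN_E)
        have "length w = 2" using S2_Tpow[OF s] w(1) by (simp add: Tpow_iff in_keys_iff)
        then show ?thesis using keys_gen(1)[OF w(2)] by simp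
      qed
      then show "lookup (lin gen s) W = lookup (component (\<lambda>W. syz W = 0) (lin gen s)) W"
        by (cases "W \<in> keys (lin gen s)") (simp_all add: in_keys_iff)
    qed
    also have "\<dots> = emb r"
      using emb_g_lift[OF K_lin_gen[OF sCB]] by (simp add: g_lift_gen rel)
    finally have "der gen (desusp s) = emb r" by (simp add: der_desusp)
    then show "r \<in> J" using K_desusp[OF sCB] R_T r unfolding J_def by blast
  qed
  ultimately have "I \<subseteq> J" by (rule ring.genideal_minimal[OF ring_tensor_algebra])
  then show ?thesis using assms by (auto simp: J_def)
qed

lemma quasi_iso_g_kappa:
  "quasi_iso (cobar X deg R) (cobar_diff X deg R) (QLC_algebra X R) (\<lambda>_. \<zero>\<^bsub>QLC_algebra X R\<^esub>) (g_kappa X R)"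
proof -
  let ?A = "QLC_algebra X R" and ?D = "cobar_diff X deg R" and ?g = "g_kappa X R"
  have A: "ring ?A" unfolding QLC_algebra_def by (rule ideal.quotient_is_ring[OF ideal_I])
  have hom: "(+>\<^bsub>tensor_algebra X\<^esub>) I \<in> ring_hom (tensor_algebra X) ?A"
    unfolding QLC_algebra_def by (rule ideal.rcos_ring_hom[OF ideal_I])
  have zero: "\<zero>\<^bsub>?A\<^esub> = I" by (simp add: QLC_algebra_def FactRing_def)
  have coset_zero: "I +>\<^bsub>tensor_algebra X\<^esub> t = \<zero>\<^bsub>?A\<^esub> \<longleftrightarrow> t \<in> I" if "t \<in> T X" for t
  proof
    assume "I +>\<^bsub>tensor_algebra X\<^esub> t = \<zero>\<^bsub>?A\<^esub>"
    then show "t \<in> I" using ideal.rcos_const_imp_mem[OF ideal_I, of t] that by (simp add: zero)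
  next
    assume "t \<in> I"
    then show "I +>\<^bsub>tensor_algebra X\<^esub> t = \<zero>\<^bsub>?A\<^esub>"
      unfolding zero
      using abelian_subgroup.a_rcos_const[OF abelian_subgroupI3[OF ideal.axioms(1)[OF ideal_I]
          ring.is_abelian_group[OF ring_tensor_algebra]]] by simp
  qed
  have D: "?D x = der gen x" if "x \<in> K" for x by (rule cobar_diff_der[OF that])
  have cm: "chain_map (subalgebra_ring K) ?D ?A (\<lambda>_. \<zero>\<^bsub>?A\<^esub>) ?g"
    unfolding chain_map_def chain_complex_def
  proof (intro conjI ballI)
    show "abelian_group (subalgebra_ring K)" using abelian_group_cobar by (simp add: cobar_def)
    show "?D \<in> carrier (subalgebra_ring K) \<rightarrow> carrier (subalgebra_ring K)"
      using K_gen by (simp add: D)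
    show "abelian_group ?A" by (rule ring.is_abelian_group[OF A])
    then interpret A: abelian_group ?A .
    show "(\<lambda>_. \<zero>\<^bsub>?A\<^esub>) \<in> carrier ?A \<rightarrow> carrier ?A" by simp
    show "\<zero>\<^bsub>?A\<^esub> = \<zero>\<^bsub>?A\<^esub> \<oplus>\<^bsub>?A\<^esub> \<zero>\<^bsub>?A\<^esub>" by simp
    show "?g \<in> carrier (subalgebra_ring K) \<rightarrow> carrier ?A"
      using K_g_lift_T ring_hom_closed[OF hom] by (simp add: g_kappa_def)
  next
    fix x assume x: "x \<in> carrier (subalgebra_ring K)"
    then have xK: "x \<in> K" by simp
    show "?D (?D x) = \<zero>\<^bsub>subalgebra_ring K\<^esub>" using D[OF xK] D[OF K_gen[OF xK]] gen_gen[OF xK] by simp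
    show "?g (?D x) = \<zero>\<^bsub>?A\<^esub>"
      using coset_zero[OF K_g_lift_T[OF K_gen[OF xK]]] g_lift_der_gen[OF xK] D[OF xK] by (simp add: g_kappa_def)
    fix y assume y: "y \<in> carrier (subalgebra_ring K)"
    then have yK: "y \<in> K" by simp
    show "?D (x \<oplus>\<^bsub>subalgebra_ring K\<^esub> y) = ?D x \<oplus>\<^bsub>subalgebra_ring K\<^esub> ?D y"
      using pm.subspace_add[OF K_subspace xK yK] by (simp add: D xK yK plin_add[OF plin_der])
    show "?g (x \<oplus>\<^bsub>subalgebra_ring K\<^esub> y) = ?g x \<oplus>\<^bsub>?A\<^esub> ?g y"
      using ring_hom_add[OF hom, of "g_lift x" "g_lift y"] K_g_lift_T[OF xK] K_g_lift_T[OF yK]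
      by (simp add: g_kappa_def plin_add[OF plin_g_lift])
  qed simp_all
  have inj: "z \<in> ?D ` K" if z: "z \<in> K" "?D z = 0" "?g z = \<zero>\<^bsub>?A\<^esub>" for z
  proof -
    \<comment> \<open>first remove the component of syzygy degree zero, then use exactness in positive degree\<close>
    have "g_lift z \<in> I" using coset_zero[OF K_g_lift_T[OF z(1)]] z(3) by (simp add: g_kappa_def)
    then obtain y where y: "y \<in> K" "der gen y = emb (g_lift z)" using emb_relation_boundary by blast
    let ?z = "z - der gen y"
    have zK: "?z \<in> K" using z(1) K_gen[OF y(1)] by (rule K_minus)
    have "der gen ?z = 0" using z(1,2) gen_gen[OF y(1)] by (simp add: D plin_diff[OF plin_der])
    moreover have "?z = z - component (\<lambda>W. syz W = 0) z" using y(2) emb_g_lift[OF z(1)] by simp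
    then have pos: "0 < syz W" if "W \<in> keys ?z" for W
      using that by (auto simp: in_keys_iff lookup_minus split: if_splits)
    moreover obtain N where "\<And>W. W \<in> keys ?z \<Longrightarrow> wt W < N"
    proof -
      have "finite (wt ` keys ?z)" by simp
      then obtain N where "\<forall>n\<in>wt ` keys ?z. n < N" using finite_nat_set_iff_bounded by blast
      then show ?thesis using that by blast
    qed
    ultimately obtain y' where y': "y' \<in> K" "der gen y' = ?z" using gen_exact[OF zK] by blast
    have yy: "y' + y \<in> K" by (rule pm.subspace_add[OF K_subspace y'(1) y(1)])
    have "?D (y' + y) = z" unfolding D[OF yy] plin_add[OF plin_der] y'(2) by simp
    then show ?thesis using yy by blast
  qed
  have surj: "\<exists>z\<in>K. ?D z = 0 \<and> ?g z = a" if "a \<in> carrier ?A" for a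
  proof -
    obtain t where t: "t \<in> T X" "a = I +>\<^bsub>tensor_algebra X\<^esub> t"
      using \<open>a \<in> carrier ?A\<close> by (auto simp: QLC_algebra_def FactRing_def A_RCOSETS_def')
    have "?D (emb t) = 0" using D[OF K_emb[OF t(1)]] by (simp add: der_gen_emb)
    moreover have "?g (emb t) = a" using t(2) by (simp add: g_kappa_def g_lift_emb)
    ultimately show ?thesis using K_emb[OF t(1)] by blast
  qed
  show ?thesis unfolding cobar_def
    using quasi_iso_onto_zero_differential[OF cm K_zero K_closed_minus] inj surj by blast
qed

end

theorem theorem3p1:
  fixes X :: "'x set" and deg :: "'x \<Rightarrow> nat"
    and R :: "('x list \<Rightarrow>\<^sub>0 'k::field_char_0) set"
  assumes "QLC_datum X deg R"
    and "qA_Koszul X deg R"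
  shows "quasi_iso (cobar X deg R) (cobar_diff X deg R)
    (QLC_algebra X R) (\<lambda>_. \<zero>\<^bsub>QLC_algebra X R\<^esub>) (g_kappa X R)"
proof -
  interpret qlc X deg R by (rule qlc.intro) (rule assms(1))
  show ?thesis
  proof (rule homogeneous_extensions)
    fix gam tht :: "'x list \<Rightarrow> ('x list \<Rightarrow>\<^sub>0 'k)"
    assume "\<And>w. length w \<noteq> 2 \<Longrightarrow> gam w = 0" "\<And>w. length w \<noteq> 2 \<Longrightarrow> tht w = 0"
      "\<And>w u. u \<in> keys (gam w) \<Longrightarrow> \<exists>x\<in>X. u = [x] \<and> deg x = vdeg deg w"
      "\<And>w u. u \<in> keys (tht w) \<Longrightarrow> u = [] \<and> vdeg deg w = 0"
      "\<And>c. c \<in> dual_coalg X deg R \<Longrightarrow> lin gam c = phi X R (susp2 deg (q c))"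
      "\<And>c. c \<in> dual_coalg X deg R \<Longrightarrow> lin tht c = single [] (theta_tilde X deg R c)"
    then interpret koszul_words X deg R gam tht
      using assms(2) by unfold_locales
    show ?thesis by (rule quasi_iso_g_kappa)
  qed
qed

end
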